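(* Let $m\ge1$ and $g\in\mathrm{Gal}_k[m]$. Then, in $\mathrm{GL}(r;\mathbb Z_l[[\mathfrak F_r]]/I^{m+1})$, where $I$ is the augmentation ideal of $\mathbb Z_l[[\mathfrak F_r]]$ (and on the right-hand side the first summand is the identity matrix), $$\mathrm M_S^{[m]}(g)=\mathrm{Id}+\overline{\|\tau_S^{[m]}(g)\|}.$$
   Context: Setup. Fix a prime $l$ and $r\ge2$. $\mathfrak F_r$ is the free pro-$l$ group on $x_1,\dots,x_r$, and $x_{r+1}:=(x_1\cdots x_r)^{-1}$. $S=(P_1,\dots,P_{r+1})$ is an ordered set of distinct $\overline{\mathbb Q}$-rational points of $\mathbb P^1$ ($\overline{\mathbb Q}\subset\mathbb C$) with $P_1=0,P_2=1,P_{r+1}=\infty$; $k=\mathbb Q(S\setminus\{\infty\})$ is the number field generated by the coordinates of $P_1,\dots,P_r$; $\mathrm{Gal}_k=\mathrm{Gal}(\overline{\mathbb Q}/k)$; $\chi_l:\mathrm{Gal}_k\to\mathbb Z_l^\times$ is the $l$-cyclotomic character. The maximal pro-$l$ quotient of the étale fundamental group of $\mathbb P^1_{\overline{\mathbb Q}}\setminus S$ is identified with $\mathfrak F_r$, $x_i$ being the class of a small loop around $P_i$; the monodromy action of $\mathrm{Gal}_k$ gives $\Phi_S:\mathrm{Gal}_k\to\mathrm{Out}(\mathfrak F_r)$. Let $P(\mathfrak F_r)$ be the group of $\varphi\in\mathrm{Aut}(\mathfrak F_r)$ for which there is $N(\varphi)\in\mathbb Z_l^\times$ such that $\varphi(x_i)$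 is conjugate to $x_i^{N(\varphi)}$ for $1\le i\le r-1$, $\varphi(x_r)$ is conjugate to $x_r^{N(\varphi)}$ by an element of the subgroup generated by $[\mathfrak F_r,\mathfrak F_r]$ and $x_1,\dots,x_{r-2}$, and $\varphi(x_{r+1})=x_{r+1}^{N(\varphi)}$. Each $\Phi_S(g)$ has a unique representative $\mathrm{Ih}_S(g)\in P(\mathfrak F_r)$; $\mathrm{Ih}_S:\mathrm{Gal}_k\to P(\mathfrak F_r)$ is a continuous homomorphism (the Ihara representation) with $N(\mathrm{Ih}_S(g))=\chi_l(g)$. Filtration and Johnson homomorphisms. $H=\mathfrak F_r/[\mathfrak F_r,\mathfrak F_r]$ is the free $\mathbb Z_l$-module with basis $X_i=[x_i]$. $\widehat T(H)=\prod_{n\ge0}H^{\otimes n}$, and $\Theta:\mathbb Z_l[[\mathfrak F_r]]\to\widehat T(H)$ is the topological algebra isomorphism $x_i\mapsto1+X_i$; it induces isomorphisms $\Theta_n:\mathrm{gr}_n(\mathbb Z_l[[\mathfrak F_r]]):=I^n/I^{n+1}\simeq H^{\otimes n}$. $\mathfrak F_r(1)=\mathfrak F_r$, $\mathfrak F_r(n+1)=[\mathfrak F_r(n),\mathfrak F_r]$ (closed commutator subgroups); $\mathrm{Gal}_k[n]:=\{g\in\mathrm{Gal}_k:\mathrm{Ih}_S(g)(f)f^{-1}\in\mathfrak F_r(n+1)\ \text{for all } f\in\mathfrak F_r\}$. $[\mathrm{Ih}_S(g)]$ is the automorphism of $H$ induced by $\mathrm{Ih}_S(g)$, and $\mathrm{Ih}_S(g)^*:=\Theta\circ\mathrm{Ih}_S(g)\circ\Theta^{-1}$.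 $\tau_S(g):=\mathrm{Ih}_S(g)^*\circ[\mathrm{Ih}_S(g)]^{-1}|_H-\mathrm{id}_H\in\mathrm{Hom}_{\mathbb Z_l}(H,\prod_{n\ge2}H^{\otimes n})$; $\tau_S^{(m)}(g)\in\mathrm{Hom}_{\mathbb Z_l}(H,H^{\otimes(m+1)})$ is its degree $m+1$ component; $\tau_S^{[m]}:=\tau_S^{(m)}|_{\mathrm{Gal}_k[m]}$. Fox calculus and Magnus cocycle. The pro-$l$ Fox derivatives $\partial/\partial x_j:\mathbb Z_l[[\mathfrak F_r]]\to\mathbb Z_l[[\mathfrak F_r]]$ are the continuous $\mathbb Z_l$-linear maps determined by $\alpha=\epsilon(\alpha)+\sum_j\frac{\partial\alpha}{\partial x_j}(x_j-1)$ ($\epsilon$ the augmentation); they induce maps $I^{n+1}/I^{n+2}\to I^n/I^{n+1}$. The bar denotes the anti-automorphism of $\mathbb Z_l[[\mathfrak F_r]]$ induced by $f\mapsto f^{-1}$ (and the induced map on quotients and entrywise on matrices). The pro-$l$ Magnus cocycle is $\mathrm M_S(g):=\left(\overline{\partial\,\mathrm{Ih}_S(g)(x_j)/\partial x_i}\right)_{i,j}\in\mathrm{GL}(r;\mathbb Z_l[[\mathfrak F_r]])$, and $\mathrm M_S^{[m]}(g)$, $g\in\mathrm{Gal}_k[m]$, is its reduction modulo $I^{m+1}$. For $\tau\in\mathrm{Hom}_{\mathbb Z_l}(H,H^{\otimes(m+1)})$, $\|\tau\|:=\left(\frac{\partial(\Theta_{m+1}^{-1}\circ\tau)(X_j)}{\partial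 x_i}\right)_{i,j}\in\mathrm M(r;I^m/I^{m+1})$, viewed in $\mathrm M(r;\mathbb Z_l[[\mathfrak F_r]]/I^{m+1})$. *)

theory Defs
  imports "HOL-Complex_Analysis.Complex_Analysis" "HOL-Algebra.Algebra"
    "HOL-Algebra.Algebraic_Closure_Type"
begin

section \<open>The \<open>l\<close>-adic integers\<close>

text \<open>The inverse limit of the rings \<open>\<int>/l\<^sup>n\<close>; the \<open>n\<close>-th entry of a sequence is the
  representative in \<open>{0..<l\<^sup>n}\<close>.\<close>

definition Zl :: "nat \<Rightarrow> (nat \<Rightarrow> int) ring" where
  "Zl l = \<lparr>carrier = {a. \<forall>n. a n \<in> {0..<int l ^ n} \<and> a (Suc n) mod int l ^ n = a n},
           mult = (\<lambda>a b n. (a n * b n) mod int l ^ n),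
           one = (\<lambda>n. 1 mod int l ^ n),
           ring.zero = (\<lambda>n. 0),
           add = (\<lambda>a b n. (a n + b n) mod int l ^ n)\<rparr>"

definition Zl_topology :: "nat \<Rightarrow> (nat \<Rightarrow> int) topology" where
  "Zl_topology l =
     subtopology (product_topology (\<lambda>n. discrete_topology UNIV) UNIV) (carrier (Zl l))"


section \<open>Pro-\<open>l\<close> groups\<close>

definition topological_group :: "'a monoid \<Rightarrow> 'a topology \<Rightarrow> bool" where
  "topological_group G T \<longleftrightarrow>
     group G \<and> topspace T = carrier G \<and>
     continuous_map (prod_topology T T) T (\<lambda>(a, b). a \<otimes>\<^bsub>G\<^esub> b) \<and>
     continuous_map T T (\<lambda>a. inv\<^bsub>G\<^esub> a)"

definition profinite_group :: "'a monoid \<Rightarrow> 'a topology \<Rightarrow> bool" where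
  "profinite_group G T \<longleftrightarrow>
     topological_group G T \<and> compact_space T \<and> Hausdorff_space T \<and>
     (\<forall>a\<in>carrier G. connected_component_of_set T a = {a})"

definition open_normal :: "'a monoid \<Rightarrow> 'a topology \<Rightarrow> 'a set set" where
  "open_normal G T = {N. N \<lhd> G \<and> openin T N}"

definition pro_l_group :: "nat \<Rightarrow> 'a monoid \<Rightarrow> 'a topology \<Rightarrow> bool" where
  "pro_l_group l G T \<longleftrightarrow>
     profinite_group G T \<and> (\<forall>N\<in>open_normal G T. \<exists>n. card (rcosets\<^bsub>G\<^esub> N) = l ^ n)"

text \<open>Universal property. A pro-\<open>l\<close> group topologically generated by \<open>r\<close> elements has at most
  the cardinality of the continuum, so a copy of it exists on the type \<open>nat \<Rightarrow> nat\<close>;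
  letting \<open>Q\<close> range over groups on this type therefore loses nothing.\<close>

definition free_pro_l_group ::
    "nat \<Rightarrow> nat \<Rightarrow> 'a monoid \<Rightarrow> 'a topology \<Rightarrow> (nat \<Rightarrow> 'a) \<Rightarrow> bool" where
  "free_pro_l_group l r F T x \<longleftrightarrow>
     pro_l_group l F T \<and> x \<in> {1..r} \<rightarrow> carrier F \<and>
     (\<forall>(Q :: (nat \<Rightarrow> nat) monoid) TQ q.
        pro_l_group l Q TQ \<and> q \<in> {1..r} \<rightarrow> carrier Q \<longrightarrow>
        (\<exists>!h. h \<in> hom F Q \<inter> extensional (carrier F) \<and> continuous_map T TQ h \<and>
              (\<forall>i\<in>{1..r}. h (x i) = q i)))"

definition topologically_generated :: "'a monoid \<Rightarrow> 'a topology \<Rightarrow> 'a set \<Rightarrow> 'a set" where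
  "topologically_generated G T A = T closure_of (generate G A)"

text \<open>\<open>lcs F T n\<close> is \<open>F(n)\<close>; the index starts at 1 and the value at 0 is irrelevant.\<close>

fun lcs :: "'a monoid \<Rightarrow> 'a topology \<Rightarrow> nat \<Rightarrow> 'a set" where
  "lcs G T 0 = carrier G"
| "lcs G T (Suc 0) = carrier G"
| "lcs G T (Suc (Suc n)) = topologically_generated G T
     {a \<otimes>\<^bsub>G\<^esub> b \<otimes>\<^bsub>G\<^esub> inv\<^bsub>G\<^esub> a \<otimes>\<^bsub>G\<^esub> inv\<^bsub>G\<^esub> b | a b. a \<in> lcs G T (Suc n) \<and> b \<in> carrier G}"

definition Zl_pow :: "'a monoid \<Rightarrow> 'a topology \<Rightarrow> 'a \<Rightarrow> (nat \<Rightarrow> int) \<Rightarrow> 'a" where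
  "Zl_pow G T a N = (THE y. limitin T (\<lambda>n. a [^]\<^bsub>G\<^esub> N n) y sequentially)"

definition ordered_prod :: "'a monoid \<Rightarrow> nat \<Rightarrow> (nat \<Rightarrow> 'a) \<Rightarrow> 'a" where
  "ordered_prod G r y = foldr (\<lambda>i z. y i \<otimes>\<^bsub>G\<^esub> z) [1..<Suc r] \<one>\<^bsub>G\<^esub>"

text \<open>\<open>x\<^sub>1, \<dots>, x\<^sub>r\<close> extended by \<open>x\<^sub>r\<^sub>+\<^sub>1 = (x\<^sub>1 \<cdots> x\<^sub>r)\<^sup>-\<^sup>1\<close>.\<close>

definition loop_gen :: "'a monoid \<Rightarrow> nat \<Rightarrow> (nat \<Rightarrow> 'a) \<Rightarrow> nat \<Rightarrow> 'a" where
  "loop_gen G r x i = (if i \<le> r then x i else inv\<^bsub>G\<^esub> (ordered_prod G r x))"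

definition top_auto :: "'a monoid \<Rightarrow> 'a topology \<Rightarrow> ('a \<Rightarrow> 'a) set" where
  "top_auto G T = {\<phi> \<in> auto G. homeomorphic_map T T \<phi>}"

text \<open>The group \<open>P(F)\<close>. The subgroup from which the conjugator of \<open>x\<^sub>r\<close> is taken is understood,
  as always for profinite groups, to be the closed one.\<close>

definition P_group ::
    "nat \<Rightarrow> nat \<Rightarrow> 'a monoid \<Rightarrow> 'a topology \<Rightarrow> (nat \<Rightarrow> 'a) \<Rightarrow> ('a \<Rightarrow> 'a) set" where
  "P_group l r F T x = {\<phi> \<in> top_auto F T. \<exists>N\<in>Units (Zl l).
     (\<forall>i\<in>{1..r - 1}. \<exists>a\<in>carrier F. \<phi> (x i) = a \<otimes>\<^bsub>F\<^esub> Zl_pow F T (x i) N \<otimes>\<^bsub>F\<^esub> inv\<^bsub>F\<^esub> a) \<and>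
     (\<exists>a\<in>topologically_generated F T (lcs F T 2 \<union> x ` {1..r - 2}).
        \<phi> (x r) = a \<otimes>\<^bsub>F\<^esub> Zl_pow F T (x r) N \<otimes>\<^bsub>F\<^esub> inv\<^bsub>F\<^esub> a) \<and>
     \<phi> (loop_gen F r x (r + 1)) = Zl_pow F T (loop_gen F r x (r + 1)) N}"


section \<open>Fields and Galois groups\<close>

text \<open>Subfields of a type of class \<open>field\<close>, with the notions of the algebra library.\<close>

abbreviation UNIV_ring :: "'k::field ring" where
  "UNIV_ring \<equiv> ring_of_type_algebra"

definition galois_group :: "'k::field set \<Rightarrow> 'k set \<Rightarrow> ('k \<Rightarrow> 'k) monoid" where
  "galois_group L K = (BijGroup L)\<lparr>carrier :=
     {\<sigma> \<in> Bij L. \<sigma> \<in> ring_hom (UNIV_ring\<lparr>carrier := L\<rparr>) (UNIV_ring\<lparr>carrier := L\<rparr>) \<and>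
                 (\<forall>a\<in>K. \<sigma> a = a)}\<rparr>"

definition krull_topology :: "'k::field set \<Rightarrow> 'k set \<Rightarrow> ('k \<Rightarrow> 'k) topology" where
  "krull_topology L K =
     subtopology (product_topology (\<lambda>_. discrete_topology L) L) (carrier (galois_group L K))"

definition finite_galois :: "'k::field set \<Rightarrow> 'k set \<Rightarrow> bool" where
  "finite_galois L K \<longleftrightarrow>
     subfield K UNIV_ring \<and> subfield L UNIV_ring \<and> K \<subseteq> L \<and>
     ring.finite_dimension UNIV_ring K L \<and>
     {a \<in> L. \<forall>\<sigma>\<in>carrier (galois_group L K). \<sigma> a = a} = K"

definition discrete_valuation :: "'k::field set \<Rightarrow> ('k \<Rightarrow> int) \<Rightarrow> bool" where
  "discrete_valuation L v \<longleftrightarrow>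
     (\<forall>a\<in>L - {0}. \<forall>b\<in>L - {0}. v (a * b) = v a + v b) \<and>
     (\<forall>a\<in>L - {0}. \<forall>b\<in>L - {0}. a + b \<noteq> 0 \<longrightarrow> min (v a) (v b) \<le> v (a + b)) \<and>
     v ` (L - {0}) = UNIV"


section \<open>The punctured line and its pro-\<open>l\<close> fundamental group\<close>

abbreviation Qbar :: "complex set" where
  "Qbar \<equiv> {z. algebraic z}"

text \<open>The points \<open>P\<^sub>1, \<dots>, P\<^sub>r\<close>; the last point is always \<open>\<infinity>\<close>.\<close>

definition branch_points :: "nat \<Rightarrow> (nat \<Rightarrow> complex) \<Rightarrow> bool" where
  "branch_points r P \<longleftrightarrow>
     P 1 = 0 \<and> P 2 = 1 \<and> inj_on P {1..r} \<and> P ` {1..r} \<subseteq> Qbar"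

definition base_field :: "nat \<Rightarrow> (nat \<Rightarrow> complex) \<Rightarrow> complex set" where
  "base_field r P = generate_field UNIV_ring (P ` {1..r})"

definition Gal_k :: "nat \<Rightarrow> (nat \<Rightarrow> complex) \<Rightarrow> (complex \<Rightarrow> complex) monoid" where
  "Gal_k r P = galois_group Qbar (base_field r P)"

text \<open>The coordinate \<open>t\<close> of the projective line and the function field \<open>Qbar(t)\<close>, realised in
  the field of Laurent series around a base point \<open>b\<close>.\<close>

definition coord :: "complex \<Rightarrow> complex fls" where
  "coord b = fls_const b + fls_X"

definition function_field :: "complex \<Rightarrow> complex fls set" where
  "function_field b = generate_field UNIV_ring (insert (coord b) (fls_const ` Qbar))"

text \<open>In characteristic 0, and with algebraically closed residue field, an extension is
  unramified over the point \<open>t = a\<close> iff all ramification indices over it are 1. The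
  ramification index of a normalised valuation \<open>v\<close> over that point is \<open>v (t - a)\<close>.\<close>

definition unramified_outside :: "complex \<Rightarrow> complex set \<Rightarrow> complex fls set \<Rightarrow> bool" where
  "unramified_outside b S L \<longleftrightarrow>
     (\<forall>a\<in>Qbar - S. \<forall>v. discrete_valuation L v \<and> v (coord b - fls_const a) > 0 \<longrightarrow>
                        v (coord b - fls_const a) = 1)"

text \<open>The maximal pro-\<open>l\<close> extension of \<open>Qbar(t)\<close> unramified outside \<open>P\<^sub>1, \<dots>, P\<^sub>r, \<infinity>\<close>.
  As \<open>b\<close> is not a branch point, every finite extension of this kind splits completely over the
  field of Laurent series at \<open>b\<close>, so forming the union inside that field gives all of it. The
  Galois group of this extension is the maximal pro-\<open>l\<close> quotient of the etale fundamental
  group of the punctured line over \<open>Qbar\<close>.\<close>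

definition max_pro_l_ext :: "nat \<Rightarrow> nat \<Rightarrow> (nat \<Rightarrow> complex) \<Rightarrow> complex \<Rightarrow> complex fls set" where
  "max_pro_l_ext l r P b = \<Union> {L. finite_galois L (function_field b) \<and>
     (\<exists>n. ring.dimension UNIV_ring (l ^ n) (function_field b) L) \<and>
     unramified_outside b (P ` {1..r}) L}"

definition pi1 :: "nat \<Rightarrow> nat \<Rightarrow> (nat \<Rightarrow> complex) \<Rightarrow> complex \<Rightarrow> (complex fls \<Rightarrow> complex fls) monoid"
  where "pi1 l r P b = galois_group (max_pro_l_ext l r P b) (function_field b)"

definition pi1_topology ::
    "nat \<Rightarrow> nat \<Rightarrow> (nat \<Rightarrow> complex) \<Rightarrow> complex \<Rightarrow> (complex fls \<Rightarrow> complex fls) topology"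
  where "pi1_topology l r P b = krull_topology (max_pro_l_ext l r P b) (function_field b)"

text \<open>\<open>f'\<close> is the (meromorphic) continuation of the germ \<open>f\<close> along \<open>\<gamma>\<close>; \<open>G s\<close> is the
  germ at \<open>\<gamma> s\<close>.\<close>

definition continuation :: "(real \<Rightarrow> complex) \<Rightarrow> complex fls \<Rightarrow> complex fls \<Rightarrow> bool" where
  "continuation \<gamma> f f' \<longleftrightarrow>
     (\<exists>G. G 0 = f \<and> G 1 = f' \<and>
        (\<forall>s\<in>{0..1}. \<exists>h. \<exists>\<delta>>0. \<forall>s'\<in>{0..1}. \<bar>s' - s\<bar> < \<delta> \<longrightarrow>
            (\<lambda>z. h (\<gamma> s' + z)) has_laurent_expansion G s'))"

text \<open>A path from \<open>b\<close>, a small positively oriented circle around \<open>P\<^sub>i\<close>, and the path back. For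
  \<open>i = r + 1\<close> the circle surrounds \<open>\<infinity>\<close>: it is large, and clockwise seen from 0.\<close>

definition small_loop ::
    "nat \<Rightarrow> (nat \<Rightarrow> complex) \<Rightarrow> complex \<Rightarrow> nat \<Rightarrow> (real \<Rightarrow> complex) \<Rightarrow> bool" where
  "small_loop r P b i \<gamma> \<longleftrightarrow>
     (\<exists>\<delta> \<rho>. path \<delta> \<and> pathstart \<delta> = b \<and> path_image \<delta> \<inter> P ` {1..r} = {} \<and> \<rho> > 0 \<and>
        (if i \<le> r
         then pathfinish \<delta> = P i + complex_of_real \<rho> \<and>
              cball (P i) \<rho> \<inter> P ` {1..r} = {P i} \<and>
              \<gamma> = \<delta> +++ circlepath (P i) \<rho> +++ reversepath \<delta>
         else pathfinish \<delta> = complex_of_real \<rho> \<and>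
              P ` {1..r} \<subseteq> ball 0 \<rho> \<and>
              \<gamma> = \<delta> +++ reversepath (circlepath 0 \<rho>) +++ reversepath \<delta>))"

text \<open>Identifications of the free pro-\<open>l\<close> group with the pro-\<open>l\<close> fundamental group. Loops act
  by continuation, and the product in the Galois group is composition of maps; so the relation
  \<open>x\<^sub>1 \<cdots> x\<^sub>r\<^sub>+\<^sub>1 = 1\<close> holds for paths composed from right to left.\<close>

definition pi1_identification ::
    "nat \<Rightarrow> nat \<Rightarrow> (nat \<Rightarrow> complex) \<Rightarrow> complex \<Rightarrow> 'a monoid \<Rightarrow> 'a topology \<Rightarrow> (nat \<Rightarrow> 'a) \<Rightarrow>
     ('a \<Rightarrow> complex fls \<Rightarrow> complex fls) \<Rightarrow> bool" where
  "pi1_identification l r P b F T x \<iota> \<longleftrightarrow>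
     \<iota> \<in> iso F (pi1 l r P b) \<and> homeomorphic_map T (pi1_topology l r P b) \<iota> \<and>
     (\<forall>i\<in>{1..r + 1}. \<exists>\<gamma>. small_loop r P b i \<gamma> \<and>
        (\<forall>f\<in>max_pro_l_ext l r P b. continuation \<gamma> f (\<iota> (loop_gen F r x i) f)))"

text \<open>The outer monodromy action: \<open>g\<close> is extended to an automorphism \<open>\<sigma>\<close> of the maximal
  extension that fixes \<open>t\<close>, and \<open>\<sigma>\<close> acts by conjugation. Two extensions differ by an element
  of the fundamental group, so the automorphisms obtained form one class modulo inner
  automorphisms.\<close>

definition outer_action ::
    "nat \<Rightarrow> nat \<Rightarrow> (nat \<Rightarrow> complex) \<Rightarrow> complex \<Rightarrow> 'a monoid \<Rightarrow> 'a topology \<Rightarrow>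
     ('a \<Rightarrow> complex fls \<Rightarrow> complex fls) \<Rightarrow> (complex \<Rightarrow> complex) \<Rightarrow> ('a \<Rightarrow> 'a) set" where
  "outer_action l r P b F T \<iota> g =
     {\<phi> \<in> top_auto F T. \<exists>\<sigma>\<in>carrier (galois_group (max_pro_l_ext l r P b) {coord b}).
        (\<forall>c\<in>Qbar. \<sigma> (fls_const c) = fls_const (g c)) \<and>
        (\<forall>f\<in>carrier F. compose (max_pro_l_ext l r P b) (\<iota> (\<phi> f)) \<sigma> =
                        compose (max_pro_l_ext l r P b) \<sigma> (\<iota> f))}"

text \<open>The Ihara representation assigns to \<open>g\<close> the representative of its outer action in
  \<open>P(F)\<close>. As this representative is unique, the following determines \<open>Ih\<close> on \<open>Gal(Qbar/k)\<close>.\<close>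

definition ihara_representation ::
    "nat \<Rightarrow> nat \<Rightarrow> (nat \<Rightarrow> complex) \<Rightarrow> complex \<Rightarrow> 'a monoid \<Rightarrow> 'a topology \<Rightarrow> (nat \<Rightarrow> 'a) \<Rightarrow>
     ('a \<Rightarrow> complex fls \<Rightarrow> complex fls) \<Rightarrow> ((complex \<Rightarrow> complex) \<Rightarrow> 'a \<Rightarrow> 'a) \<Rightarrow> bool" where
  "ihara_representation l r P b F T x \<iota> Ih \<longleftrightarrow>
     (\<forall>g\<in>carrier (Gal_k r P). Ih g \<in> P_group l r F T x \<inter> outer_action l r P b F T \<iota> g)"

definition Gal_filtration ::
    "nat \<Rightarrow> (nat \<Rightarrow> complex) \<Rightarrow> 'a monoid \<Rightarrow> 'a topology \<Rightarrow> ((complex \<Rightarrow> complex) \<Rightarrow> 'a \<Rightarrow> 'a) \<Rightarrow>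
     nat \<Rightarrow> (complex \<Rightarrow> complex) set" where
  "Gal_filtration r P F T Ih m =
     {g \<in> carrier (Gal_k r P). \<forall>f\<in>carrier F. Ih g f \<otimes>\<^bsub>F\<^esub> inv\<^bsub>F\<^esub> f \<in> lcs F T (m + 1)}"


section \<open>The completed group algebra\<close>

text \<open>The group algebra of a finite group, and the inverse limit of the algebras
  \<open>\<int>\<^sub>l[F/N]\<close> over all open normal subgroups \<open>N\<close>.\<close>

definition group_algebra :: "'r ring \<Rightarrow> 'g monoid \<Rightarrow> ('r, 'g \<Rightarrow> 'r) module" where
  "group_algebra R G =
     \<lparr>carrier = carrier G \<rightarrow>\<^sub>E carrier R,
      mult = (\<lambda>\<alpha> \<beta>. \<lambda>c\<in>carrier G. \<Oplus>\<^bsub>R\<^esub>d\<in>carrier G. \<alpha> d \<otimes>\<^bsub>R\<^esub> \<beta> (inv\<^bsub>G\<^esub> d \<otimes>\<^bsub>G\<^esub> c)),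
      one = (\<lambda>c\<in>carrier G. if c = \<one>\<^bsub>G\<^esub> then \<one>\<^bsub>R\<^esub> else \<zero>\<^bsub>R\<^esub>),
      ring.zero = (\<lambda>c\<in>carrier G. \<zero>\<^bsub>R\<^esub>),
      add = (\<lambda>\<alpha> \<beta>. \<lambda>c\<in>carrier G. \<alpha> c \<oplus>\<^bsub>R\<^esub> \<beta> c),
      smult = (\<lambda>a \<alpha>. \<lambda>c\<in>carrier G. a \<otimes>\<^bsub>R\<^esub> \<alpha> c)\<rparr>"

type_synonym 'a cga = "'a set \<Rightarrow> 'a set \<Rightarrow> nat \<Rightarrow> int"

definition cga :: "nat \<Rightarrow> 'a monoid \<Rightarrow> 'a topology \<Rightarrow> (nat \<Rightarrow> int, 'a cga) module" where
  "cga l F T =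
     \<lparr>carrier = {\<alpha> \<in> (\<Pi>\<^sub>E N\<in>open_normal F T. carrier (group_algebra (Zl l) (F Mod N))).
        \<forall>N\<in>open_normal F T. \<forall>N'\<in>open_normal F T. N \<subseteq> N' \<longrightarrow>
          (\<forall>c'\<in>rcosets\<^bsub>F\<^esub> N'. \<alpha> N' c' = (\<Oplus>\<^bsub>Zl l\<^esub>c\<in>{c \<in> rcosets\<^bsub>F\<^esub> N. c \<subseteq> c'}. \<alpha> N c))},
      mult = (\<lambda>\<alpha> \<beta>. \<lambda>N\<in>open_normal F T. \<alpha> N \<otimes>\<^bsub>group_algebra (Zl l) (F Mod N)\<^esub> \<beta> N),
      one = (\<lambda>N\<in>open_normal F T. \<one>\<^bsub>group_algebra (Zl l) (F Mod N)\<^esub>),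
      ring.zero = (\<lambda>N\<in>open_normal F T. \<zero>\<^bsub>group_algebra (Zl l) (F Mod N)\<^esub>),
      add = (\<lambda>\<alpha> \<beta>. \<lambda>N\<in>open_normal F T. \<alpha> N \<oplus>\<^bsub>group_algebra (Zl l) (F Mod N)\<^esub> \<beta> N),
      smult = (\<lambda>a \<alpha>. \<lambda>N\<in>open_normal F T. a \<odot>\<^bsub>group_algebra (Zl l) (F Mod N)\<^esub> \<alpha> N)\<rparr>"

definition cga_topology :: "nat \<Rightarrow> 'a monoid \<Rightarrow> 'a topology \<Rightarrow> 'a cga topology" where
  "cga_topology l F T = subtopology
     (product_topology (\<lambda>N. product_topology (\<lambda>c. Zl_topology l) (rcosets\<^bsub>F\<^esub> N)) (open_normal F T))
     (carrier (cga l F T))"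

definition cga_of :: "nat \<Rightarrow> 'a monoid \<Rightarrow> 'a topology \<Rightarrow> 'a \<Rightarrow> 'a cga" where
  "cga_of l F T f =
     (\<lambda>N\<in>open_normal F T. \<lambda>c\<in>rcosets\<^bsub>F\<^esub> N. if f \<in> c then \<one>\<^bsub>Zl l\<^esub> else \<zero>\<^bsub>Zl l\<^esub>)"

text \<open>The augmentation is the projection to \<open>\<int>\<^sub>l[F/F]\<close>.\<close>

definition augmentation :: "'a monoid \<Rightarrow> 'a cga \<Rightarrow> nat \<Rightarrow> int" where
  "augmentation F \<alpha> = \<alpha> (carrier F) (carrier F)"

definition aug_ideal :: "nat \<Rightarrow> 'a monoid \<Rightarrow> 'a topology \<Rightarrow> 'a cga set" where
  "aug_ideal l F T = {\<alpha> \<in> carrier (cga l F T). augmentation F \<alpha> = \<zero>\<^bsub>Zl l\<^esub>}"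

primrec aug_power :: "nat \<Rightarrow> 'a monoid \<Rightarrow> 'a topology \<Rightarrow> nat \<Rightarrow> 'a cga set" where
  "aug_power l F T 0 = carrier (cga l F T)"
| "aug_power l F T (Suc n) = ideal_prod (cga l F T) (aug_ideal l F T) (aug_power l F T n)"

text \<open>The maps induced on the completed group algebra by \<open>f \<mapsto> f\<^sup>-\<^sup>1\<close> and by a topological
  automorphism \<open>\<phi>\<close> of \<open>F\<close>.\<close>

definition bar :: "'a monoid \<Rightarrow> 'a topology \<Rightarrow> 'a cga \<Rightarrow> 'a cga" where
  "bar F T \<alpha> = (\<lambda>N\<in>open_normal F T. \<lambda>c\<in>rcosets\<^bsub>F\<^esub> N. \<alpha> N (inv\<^bsub>F Mod N\<^esub> c))"

definition cga_map :: "'a monoid \<Rightarrow> 'a topology \<Rightarrow> ('a \<Rightarrow> 'a) \<Rightarrow> 'a cga \<Rightarrow> 'a cga" where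
  "cga_map F T \<phi> \<alpha> = (\<lambda>N\<in>open_normal F T. \<lambda>c\<in>rcosets\<^bsub>F\<^esub> N.
     \<alpha> (\<phi> -` N \<inter> carrier F) (\<phi> -` c \<inter> carrier F))"


section \<open>The completed tensor algebra and the Magnus isomorphism\<close>

text \<open>\<open>H\<close> is free on \<open>X\<^sub>1, \<dots>, X\<^sub>r\<close>, so \<open>H\<^sup>\<otimes>\<^sup>n\<close> is free on the words of length \<open>n\<close>; the
  product over all \<open>n\<close> consists of the families of coefficients indexed by all words.\<close>

definition words :: "nat \<Rightarrow> nat list set" where
  "words r = {w. set w \<subseteq> {1..r}}"

type_synonym tensor = "nat list \<Rightarrow> nat \<Rightarrow> int"

definition tensor_algebra :: "nat \<Rightarrow> nat \<Rightarrow> (nat \<Rightarrow> int, tensor) module" where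
  "tensor_algebra l r =
     \<lparr>carrier = words r \<rightarrow>\<^sub>E carrier (Zl l),
      mult = (\<lambda>s t. \<lambda>w\<in>words r.
                \<Oplus>\<^bsub>Zl l\<^esub>i\<in>{..length w}. s (take i w) \<otimes>\<^bsub>Zl l\<^esub> t (drop i w)),
      one = (\<lambda>w\<in>words r. if w = [] then \<one>\<^bsub>Zl l\<^esub> else \<zero>\<^bsub>Zl l\<^esub>),
      ring.zero = (\<lambda>w\<in>words r. \<zero>\<^bsub>Zl l\<^esub>),
      add = (\<lambda>s t. \<lambda>w\<in>words r. s w \<oplus>\<^bsub>Zl l\<^esub> t w),
      smult = (\<lambda>a t. \<lambda>w\<in>words r. a \<otimes>\<^bsub>Zl l\<^esub> t w)\<rparr>"

definition tensor_topology :: "nat \<Rightarrow> nat \<Rightarrow> tensor topology" where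
  "tensor_topology l r = product_topology (\<lambda>w. Zl_topology l) (words r)"

definition tensor_X :: "nat \<Rightarrow> nat \<Rightarrow> nat \<Rightarrow> tensor" where
  "tensor_X l r i = (\<lambda>w\<in>words r. if w = [i] then \<one>\<^bsub>Zl l\<^esub> else \<zero>\<^bsub>Zl l\<^esub>)"

definition component :: "nat \<Rightarrow> nat \<Rightarrow> tensor \<Rightarrow> tensor" where
  "component r n t = restrict t {w \<in> words r. length w = n}"

definition magnus_isomorphism ::
    "nat \<Rightarrow> nat \<Rightarrow> 'a monoid \<Rightarrow> 'a topology \<Rightarrow> (nat \<Rightarrow> 'a) \<Rightarrow> ('a cga \<Rightarrow> tensor) \<Rightarrow> bool" where
  "magnus_isomorphism l r F T x \<Theta> \<longleftrightarrow>
     \<Theta> \<in> ring_iso (cga l F T) (tensor_algebra l r) \<and>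
     (\<forall>a\<in>carrier (Zl l). \<forall>\<alpha>\<in>carrier (cga l F T).
        \<Theta> (a \<odot>\<^bsub>cga l F T\<^esub> \<alpha>) = a \<odot>\<^bsub>tensor_algebra l r\<^esub> \<Theta> \<alpha>) \<and>
     homeomorphic_map (cga_topology l F T) (tensor_topology l r) \<Theta> \<and>
     (\<forall>i\<in>{1..r}. \<Theta> (cga_of l F T (x i)) = \<one>\<^bsub>tensor_algebra l r\<^esub> \<oplus>\<^bsub>tensor_algebra l r\<^esub> tensor_X l r i)"

text \<open>\<open>gr\<^sub>n = I\<^sup>n/I\<^sup>n\<^sup>+\<^sup>1\<close> as a set of cosets. For a map \<open>f\<close> that is constant on a coset \<open>c\<close>, the
  value on \<open>c\<close> of the map induced by \<open>f\<close> is \<open>the_elem (f ` c)\<close>.\<close>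

definition gr :: "nat \<Rightarrow> 'a monoid \<Rightarrow> 'a topology \<Rightarrow> nat \<Rightarrow> 'a cga set set" where
  "gr l F T n = (\<lambda>\<alpha>. aug_power l F T (n + 1) +>\<^bsub>cga l F T\<^esub> \<alpha>) ` aug_power l F T n"

definition Theta_gr :: "nat \<Rightarrow> nat \<Rightarrow> ('a cga \<Rightarrow> tensor) \<Rightarrow> 'a cga set \<Rightarrow> tensor" where
  "Theta_gr r n \<Theta> c = the_elem ((\<lambda>\<alpha>. component r n (\<Theta> \<alpha>)) ` c)"


section \<open>Johnson homomorphisms\<close>

definition H :: "'a monoid \<Rightarrow> 'a topology \<Rightarrow> 'a set monoid" where
  "H F T = F Mod lcs F T 2"

definition H_X :: "'a monoid \<Rightarrow> 'a topology \<Rightarrow> (nat \<Rightarrow> 'a) \<Rightarrow> nat \<Rightarrow> 'a set" where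
  "H_X F T x i = lcs F T 2 #>\<^bsub>F\<^esub> x i"

text \<open>The coordinates of \<open>h \<in> H\<close> in the basis \<open>X\<^sub>1, \<dots>, X\<^sub>r\<close> (\<open>H\<close> is written multiplicatively),
  and the embedding of \<open>H\<close> as the degree 1 part of the tensor algebra.\<close>

definition H_coord ::
    "nat \<Rightarrow> nat \<Rightarrow> 'a monoid \<Rightarrow> 'a topology \<Rightarrow> (nat \<Rightarrow> 'a) \<Rightarrow> 'a set \<Rightarrow> nat \<Rightarrow> nat \<Rightarrow> int" where
  "H_coord l r F T x h = (THE a. a \<in> {1..r} \<rightarrow>\<^sub>E carrier (Zl l) \<and>
     h = lcs F T 2 #>\<^bsub>F\<^esub> ordered_prod F r (\<lambda>i. Zl_pow F T (x i) (a i)))"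

definition H_emb ::
    "nat \<Rightarrow> nat \<Rightarrow> 'a monoid \<Rightarrow> 'a topology \<Rightarrow> (nat \<Rightarrow> 'a) \<Rightarrow> 'a set \<Rightarrow> tensor" where
  "H_emb l r F T x h =
     (\<lambda>w\<in>words r. if length w = 1 then H_coord l r F T x h (hd w) else \<zero>\<^bsub>Zl l\<^esub>)"

text \<open>The automorphism \<open>[\<phi>]\<close> of \<open>H\<close>, and \<open>\<phi>\<^sup>* = \<Theta> \<circ> \<phi> \<circ> \<Theta>\<^sup>-\<^sup>1\<close>.\<close>

definition H_map :: "('a \<Rightarrow> 'a) \<Rightarrow> 'a set \<Rightarrow> 'a set" where
  "H_map \<phi> h = \<phi> ` h"

definition tensor_map ::
    "nat \<Rightarrow> 'a monoid \<Rightarrow> 'a topology \<Rightarrow> ('a cga \<Rightarrow> tensor) \<Rightarrow> ('a \<Rightarrow> 'a) \<Rightarrow> tensor \<Rightarrow> tensor" where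
  "tensor_map l F T \<Theta> \<phi> = \<Theta> \<circ> cga_map F T \<phi> \<circ> inv_into (carrier (cga l F T)) \<Theta>"

definition johnson ::
    "nat \<Rightarrow> nat \<Rightarrow> 'a monoid \<Rightarrow> 'a topology \<Rightarrow> (nat \<Rightarrow> 'a) \<Rightarrow> ('a cga \<Rightarrow> tensor) \<Rightarrow> ('a \<Rightarrow> 'a) \<Rightarrow>
     'a set \<Rightarrow> tensor" where
  "johnson l r F T x \<Theta> \<phi> h =
     tensor_map l F T \<Theta> \<phi> (H_emb l r F T x (inv_into (carrier (H F T)) (H_map \<phi>) h))
       \<ominus>\<^bsub>tensor_algebra l r\<^esub> H_emb l r F T x h"

definition johnson_component ::
    "nat \<Rightarrow> nat \<Rightarrow> 'a monoid \<Rightarrow> 'a topology \<Rightarrow> (nat \<Rightarrow> 'a) \<Rightarrow> ('a cga \<Rightarrow> tensor) \<Rightarrow> nat \<Rightarrow> ('a \<Rightarrow> 'a) \<Rightarrow>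
     'a set \<Rightarrow> tensor" where
  "johnson_component l r F T x \<Theta> m \<phi> h = component r (m + 1) (johnson l r F T x \<Theta> \<phi> h)"


section \<open>Fox derivatives and the Magnus cocycle\<close>

definition fox ::
    "nat \<Rightarrow> nat \<Rightarrow> 'a monoid \<Rightarrow> 'a topology \<Rightarrow> (nat \<Rightarrow> 'a) \<Rightarrow> nat \<Rightarrow> 'a cga \<Rightarrow> 'a cga" where
  "fox l r F T x j \<alpha> = (THE d. d \<in> {1..r} \<rightarrow>\<^sub>E carrier (cga l F T) \<and>
     \<alpha> = (augmentation F \<alpha> \<odot>\<^bsub>cga l F T\<^esub> \<one>\<^bsub>cga l F T\<^esub>) \<oplus>\<^bsub>cga l F T\<^esub>
         (\<Oplus>\<^bsub>cga l F T\<^esub>i\<in>{1..r}. d i \<otimes>\<^bsub>cga l F T\<^esub> (cga_of l F T (x i) \<ominus>\<^bsub>cga l F T\<^esub> \<one>\<^bsub>cga l F T\<^esub>))) j"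

definition matrix_ring :: "nat \<Rightarrow> 'r ring \<Rightarrow> (nat \<times> nat \<Rightarrow> 'r) ring" where
  "matrix_ring r R =
     \<lparr>carrier = {1..r} \<times> {1..r} \<rightarrow>\<^sub>E carrier R,
      mult = (\<lambda>A B. \<lambda>(i, j)\<in>{1..r} \<times> {1..r}. \<Oplus>\<^bsub>R\<^esub>k\<in>{1..r}. A (i, k) \<otimes>\<^bsub>R\<^esub> B (k, j)),
      one = (\<lambda>(i, j)\<in>{1..r} \<times> {1..r}. if i = j then \<one>\<^bsub>R\<^esub> else \<zero>\<^bsub>R\<^esub>),
      ring.zero = (\<lambda>(i, j)\<in>{1..r} \<times> {1..r}. \<zero>\<^bsub>R\<^esub>),
      add = (\<lambda>A B. \<lambda>p\<in>{1..r} \<times> {1..r}. A p \<oplus>\<^bsub>R\<^esub> B p)\<rparr>"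

definition magnus_cocycle ::
    "nat \<Rightarrow> nat \<Rightarrow> 'a monoid \<Rightarrow> 'a topology \<Rightarrow> (nat \<Rightarrow> 'a) \<Rightarrow> ('a \<Rightarrow> 'a) \<Rightarrow> nat \<times> nat \<Rightarrow> 'a cga"
  where "magnus_cocycle l r F T x \<phi> =
     (\<lambda>(i, j)\<in>{1..r} \<times> {1..r}. bar F T (fox l r F T x i (cga_of l F T (\<phi> (x j)))))"

abbreviation cga_mod :: "nat \<Rightarrow> 'a monoid \<Rightarrow> 'a topology \<Rightarrow> nat \<Rightarrow> 'a cga set ring" where
  "cga_mod l F T n \<equiv> cga l F T Quot aug_power l F T n"

definition magnus_cocycle_mod ::
    "nat \<Rightarrow> nat \<Rightarrow> 'a monoid \<Rightarrow> 'a topology \<Rightarrow> (nat \<Rightarrow> 'a) \<Rightarrow> nat \<Rightarrow> ('a \<Rightarrow> 'a) \<Rightarrow>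
     nat \<times> nat \<Rightarrow> 'a cga set" where
  "magnus_cocycle_mod l r F T x m \<phi> = (\<lambda>p\<in>{1..r} \<times> {1..r}.
     aug_power l F T (m + 1) +>\<^bsub>cga l F T\<^esub> magnus_cocycle l r F T x \<phi> p)"

text \<open>The map \<open>I\<^sup>n\<^sup>+\<^sup>1/I\<^sup>n\<^sup>+\<^sup>2 \<rightarrow> I\<^sup>n/I\<^sup>n\<^sup>+\<^sup>1\<close> induced by the \<open>i\<close>-th Fox derivative.\<close>

definition fox_gr ::
    "nat \<Rightarrow> nat \<Rightarrow> 'a monoid \<Rightarrow> 'a topology \<Rightarrow> (nat \<Rightarrow> 'a) \<Rightarrow> nat \<Rightarrow> nat \<Rightarrow> 'a cga set \<Rightarrow> 'a cga set"
  where "fox_gr l r F T x n i c =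
     the_elem ((\<lambda>\<alpha>. aug_power l F T (n + 1) +>\<^bsub>cga l F T\<^esub> fox l r F T x i \<alpha>) ` c)"

definition fox_matrix ::
    "nat \<Rightarrow> nat \<Rightarrow> 'a monoid \<Rightarrow> 'a topology \<Rightarrow> (nat \<Rightarrow> 'a) \<Rightarrow> ('a cga \<Rightarrow> tensor) \<Rightarrow> nat \<Rightarrow>
     ('a set \<Rightarrow> tensor) \<Rightarrow> nat \<times> nat \<Rightarrow> 'a cga set" where
  "fox_matrix l r F T x \<Theta> m \<tau> = (\<lambda>(i, j)\<in>{1..r} \<times> {1..r}.
     fox_gr l r F T x m i
       (inv_into (gr l F T (m + 1)) (Theta_gr r (m + 1) \<Theta>) (\<tau> (H_X F T x j))))"

text \<open>The map induced by \<open>bar\<close> on a quotient by a power of \<open>I\<close> sends a coset to its image.\<close>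

definition bar_matrix ::
    "nat \<Rightarrow> 'a monoid \<Rightarrow> 'a topology \<Rightarrow> (nat \<times> nat \<Rightarrow> 'a cga set) \<Rightarrow> nat \<times> nat \<Rightarrow> 'a cga set" where
  "bar_matrix r F T A = (\<lambda>p\<in>{1..r} \<times> {1..r}. bar F T ` A p)"

end

theory Submission
  imports Defs
begin

text \<open>Write \<open>\<phi>\<close> for the automorphism \<open>Ih g\<close> of \<open>F\<close>. It is a homeomorphism, and
  \<open>\<phi>(f) f\<^sup>-\<^sup>1 \<in> F(m + 1)\<close> for all \<open>f\<close>.

  Through the Magnus isomorphism every element of the completed group algebra is a family of
  coefficients indexed by words in the letters \<open>1, \<dots>, r\<close>, and the structure becomes
  combinatorial. The augmentation is the coefficient at the empty word (\<open>aug_eq_coeff\<close>), the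
  power \<open>I\<^sup>n\<close> consists of the elements without coefficients at words shorter than \<open>n\<close>
  (\<open>aug_power_eq\<close>), and the Fox derivative along \<open>x\<^sub>j\<close> selects the words that end in \<open>j\<close> and
  deletes this letter (\<open>coeff_fox\<close>), so it lowers the degree by one.

  An element \<open>f\<close> of \<open>F(n)\<close> satisfies \<open>f - 1 \<in> I\<^sup>n\<close> (\<open>lcs_subset_dimsub\<close>). Hence
  \<open>u\<^sub>j = \<phi>(x\<^sub>j) - x\<^sub>j = (\<phi>(x\<^sub>j) x\<^sub>j\<^sup>-\<^sup>1 - 1) x\<^sub>j\<close> lies in \<open>I\<^sup>m\<^sup>+\<^sup>1\<close>. As \<open>\<phi>\<close> acts trivially on
  \<open>H\<close>, the value of the Johnson map on \<open>X\<^sub>j\<close> is the Magnus expansion of \<open>u\<^sub>j\<close>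
  (\<open>johnson_gen\<close>), so its component of degree \<open>m + 1\<close> corresponds to the class of \<open>u\<^sub>j\<close> in
  \<open>I\<^sup>m\<^sup>+\<^sup>1/I\<^sup>m\<^sup>+\<^sup>2\<close>. The Fox derivative of \<open>\<phi>(x\<^sub>j) = x\<^sub>j + u\<^sub>j\<close> along \<open>x\<^sub>i\<close> is the Kronecker
  delta plus that of \<open>u\<^sub>j\<close>; applying the bar gives the formula. The matrix is invertible because
  it is the identity plus a matrix \<open>B\<close> with entries in \<open>I\<^sup>m\<close>, whose products lie in
  \<open>I\<^sup>2\<^sup>m \<subseteq> I\<^sup>m\<^sup>+\<^sup>1\<close>, so that \<open>Id - B\<close> is its inverse.

  Identifying the element \<open>X\<^sub>j\<close> of \<open>H\<close> with the letter \<open>j\<close> requires that its coordinates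
  with respect to the basis are unique (\<open>H_coord_gen\<close>). Uniqueness follows by comparing
  one-letter coefficients, once powers with \<open>l\<close>-adic exponents are known to exist as limits
  (\<open>Zl_pow_limit\<close>); for this the open normal subgroups must separate points
  (\<open>residually_finite\<close>), which comes from total disconnectedness and compactness.\<close>

section \<open>The ring of \<open>l\<close>-adic integers\<close>

lemma Zl_simps:
  "a \<in> carrier (Zl l) \<longleftrightarrow> (\<forall>n. a n \<in> {0..<int l ^ n} \<and> a (Suc n) mod int l ^ n = a n)"
  "a \<otimes>\<^bsub>Zl l\<^esub> b = (\<lambda>n. (a n * b n) mod int l ^ n)"
  "\<one>\<^bsub>Zl l\<^esub> = (\<lambda>n. 1 mod int l ^ n)"
  "\<zero>\<^bsub>Zl l\<^esub> = (\<lambda>n. 0)"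
  "a \<oplus>\<^bsub>Zl l\<^esub> b = (\<lambda>n. (a n + b n) mod int l ^ n)"
  by (auto simp: Zl_def)

lemma Zl_mod: "a \<in> carrier (Zl l) \<Longrightarrow> a n mod int l ^ n = a n"
  by (simp add: Zl_simps(1))

lemma Zl_mod_le:
  assumes "a \<in> carrier (Zl l)" "n \<le> k"
  shows "a k mod int l ^ n = a n"
  using assms(2)
proof (induction k rule: dec_induct)
  case base
  show ?case using Zl_mod[OF assms(1)] .
next
  case (step k)
  have "a (Suc k) mod int l ^ n = a (Suc k) mod int l ^ k mod int l ^ n"
    using step(1) by (simp add: mod_mod_cancel le_imp_power_dvd)
  also have "\<dots> = a n" using assms(1) step(3) by (simp add: Zl_simps(1))
  finally show ?case .
qed

text \<open>A family of integers that is coherent modulo the powers of \<open>l\<close> defines an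
  \<open>l\<close>-adic integer, whether or not its members are reduced.\<close>

lemma Zl_memI:
  assumes "l > 0" "\<And>n. f (Suc n) mod int l ^ n = f n mod int l ^ n"
  shows "(\<lambda>n. f n mod int l ^ n) \<in> carrier (Zl l)"
proof -
  have "f (Suc n) mod (int l * int l ^ n) mod int l ^ n = f n mod int l ^ n" for n
    using assms(2)[of n] by (simp add: mod_mod_cancel)
  then show ?thesis using assms(1) by (simp add: Zl_simps)
qed

lemma Zl_coherent: "a \<in> carrier (Zl l) \<Longrightarrow> a (Suc n) mod int l ^ n = a n mod int l ^ n"
  by (simp add: Zl_simps(1))

lemma Zl_cring:
  assumes "l > 0"
  shows "cring (Zl l)"
proof (rule cringI)
  show "abelian_group (Zl l)"
  proof (rule abelian_groupI)
    fix x y assume xy: "x \<in> carrier (Zl l)" "y \<in> carrier (Zl l)"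
    show "x \<oplus>\<^bsub>Zl l\<^esub> y \<in> carrier (Zl l)"
      unfolding Zl_simps(5)
      by (rule Zl_memI[OF assms]) (intro mod_add_cong Zl_coherent xy)
    show "x \<oplus>\<^bsub>Zl l\<^esub> y = y \<oplus>\<^bsub>Zl l\<^esub> x" by (simp add: Zl_simps add.commute)
    fix z assume "z \<in> carrier (Zl l)"
    show "x \<oplus>\<^bsub>Zl l\<^esub> y \<oplus>\<^bsub>Zl l\<^esub> z = x \<oplus>\<^bsub>Zl l\<^esub> (y \<oplus>\<^bsub>Zl l\<^esub> z)"
      by (simp add: Zl_simps mod_simps add.assoc)
  next
    show "\<zero>\<^bsub>Zl l\<^esub> \<in> carrier (Zl l)" using assms by (simp add: Zl_simps)
    fix x assume x: "x \<in> carrier (Zl l)"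
    show "\<zero>\<^bsub>Zl l\<^esub> \<oplus>\<^bsub>Zl l\<^esub> x = x" using Zl_mod[OF x] by (simp add: Zl_simps)
    show "\<exists>y\<in>carrier (Zl l). y \<oplus>\<^bsub>Zl l\<^esub> x = \<zero>\<^bsub>Zl l\<^esub>"
    proof
      show "(\<lambda>n. (- x n) mod int l ^ n) \<in> carrier (Zl l)"
        by (rule Zl_memI[OF assms]) (intro mod_minus_cong Zl_coherent x)
    qed (simp add: Zl_simps mod_simps)
  qed
  show "comm_monoid (Zl l)"
  proof (rule comm_monoidI)
    fix x y assume xy: "x \<in> carrier (Zl l)" "y \<in> carrier (Zl l)"
    show "x \<otimes>\<^bsub>Zl l\<^esub> y \<in> carrier (Zl l)"
      unfolding Zl_simps(2)
      by (rule Zl_memI[OF assms]) (intro mod_mult_cong Zl_coherent xy)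
    show "x \<otimes>\<^bsub>Zl l\<^esub> y = y \<otimes>\<^bsub>Zl l\<^esub> x" by (simp add: Zl_simps mult.commute)
    fix z assume "z \<in> carrier (Zl l)"
    show "x \<otimes>\<^bsub>Zl l\<^esub> y \<otimes>\<^bsub>Zl l\<^esub> z = x \<otimes>\<^bsub>Zl l\<^esub> (y \<otimes>\<^bsub>Zl l\<^esub> z)"
      by (simp add: Zl_simps mod_simps mult.assoc)
  next
    show "\<one>\<^bsub>Zl l\<^esub> \<in> carrier (Zl l)"
      unfolding Zl_simps(3) by (rule Zl_memI[OF assms]) simp
    fix x assume x: "x \<in> carrier (Zl l)"
    show "\<one>\<^bsub>Zl l\<^esub> \<otimes>\<^bsub>Zl l\<^esub> x = x" using Zl_mod[OF x] by (simp add: Zl_simps mod_simps)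
  qed
  fix x y z
  show "(x \<oplus>\<^bsub>Zl l\<^esub> y) \<otimes>\<^bsub>Zl l\<^esub> z = x \<otimes>\<^bsub>Zl l\<^esub> z \<oplus>\<^bsub>Zl l\<^esub> y \<otimes>\<^bsub>Zl l\<^esub> z"
    by (simp add: Zl_simps mod_simps distrib_right)
qed

text \<open>Finite sums are sums of residues. Identities between \<open>l\<close>-adic integers thereby become
  congruences between integers, which is how they are proved below.\<close>

lemma Zl_finsum:
  assumes "l > 0" "finite A" "\<And>i. i \<in> A \<Longrightarrow> f i \<in> carrier (Zl l)"
  shows "(\<Oplus>\<^bsub>Zl l\<^esub>i\<in>A. f i) = (\<lambda>n. (\<Sum>i\<in>A. f i n) mod int l ^ n)"
  using assms(2,3)
proof (induction A rule: finite_induct)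
  case empty
  interpret cring "Zl l" by (rule Zl_cring[OF assms(1)])
  show ?case by (simp add: Zl_simps)
next
  case (insert a A)
  interpret cring "Zl l" by (rule Zl_cring[OF assms(1)])
  have "(\<Oplus>\<^bsub>Zl l\<^esub>i\<in>insert a A. f i) = f a \<oplus>\<^bsub>Zl l\<^esub> (\<Oplus>\<^bsub>Zl l\<^esub>i\<in>A. f i)"
    by (rule finsum_insert) (use insert in auto)
  then show ?case using insert by (simp add: Zl_simps mod_simps)
qed


section \<open>The tensor algebra\<close>

text \<open>The product of the tensor algebra at one level modulo \<open>l\<^sup>n\<close>, with the reduction left
  out. Splitting off the first letter of the word makes associativity a simple induction.\<close>

definition conv :: "('b list \<Rightarrow> int) \<Rightarrow> ('b list \<Rightarrow> int) \<Rightarrow> 'b list \<Rightarrow> int" where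
  "conv s t w = (\<Sum>i\<le>length w. s (take i w) * t (drop i w))"

lemma conv_Nil: "conv s t [] = s [] * t []"
  by (simp add: conv_def)

lemma conv_Cons: "conv s t (a # w) = s [] * t (a # w) + conv (\<lambda>v. s (a # v)) t w"
  by (simp add: conv_def sum.atMost_Suc_shift del: sum.atMost_Suc)

lemma conv_distrib_right: "conv (\<lambda>v. s v + t v) u w = conv s u w + conv t u w"
  by (simp add: conv_def algebra_simps sum.distrib)

lemma conv_distrib_left: "conv u (\<lambda>v. s v + t v) w = conv u s w + conv u t w"
  by (simp add: conv_def algebra_simps sum.distrib)

lemma conv_scale_left: "conv (\<lambda>v. c * s v) t w = c * conv s t w"
  by (simp add: conv_def sum_distrib_left mult.assoc)

lemma conv_assoc: "conv (conv s t) u w = conv s (conv t u) w"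
proof (induction w arbitrary: s)
  case Nil
  show ?case by (simp add: conv_Nil)
next
  case (Cons a w)
  have "conv (\<lambda>v. conv s t (a # v)) u w
      = s [] * conv (\<lambda>v. t (a # v)) u w + conv (\<lambda>v. s (a # v)) (conv t u) w"
    by (simp add: conv_Cons conv_distrib_right conv_scale_left Cons)
  then show ?case by (simp add: conv_Cons conv_Nil algebra_simps)
qed

lemma conv_cong:
  assumes "\<And>i. i \<le> length w \<Longrightarrow> s (take i w) mod q = s' (take i w) mod q"
    and "\<And>i. i \<le> length w \<Longrightarrow> t (drop i w) mod q = t' (drop i w) mod q"
  shows "conv s t w mod q = conv s' t' w mod q"
proof -
  have "conv s t w mod q = (\<Sum>i\<le>length w. (s (take i w) * t (drop i w)) mod q) mod q"
    by (simp add: conv_def mod_sum_eq)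
  also have "\<dots> = (\<Sum>i\<le>length w. (s' (take i w) * t' (drop i w)) mod q) mod q"
    by (intro arg_cong[where f = "\<lambda>z. z mod q"] sum.cong refl mod_mult_cong assms) auto
  also have "\<dots> = conv s' t' w mod q"
    by (simp add: conv_def mod_sum_eq)
  finally show ?thesis .
qed

lemma words_take_drop:
  "w \<in> words r \<Longrightarrow> take i w \<in> words r" "w \<in> words r \<Longrightarrow> drop i w \<in> words r"
  by (auto simp: words_def dest: in_set_takeD in_set_dropD)

lemma words_simps [simp]:
  "[] \<in> words r" "a # w \<in> words r \<longleftrightarrow> a \<in> {1..r} \<and> w \<in> words r"
  "v @ w \<in> words r \<longleftrightarrow> v \<in> words r \<and> w \<in> words r"
  by (auto simp: words_def)

lemma tensor_simps:
  "carrier (tensor_algebra l r) = words r \<rightarrow>\<^sub>E carrier (Zl l)"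
  "\<one>\<^bsub>tensor_algebra l r\<^esub> = (\<lambda>w\<in>words r. if w = [] then \<one>\<^bsub>Zl l\<^esub> else \<zero>\<^bsub>Zl l\<^esub>)"
  "\<zero>\<^bsub>tensor_algebra l r\<^esub> = (\<lambda>w\<in>words r. \<zero>\<^bsub>Zl l\<^esub>)"
  "s \<oplus>\<^bsub>tensor_algebra l r\<^esub> t = (\<lambda>w\<in>words r. s w \<oplus>\<^bsub>Zl l\<^esub> t w)"
  "a \<odot>\<^bsub>tensor_algebra l r\<^esub> t = (\<lambda>w\<in>words r. a \<otimes>\<^bsub>Zl l\<^esub> t w)"
  by (auto simp: tensor_algebra_def)

lemma tensor_mult:
  assumes "l > 0" "s \<in> carrier (tensor_algebra l r)" "t \<in> carrier (tensor_algebra l r)"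
  shows "s \<otimes>\<^bsub>tensor_algebra l r\<^esub> t =
    (\<lambda>w\<in>words r. \<lambda>n. conv (\<lambda>v. s v n) (\<lambda>v. t v n) w mod int l ^ n)"
proof
  interpret cring "Zl l" by (rule Zl_cring[OF assms(1)])
  fix w
  show "(s \<otimes>\<^bsub>tensor_algebra l r\<^esub> t) w =
    (\<lambda>w\<in>words r. \<lambda>n. conv (\<lambda>v. s v n) (\<lambda>v. t v n) w mod int l ^ n) w"
  proof (cases "w \<in> words r")
    case True
    have st: "s (take i w) \<in> carrier (Zl l)" "t (drop i w) \<in> carrier (Zl l)" for i
      using assms(2,3) words_take_drop[OF True, of i] by (auto simp: tensor_simps)
    then have "(s \<otimes>\<^bsub>tensor_algebra l r\<^esub> t) w = (\<lambda>n. (\<Sum>i\<le>length w. 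
        (s (take i w) \<otimes>\<^bsub>Zl l\<^esub> t (drop i w)) n) mod int l ^ n)"
      using True by (subst Zl_finsum[OF assms(1), symmetric]) (auto simp: tensor_algebra_def)
    also have "\<dots> = (\<lambda>n. conv (\<lambda>v. s v n) (\<lambda>v. t v n) w mod int l ^ n)"
      by (simp add: Zl_simps(2) conv_def mod_sum_eq)
    finally show ?thesis using True by simp
  qed (simp add: tensor_algebra_def)
qed

lemma tensor_mult_closed:
  assumes "l > 0" "s \<in> carrier (tensor_algebra l r)" "t \<in> carrier (tensor_algebra l r)"
  shows "s \<otimes>\<^bsub>tensor_algebra l r\<^esub> t \<in> carrier (tensor_algebra l r)"
proof -
  have "(\<lambda>n. conv (\<lambda>v. s v n) (\<lambda>v. t v n) w mod int l ^ n) \<in> carrier (Zl l)" if w: "w \<in> words r" for w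
  proof (rule Zl_memI[OF assms(1)], rule conv_cong)
    fix n i
    have "s (take i w) \<in> carrier (Zl l)" "t (drop i w) \<in> carrier (Zl l)"
      using assms(2,3) words_take_drop[OF w, of i] by (auto simp: tensor_simps)
    then show "s (take i w) (Suc n) mod int l ^ n = s (take i w) n mod int l ^ n"
      "t (drop i w) (Suc n) mod int l ^ n = t (drop i w) n mod int l ^ n"
      by (auto intro: Zl_coherent)
  qed
  then show ?thesis
    by (simp add: tensor_mult[OF assms] tensor_simps)
qed

lemma tensor_ring:
  assumes l: "l > 0"
  shows "ring (tensor_algebra l r)"
proof (rule ringI)
  interpret Z: cring "Zl l" by (rule Zl_cring[OF l])
  let ?T = "tensor_algebra l r"
  have ext: "s = t" if "s \<in> carrier ?T" "t \<in> carrier ?T" "\<And>w n. w \<in> words r \<Longrightarrow> s w n = t w n"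
    for s t
  proof (rule PiE_ext[of s "words r" "\<lambda>_. carrier (Zl l)" t])
    show "s w = t w" if "w \<in> words r" for w using \<open>\<And>w n. w \<in> words r \<Longrightarrow> s w n = t w n\<close> that by blast
  qed (use that in \<open>auto simp: tensor_simps\<close>)
  have val: "s w \<in> carrier (Zl l)" if "s \<in> carrier ?T" "w \<in> words r" for s w
    using that by (auto simp: tensor_simps)
  show "abelian_group ?T"
  proof (rule abelian_groupI)
    fix x assume x: "x \<in> carrier ?T"
    show "\<exists>y\<in>carrier ?T. y \<oplus>\<^bsub>?T\<^esub> x = \<zero>\<^bsub>?T\<^esub>"
      by (rule bexI[of _ "\<lambda>w\<in>words r. \<ominus>\<^bsub>Zl l\<^esub> x w"])
         (use val[OF x] in \<open>auto simp: tensor_simps Z.l_neg intro!: restrict_ext\<close>)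
    show "\<zero>\<^bsub>?T\<^esub> \<oplus>\<^bsub>?T\<^esub> x = x"
      using x by (intro PiE_ext[of _ "words r" "\<lambda>_. carrier (Zl l)"])
        (use val[OF x] in \<open>auto simp: tensor_simps\<close>)
  next
    show "\<zero>\<^bsub>?T\<^esub> \<in> carrier ?T" by (simp add: tensor_simps)
    fix x y assume x: "x \<in> carrier ?T" and y: "y \<in> carrier ?T"
    show "x \<oplus>\<^bsub>?T\<^esub> y \<in> carrier ?T" using val[OF x] val[OF y] by (simp add: tensor_simps)
    show "x \<oplus>\<^bsub>?T\<^esub> y = y \<oplus>\<^bsub>?T\<^esub> x"
      using val[OF x] val[OF y] by (auto simp: tensor_simps Z.a_comm intro!: restrict_ext)
    fix z assume z: "z \<in> carrier ?T"
    show "x \<oplus>\<^bsub>?T\<^esub> y \<oplus>\<^bsub>?T\<^esub> z = x \<oplus>\<^bsub>?T\<^esub> (y \<oplus>\<^bsub>?T\<^esub> z)"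
      using val[OF x] val[OF y] val[OF z]
      by (auto simp: tensor_simps Z.a_assoc intro!: restrict_ext)
  qed
  show "monoid ?T"
  proof (rule monoidI)
    fix x y z assume x: "x \<in> carrier ?T" and y: "y \<in> carrier ?T" and z: "z \<in> carrier ?T"
    show xy: "x \<otimes>\<^bsub>?T\<^esub> y \<in> carrier ?T" by (rule tensor_mult_closed[OF l x y])
    have yz: "y \<otimes>\<^bsub>?T\<^esub> z \<in> carrier ?T" by (rule tensor_mult_closed[OF l y z])
    show "x \<otimes>\<^bsub>?T\<^esub> y \<otimes>\<^bsub>?T\<^esub> z = x \<otimes>\<^bsub>?T\<^esub> (y \<otimes>\<^bsub>?T\<^esub> z)"
    proof (rule ext)
      fix w n assume w: "w \<in> words r"
      let ?q = "int l ^ n" and ?x = "\<lambda>v. x v n" and ?y = "\<lambda>v. y v n" and ?z = "\<lambda>v. z v n"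
      have "(x \<otimes>\<^bsub>?T\<^esub> y \<otimes>\<^bsub>?T\<^esub> z) w n = conv (conv ?x ?y) ?z w mod ?q"
        unfolding tensor_mult[OF l xy z] using w
        by (auto intro!: conv_cong simp: tensor_mult[OF l x y] words_take_drop)
      also have "\<dots> = conv ?x (conv ?y ?z) w mod ?q" by (simp add: conv_assoc)
      also have "\<dots> = (x \<otimes>\<^bsub>?T\<^esub> (y \<otimes>\<^bsub>?T\<^esub> z)) w n"
        unfolding tensor_mult[OF l x yz] using w
        by (auto intro!: conv_cong simp: tensor_mult[OF l y z] words_take_drop)
      finally show "(x \<otimes>\<^bsub>?T\<^esub> y \<otimes>\<^bsub>?T\<^esub> z) w n = (x \<otimes>\<^bsub>?T\<^esub> (y \<otimes>\<^bsub>?T\<^esub> z)) w n" .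
    qed (use x y z xy yz l in \<open>auto intro: tensor_mult_closed\<close>)
  next
    show one: "\<one>\<^bsub>?T\<^esub> \<in> carrier ?T" by (simp add: tensor_simps)
    fix x assume x: "x \<in> carrier ?T"
    show "\<one>\<^bsub>?T\<^esub> \<otimes>\<^bsub>?T\<^esub> x = x"
    proof (rule ext)
      fix w n assume w: "w \<in> words r"
      have "conv (\<lambda>v. \<one>\<^bsub>?T\<^esub> v n) (\<lambda>v. x v n) w =
          (\<Sum>i\<le>length w. if i = 0 then 1 mod int l ^ n * x w n else 0)"
        unfolding conv_def using w
        by (intro sum.cong) (auto simp: tensor_simps Zl_simps words_take_drop)
      then show "(\<one>\<^bsub>?T\<^esub> \<otimes>\<^bsub>?T\<^esub> x) w n = x w n"
        using w Zl_mod[OF val[OF x w], of n] by (simp add: tensor_mult[OF l one x] mod_simps)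
    qed (use x one l in \<open>auto intro: tensor_mult_closed\<close>)
    show "x \<otimes>\<^bsub>?T\<^esub> \<one>\<^bsub>?T\<^esub> = x"
    proof (rule ext)
      fix w n assume w: "w \<in> words r"
      have "conv (\<lambda>v. x v n) (\<lambda>v. \<one>\<^bsub>?T\<^esub> v n) w =
          (\<Sum>i\<le>length w. if i = length w then x w n * (1 mod int l ^ n) else 0)"
        unfolding conv_def using w
        by (intro sum.cong) (auto simp: tensor_simps Zl_simps words_take_drop)
      then show "(x \<otimes>\<^bsub>?T\<^esub> \<one>\<^bsub>?T\<^esub>) w n = x w n"
        using w Zl_mod[OF val[OF x w], of n] by (simp add: tensor_mult[OF l x one] mod_simps)
    qed (use x one l in \<open>auto intro: tensor_mult_closed\<close>)
  qed
  fix x y z assume x: "x \<in> carrier ?T" and y: "y \<in> carrier ?T" and z: "z \<in> carrier ?T"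
  have xy: "x \<oplus>\<^bsub>?T\<^esub> y \<in> carrier ?T" using val[OF x] val[OF y] by (auto simp: tensor_simps)
  have adds: "(s \<oplus>\<^bsub>?T\<^esub> t) v n = (s v n + t v n) mod int l ^ n" if "v \<in> words r" for s t v n
    using that by (simp add: tensor_simps Zl_simps)
  have cl: "s \<oplus>\<^bsub>?T\<^esub> t \<in> carrier ?T" if "s \<in> carrier ?T" "t \<in> carrier ?T" for s t
    using val[OF that(1)] val[OF that(2)] by (auto simp: tensor_simps)
  show "(x \<oplus>\<^bsub>?T\<^esub> y) \<otimes>\<^bsub>?T\<^esub> z = x \<otimes>\<^bsub>?T\<^esub> z \<oplus>\<^bsub>?T\<^esub> y \<otimes>\<^bsub>?T\<^esub> z"
  proof (rule ext)
    fix w n assume w: "w \<in> words r"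
    have "((x \<oplus>\<^bsub>?T\<^esub> y) \<otimes>\<^bsub>?T\<^esub> z) w n = conv (\<lambda>v. x v n + y v n) (\<lambda>v. z v n) w mod int l ^ n"
      using w by (auto simp: tensor_mult[OF l xy z] adds words_take_drop intro!: conv_cong)
    then show "((x \<oplus>\<^bsub>?T\<^esub> y) \<otimes>\<^bsub>?T\<^esub> z) w n = (x \<otimes>\<^bsub>?T\<^esub> z \<oplus>\<^bsub>?T\<^esub> y \<otimes>\<^bsub>?T\<^esub> z) w n"
      using w by (simp add: adds tensor_mult[OF l x z] tensor_mult[OF l y z] conv_distrib_right mod_simps)
  qed (use x y z xy l in \<open>auto intro!: tensor_mult_closed cl\<close>)
  show "z \<otimes>\<^bsub>?T\<^esub> (x \<oplus>\<^bsub>?T\<^esub> y) = z \<otimes>\<^bsub>?T\<^esub> x \<oplus>\<^bsub>?T\<^esub> z \<otimes>\<^bsub>?T\<^esub> y"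
  proof (rule ext)
    fix w n assume w: "w \<in> words r"
    have "(z \<otimes>\<^bsub>?T\<^esub> (x \<oplus>\<^bsub>?T\<^esub> y)) w n = conv (\<lambda>v. z v n) (\<lambda>v. x v n + y v n) w mod int l ^ n"
      using w by (auto simp: tensor_mult[OF l z xy] adds words_take_drop intro!: conv_cong)
    then show "(z \<otimes>\<^bsub>?T\<^esub> (x \<oplus>\<^bsub>?T\<^esub> y)) w n = (z \<otimes>\<^bsub>?T\<^esub> x \<oplus>\<^bsub>?T\<^esub> z \<otimes>\<^bsub>?T\<^esub> y) w n"
      using w by (simp add: adds tensor_mult[OF l z x] tensor_mult[OF l z y] conv_distrib_left mod_simps)
  qed (use x y z xy l in \<open>auto intro!: tensor_mult_closed cl\<close>)
qed


section \<open>The completed group algebra\<close>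

text \<open>Push-forward of functions along a homomorphism of finite groups is multiplicative for the
  convolution products. It is stated modulo \<open>q\<close> because the entries of \<open>l\<close>-adic integers are
  residues.\<close>

lemma pushforward_convolution:
  fixes a b a' b' :: "_ \<Rightarrow> int"
  assumes "group G" "group G'" "finite (carrier G)" "finite (carrier G')" and \<pi>: "\<pi> \<in> hom G G'"
    and a': "\<And>d. d \<in> carrier G' \<Longrightarrow> a' d mod q = (\<Sum>e\<in>{e\<in>carrier G. \<pi> e = d}. a e) mod q"
    and b': "\<And>d. d \<in> carrier G' \<Longrightarrow> b' d mod q = (\<Sum>e\<in>{e\<in>carrier G. \<pi> e = d}. b e) mod q"
    and c': "c' \<in> carrier G'"
  shows "(\<Sum>d\<in>carrier G'. a' d * b' (inv\<^bsub>G'\<^esub> d \<otimes>\<^bsub>G'\<^esub> c')) mod q =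
    (\<Sum>c\<in>{c\<in>carrier G. \<pi> c = c'}. \<Sum>d\<in>carrier G. a d * b (inv\<^bsub>G\<^esub> d \<otimes>\<^bsub>G\<^esub> c)) mod q"
proof -
  interpret G: group G by fact
  interpret G': group G' by fact
  interpret hom: group_hom G G' \<pi>
    using \<pi> by (simp add: group_hom_def group_hom_axioms_def assms(1,2))
  let ?A = "\<lambda>d. \<Sum>e\<in>{e\<in>carrier G. \<pi> e = d}. a e"
  let ?B = "\<lambda>d. \<Sum>e\<in>{e\<in>carrier G. \<pi> e = d}. b e"
  have shift: "?B (inv\<^bsub>G'\<^esub> \<pi> d \<otimes>\<^bsub>G'\<^esub> c') =
      (\<Sum>c\<in>{c\<in>carrier G. \<pi> c = c'}. b (inv\<^bsub>G\<^esub> d \<otimes>\<^bsub>G\<^esub> c))" if d: "d \<in> carrier G" for d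
  proof (rule sum.reindex_bij_witness[where i = "\<lambda>c. inv\<^bsub>G\<^esub> d \<otimes>\<^bsub>G\<^esub> c" and j = "\<lambda>e. d \<otimes>\<^bsub>G\<^esub> e"])
    fix e assume e: "e \<in> {e \<in> carrier G. \<pi> e = inv\<^bsub>G'\<^esub> \<pi> d \<otimes>\<^bsub>G'\<^esub> c'}"
    then show "inv\<^bsub>G\<^esub> d \<otimes>\<^bsub>G\<^esub> (d \<otimes>\<^bsub>G\<^esub> e) = e"
      using d by (simp add: G.m_assoc[symmetric])
    then show "b (inv\<^bsub>G\<^esub> d \<otimes>\<^bsub>G\<^esub> (d \<otimes>\<^bsub>G\<^esub> e)) = b e" by simp
    show "d \<otimes>\<^bsub>G\<^esub> e \<in> {c \<in> carrier G. \<pi> c = c'}"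
      using d e c' by (simp add: G'.m_assoc[symmetric])
  next
    fix c assume c: "c \<in> {c \<in> carrier G. \<pi> c = c'}"
    show "d \<otimes>\<^bsub>G\<^esub> (inv\<^bsub>G\<^esub> d \<otimes>\<^bsub>G\<^esub> c) = c"
      using d c by (simp add: G.m_assoc[symmetric])
    show "inv\<^bsub>G\<^esub> d \<otimes>\<^bsub>G\<^esub> c \<in> {e \<in> carrier G. \<pi> e = inv\<^bsub>G'\<^esub> \<pi> d \<otimes>\<^bsub>G'\<^esub> c'}"
      using d c by simp
  qed
  have "(\<Sum>d\<in>carrier G'. a' d * b' (inv\<^bsub>G'\<^esub> d \<otimes>\<^bsub>G'\<^esub> c')) mod q =
      (\<Sum>d\<in>carrier G'. (a' d * b' (inv\<^bsub>G'\<^esub> d \<otimes>\<^bsub>G'\<^esub> c')) mod q) mod q"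
    by (simp add: mod_sum_eq)
  also have "\<dots> = (\<Sum>d\<in>carrier G'. (?A d * ?B (inv\<^bsub>G'\<^esub> d \<otimes>\<^bsub>G'\<^esub> c')) mod q) mod q"
    by (intro arg_cong[where f = "\<lambda>z. z mod q"] sum.cong refl mod_mult_cong a' b') (use c' in auto)
  also have "\<dots> = (\<Sum>d\<in>carrier G'. ?A d * ?B (inv\<^bsub>G'\<^esub> d \<otimes>\<^bsub>G'\<^esub> c')) mod q"
    by (simp add: mod_sum_eq)
  also have "(\<Sum>d\<in>carrier G'. ?A d * ?B (inv\<^bsub>G'\<^esub> d \<otimes>\<^bsub>G'\<^esub> c')) =
      (\<Sum>d\<in>carrier G'. \<Sum>e\<in>{e\<in>carrier G. \<pi> e = d}. a e * ?B (inv\<^bsub>G'\<^esub> \<pi> e \<otimes>\<^bsub>G'\<^esub> c'))"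
    by (auto simp: sum_distrib_right intro!: sum.cong)
  also have "\<dots> = (\<Sum>e\<in>carrier G. a e * ?B (inv\<^bsub>G'\<^esub> \<pi> e \<otimes>\<^bsub>G'\<^esub> c'))"
    by (rule sum.group) (use assms in auto)
  also have "\<dots> = (\<Sum>e\<in>carrier G. \<Sum>c\<in>{c\<in>carrier G. \<pi> c = c'}. a e * b (inv\<^bsub>G\<^esub> e \<otimes>\<^bsub>G\<^esub> c))"
    by (simp add: shift sum_distrib_left)
  also have "\<dots> = (\<Sum>c\<in>{c\<in>carrier G. \<pi> c = c'}. \<Sum>d\<in>carrier G. a d * b (inv\<^bsub>G\<^esub> d \<otimes>\<^bsub>G\<^esub> c))"
    by (rule sum.swap)
  finally show ?thesis .
qed

locale pro_l =
  fixes l :: nat and F :: "'a monoid" (structure) and T :: "'a topology"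
  assumes l_gt_1: "l > 1" and pro_l: "pro_l_group l F T"
begin

lemma l_pos: "l > 0"
  using l_gt_1 by simp

lemma topological_group: "topological_group F T"
  using pro_l by (simp add: pro_l_group_def profinite_group_def)

sublocale F: group F
  using topological_group by (simp add: topological_group_def)

sublocale Z: cring "Zl l"
  by (rule Zl_cring[OF l_pos])

lemma topspace_eq: "topspace T = carrier F"
  using topological_group by (simp add: topological_group_def)

lemma open_normalD:
  assumes "N \<in> open_normal F T"
  shows "N \<lhd> F" "subgroup N F" "N \<subseteq> carrier F" "openin T N" "finite (rcosets N)"
    "group (F Mod N)" "carrier (F Mod N) = rcosets N"
proof -
  show n: "N \<lhd> F" and "openin T N" using assms by (auto simp: open_normal_def)
  show "subgroup N F" using n by (rule normal.axioms(1))
  then show "N \<subseteq> carrier F" by (rule subgroup.subset)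
  show "group (F Mod N)" using n by (rule normal.factorgroup_is_group)
  show "carrier (F Mod N) = rcosets N" by (simp add: FactGroup_def)
  obtain k where "card (rcosets N) = l ^ k"
    using pro_l assms by (auto simp: pro_l_group_def)
  then show "finite (rcosets N)" using l_pos card.infinite by fastforce
qed

lemma carrier_open_normal: "carrier F \<in> open_normal F T"
  using F.normal_self topspace_eq openin_topspace[of T] by (simp add: open_normal_def)

lemma rcosetE:
  assumes "c \<in> rcosets N"
  obtains f where "f \<in> carrier F" "c = N #> f"
  using assms by (auto simp: RCOSETS_def)

lemma rcoset_mem_iff:
  assumes "subgroup N F" "c \<in> rcosets N" "f \<in> carrier F"
  shows "f \<in> c \<longleftrightarrow> c = N #> f"
  using assms(2) F.repr_independence[OF _ _ assms(1)] F.rcos_self[OF assms(3,1)]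
  by (metis rcosetE)

lemma rcosetI: "N \<in> open_normal F T \<Longrightarrow> f \<in> carrier F \<Longrightarrow> N #> f \<in> rcosets N"
  by (intro F.rcosetsI open_normalD(3))

lemma rcoset_mult:
  assumes "N \<in> open_normal F T" "f \<in> carrier F" "g \<in> carrier F"
  shows "(N #> f) <#> (N #> g) = N #> (f \<otimes> g)"
  by (rule normal.rcos_sum[OF open_normalD(1)[OF assms(1)] assms(2,3)])

lemma rcoset_inv:
  assumes "N \<in> open_normal F T" "f \<in> carrier F"
  shows "inv\<^bsub>F Mod N\<^esub> (N #> f) = N #> inv f"
proof -
  interpret normal N F by (rule open_normalD(1)[OF assms(1)])
  show ?thesis
    using rcosetI[OF assms] by (simp add: inv_FactGroup open_normalD(7)[OF assms(1)] rcos_inv assms(2))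
qed

text \<open>The transition maps \<open>F/N \<rightarrow> F/N'\<close> of the inverse system.\<close>

lemma coarsen_rcoset:
  assumes "N \<in> open_normal F T" "N' \<in> open_normal F T" "N \<subseteq> N'" "f \<in> carrier F"
  shows "N' <#> (N #> f) = N' #> f"
proof -
  note N = open_normalD(2,3)[OF assms(1)] and N' = open_normalD(2,3)[OF assms(2)]
  have "N' <#> N \<subseteq> N'"
    using assms(3) N'(1) by (auto simp: set_mult_def subset_iff intro: subgroup.m_closed)
  moreover have "N' \<subseteq> N' <#> N"
    using N'(2) N(1) subgroup.one_closed[OF N(1)]
    by (force simp: set_mult_def subset_iff intro: F.r_one[symmetric])
  ultimately have "N' <#> N = N'" by blast
  then show ?thesis using F.setmult_rcos_assoc[OF N'(2) N(2) assms(4)] by simp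
qed

lemma coarsen_hom:
  assumes "N \<in> open_normal F T" "N' \<in> open_normal F T" "N \<subseteq> N'"
  shows "(\<lambda>c. N' <#> c) \<in> hom (F Mod N) (F Mod N')"
proof (rule homI)
  fix c d assume "c \<in> carrier (F Mod N)" "d \<in> carrier (F Mod N)"
  then obtain f g where f: "f \<in> carrier F" "c = N #> f" and g: "g \<in> carrier F" "d = N #> g"
    using assms(1) by (metis open_normalD(7) rcosetE)
  show "N' <#> c \<in> carrier (F Mod N')"
    using f assms by (simp add: coarsen_rcoset open_normalD(7) rcosetI)
  show "N' <#> (c \<otimes>\<^bsub>F Mod N\<^esub> d) = (N' <#> c) \<otimes>\<^bsub>F Mod N'\<^esub> (N' <#> d)"
    using f g assms by (simp add: coarsen_rcoset rcoset_mult)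
qed

lemma rcoset_subset_iff:
  assumes "N \<in> open_normal F T" "N' \<in> open_normal F T" "N \<subseteq> N'"
    and "c \<in> rcosets N" "c' \<in> rcosets N'"
  shows "c \<subseteq> c' \<longleftrightarrow> N' <#> c = c'"
proof -
  obtain f where f: "f \<in> carrier F" "c = N #> f" using assms(4) by (rule rcosetE)
  note sg = open_normalD(2)[OF assms(1)] open_normalD(2)[OF assms(2)]
  have "c \<subseteq> c' \<longleftrightarrow> f \<in> c'"
  proof
    show "f \<in> c'" if "c \<subseteq> c'" using that f F.rcos_self[OF f(1) sg(1)] by blast
    show "c \<subseteq> c'" if "f \<in> c'"
      using that rcoset_mem_iff[OF sg(2) assms(5) f(1)] f assms(3) by (auto simp: r_coset_def)
  qed
  also have "\<dots> \<longleftrightarrow> N' <#> c = c'"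
    using rcoset_mem_iff[OF sg(2) assms(5) f(1)] coarsen_rcoset[OF assms(1-3) f(1)] f(2) by auto
  finally show ?thesis .
qed

text \<open>The fibres of the transition maps. They are the sets of cosets that occur in the coherence
  condition of the completed group algebra.\<close>

definition fib :: "'a set \<Rightarrow> 'a set \<Rightarrow> 'a set \<Rightarrow> 'a set set" where
  "fib N N' c' = {c \<in> rcosets N. N' <#> c = c'}"

lemma fib_eq:
  assumes "N \<in> open_normal F T" "N' \<in> open_normal F T" "N \<subseteq> N'" "c' \<in> rcosets N'"
  shows "{c \<in> rcosets N. c \<subseteq> c'} = fib N N' c'"
  using rcoset_subset_iff[OF assms(1-3) _ assms(4)] by (auto simp: fib_def)

lemma finite_fib: "N \<in> open_normal F T \<Longrightarrow> finite (fib N N' c')"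
  using open_normalD(5) by (auto simp: fib_def)

lemma cga_simps:
  "\<one>\<^bsub>cga l F T\<^esub> = (\<lambda>N\<in>open_normal F T. \<one>\<^bsub>group_algebra (Zl l) (F Mod N)\<^esub>)"
  "\<zero>\<^bsub>cga l F T\<^esub> = (\<lambda>N\<in>open_normal F T. \<lambda>c\<in>rcosets N. \<zero>\<^bsub>Zl l\<^esub>)"
  "\<alpha> \<oplus>\<^bsub>cga l F T\<^esub> \<beta> = (\<lambda>N\<in>open_normal F T. \<lambda>c\<in>rcosets N. \<alpha> N c \<oplus>\<^bsub>Zl l\<^esub> \<beta> N c)"
  "a \<odot>\<^bsub>cga l F T\<^esub> \<alpha> = (\<lambda>N\<in>open_normal F T. \<lambda>c\<in>rcosets N. a \<otimes>\<^bsub>Zl l\<^esub> \<alpha> N c)"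
  by (auto simp: cga_def group_algebra_def open_normalD(7) intro!: restrict_ext)

lemma cga_val:
  "\<alpha> \<in> carrier (cga l F T) \<Longrightarrow> N \<in> open_normal F T \<Longrightarrow> c \<in> rcosets N \<Longrightarrow> \<alpha> N c \<in> carrier (Zl l)"
  by (auto simp: cga_def group_algebra_def open_normalD(7) PiE_iff)

lemma cga_compat:
  assumes "\<alpha> \<in> carrier (cga l F T)" "N \<in> open_normal F T" "N' \<in> open_normal F T" "N \<subseteq> N'"
    "c' \<in> rcosets N'"
  shows "\<alpha> N' c' n = (\<Sum>c\<in>fib N N' c'. \<alpha> N c n) mod int l ^ n"
proof -
  have "\<alpha> N' c' = (\<Oplus>\<^bsub>Zl l\<^esub>c\<in>fib N N' c'. \<alpha> N c)"
    using assms fib_eq[OF assms(2-5)] by (auto simp: cga_def)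
  also have "\<dots> = (\<lambda>n. (\<Sum>c\<in>fib N N' c'. \<alpha> N c n) mod int l ^ n)"
    by (rule Zl_finsum[OF l_pos finite_fib[OF assms(2)]]) (use cga_val[OF assms(1,2)] in \<open>simp add: fib_def\<close>)
  finally show ?thesis by simp
qed

lemma cga_memI:
  assumes val: "\<And>N c. N \<in> open_normal F T \<Longrightarrow> c \<in> rcosets N \<Longrightarrow> \<alpha> N c \<in> carrier (Zl l)"
    and compat: "\<And>N N' c' n. N \<in> open_normal F T \<Longrightarrow> N' \<in> open_normal F T \<Longrightarrow> N \<subseteq> N' \<Longrightarrow>
      c' \<in> rcosets N' \<Longrightarrow> \<alpha> N' c' n = (\<Sum>c\<in>fib N N' c'. \<alpha> N c n) mod int l ^ n"
  shows "(\<lambda>N\<in>open_normal F T. \<lambda>c\<in>rcosets N. \<alpha> N c) \<in> carrier (cga l F T)" (is "?\<beta> \<in> _")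
proof -
  have beta: "?\<beta> N c = \<alpha> N c" if "N \<in> open_normal F T" "c \<in> rcosets N" for N c
    using that by simp
  have "?\<beta> N' c' = (\<Oplus>\<^bsub>Zl l\<^esub>c\<in>{c \<in> rcosets N. c \<subseteq> c'}. ?\<beta> N c)"
    if "N \<in> open_normal F T" "N' \<in> open_normal F T" "N \<subseteq> N'" "c' \<in> rcosets N'" for N N' c'
  proof -
    have "(\<Oplus>\<^bsub>Zl l\<^esub>c\<in>fib N N' c'. ?\<beta> N c) = (\<lambda>n. (\<Sum>c\<in>fib N N' c'. ?\<beta> N c n) mod int l ^ n)"
      by (rule Zl_finsum[OF l_pos finite_fib[OF that(1)]])
         (use val[OF that(1)] in \<open>simp add: fib_def that(1)\<close>)
    also have "\<dots> = (\<lambda>n. (\<Sum>c\<in>fib N N' c'. \<alpha> N c n) mod int l ^ n)"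
      using beta[OF that(1)]
      by (intro ext arg_cong[where f = "\<lambda>z. z mod _"] sum.cong refl) (auto simp: fib_def)
    finally show ?thesis
      using compat[OF that] beta[OF that(2,4)] by (simp add: fib_eq[OF that] fun_eq_iff)
  qed
  moreover have "?\<beta> \<in> (\<Pi>\<^sub>E N\<in>open_normal F T. carrier (group_algebra (Zl l) (F Mod N)))"
    using val by (auto simp: group_algebra_def open_normalD(7))
  ultimately show ?thesis
    unfolding cga_def partial_object.simps mem_Collect_eq by blast
qed

lemma cga_ext:
  assumes "\<alpha> \<in> carrier (cga l F T)" "\<beta> \<in> carrier (cga l F T)"
    "\<And>N c. N \<in> open_normal F T \<Longrightarrow> c \<in> rcosets N \<Longrightarrow> \<alpha> N c = \<beta> N c"
  shows "\<alpha> = \<beta>"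
proof (rule PiE_ext)
  let ?A = "\<Pi>\<^sub>E N\<in>open_normal F T. carrier (group_algebra (Zl l) (F Mod N))"
  show a: "\<alpha> \<in> ?A" and b: "\<beta> \<in> ?A" using assms(1,2) by (auto simp: cga_def)
  fix N assume N: "N \<in> open_normal F T"
  show "\<alpha> N = \<beta> N"
  proof (rule PiE_ext)
    show "\<alpha> N \<in> rcosets N \<rightarrow>\<^sub>E carrier (Zl l)" "\<beta> N \<in> rcosets N \<rightarrow>\<^sub>E carrier (Zl l)"
      using PiE_mem[OF a N] PiE_mem[OF b N] N by (auto simp: group_algebra_def open_normalD(7))
  qed (use assms(3) N in auto)
qed

lemma cga_add_closed:
  assumes "\<alpha> \<in> carrier (cga l F T)" "\<beta> \<in> carrier (cga l F T)"
  shows "\<alpha> \<oplus>\<^bsub>cga l F T\<^esub> \<beta> \<in> carrier (cga l F T)"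
  unfolding cga_simps
proof (rule cga_memI)
  fix N N' c' n assume *: "N \<in> open_normal F T" "N' \<in> open_normal F T" "N \<subseteq> N'" "c' \<in> rcosets N'"
  have "(\<alpha> N' c' \<oplus>\<^bsub>Zl l\<^esub> \<beta> N' c') n = ((\<Sum>c\<in>fib N N' c'. \<alpha> N c n) + (\<Sum>c\<in>fib N N' c'. \<beta> N c n)) mod int l ^ n"
    by (simp add: Zl_simps cga_compat[OF assms(1) *] cga_compat[OF assms(2) *] mod_simps)
  also have "\<dots> = (\<Sum>c\<in>fib N N' c'. (\<alpha> N c \<oplus>\<^bsub>Zl l\<^esub> \<beta> N c) n) mod int l ^ n"
    by (simp add: Zl_simps mod_sum_eq sum.distrib)
  finally show "(\<alpha> N' c' \<oplus>\<^bsub>Zl l\<^esub> \<beta> N' c') n = (\<Sum>c\<in>fib N N' c'. (\<alpha> N c \<oplus>\<^bsub>Zl l\<^esub> \<beta> N c) n) mod int l ^ n" .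
qed (use assms in \<open>auto intro: cga_val\<close>)

lemma cga_smult_closed:
  assumes "a \<in> carrier (Zl l)" "\<alpha> \<in> carrier (cga l F T)"
  shows "a \<odot>\<^bsub>cga l F T\<^esub> \<alpha> \<in> carrier (cga l F T)"
  unfolding cga_simps
proof (rule cga_memI)
  fix N N' c' n assume *: "N \<in> open_normal F T" "N' \<in> open_normal F T" "N \<subseteq> N'" "c' \<in> rcosets N'"
  have "(a \<otimes>\<^bsub>Zl l\<^esub> \<alpha> N' c') n = (a n * (\<Sum>c\<in>fib N N' c'. \<alpha> N c n)) mod int l ^ n"
    by (simp add: Zl_simps cga_compat[OF assms(2) *] mod_simps)
  also have "\<dots> = (\<Sum>c\<in>fib N N' c'. (a \<otimes>\<^bsub>Zl l\<^esub> \<alpha> N c) n) mod int l ^ n"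
    by (simp add: Zl_simps mod_sum_eq sum_distrib_left)
  finally show "(a \<otimes>\<^bsub>Zl l\<^esub> \<alpha> N' c') n = (\<Sum>c\<in>fib N N' c'. (a \<otimes>\<^bsub>Zl l\<^esub> \<alpha> N c) n) mod int l ^ n" .
qed (use assms in \<open>auto intro: cga_val\<close>)

lemma cga_zero_closed: "\<zero>\<^bsub>cga l F T\<^esub> \<in> carrier (cga l F T)"
  unfolding cga_simps by (rule cga_memI) (auto simp: Zl_simps l_pos)

lemma cga_mult_val:
  assumes "\<alpha> \<in> carrier (cga l F T)" "\<beta> \<in> carrier (cga l F T)"
    "N \<in> open_normal F T" "c \<in> rcosets N"
  shows "(\<alpha> \<otimes>\<^bsub>cga l F T\<^esub> \<beta>) N c =
    (\<lambda>n. (\<Sum>d\<in>rcosets N. \<alpha> N d n * \<beta> N (inv\<^bsub>F Mod N\<^esub> d <#> c) n) mod int l ^ n)"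
proof -
  interpret Q: group "F Mod N" by (rule open_normalD(6)[OF assms(3)])
  note [simp] = open_normalD(7)[OF assms(3)]
  have cl: "inv\<^bsub>F Mod N\<^esub> d <#> c \<in> rcosets N" if "d \<in> rcosets N" for d
    using Q.m_closed[OF Q.inv_closed, of d c] that assms(4) by simp
  have "(\<alpha> \<otimes>\<^bsub>cga l F T\<^esub> \<beta>) N c =
      (\<Oplus>\<^bsub>Zl l\<^esub>d\<in>rcosets N. \<alpha> N d \<otimes>\<^bsub>Zl l\<^esub> \<beta> N (inv\<^bsub>F Mod N\<^esub> d <#> c))"
    using assms(3,4) by (simp add: cga_def group_algebra_def)
  also have "\<dots> = (\<lambda>n. (\<Sum>d\<in>rcosets N. (\<alpha> N d \<otimes>\<^bsub>Zl l\<^esub> \<beta> N (inv\<^bsub>F Mod N\<^esub> d <#> c)) n) mod int l ^ n)"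
    by (rule Zl_finsum[OF l_pos open_normalD(5)[OF assms(3)]])
       (use cl assms in \<open>simp add: cga_val\<close>)
  also have "\<dots> = (\<lambda>n. (\<Sum>d\<in>rcosets N. \<alpha> N d n * \<beta> N (inv\<^bsub>F Mod N\<^esub> d <#> c) n) mod int l ^ n)"
    by (simp add: Zl_simps mod_sum_eq)
  finally show ?thesis .
qed

lemma cga_mult_restrict:
  "\<alpha> \<otimes>\<^bsub>cga l F T\<^esub> \<beta> = (\<lambda>N\<in>open_normal F T. \<lambda>c\<in>rcosets N. (\<alpha> \<otimes>\<^bsub>cga l F T\<^esub> \<beta>) N c)"
  by (auto simp: cga_def group_algebra_def open_normalD(7) intro!: restrict_ext)

text \<open>Coherence of a product is multiplicativity of the push-forward along \<open>F/N \<rightarrow> F/N'\<close>.\<close>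

lemma cga_mult_closed:
  assumes a: "\<alpha> \<in> carrier (cga l F T)" and b: "\<beta> \<in> carrier (cga l F T)"
  shows "\<alpha> \<otimes>\<^bsub>cga l F T\<^esub> \<beta> \<in> carrier (cga l F T)"
  apply (subst cga_mult_restrict)
proof (rule cga_memI)
  fix N c assume N: "N \<in> open_normal F T" and c: "c \<in> rcosets N"
  interpret Q: group "F Mod N" by (rule open_normalD(6)[OF N])
  note [simp] = open_normalD(7)[OF N]
  have cl: "inv\<^bsub>F Mod N\<^esub> d <#> c \<in> rcosets N" if "d \<in> rcosets N" for d
    using Q.m_closed[OF Q.inv_closed, of d c] that c by simp
  have "(\<alpha> \<otimes>\<^bsub>cga l F T\<^esub> \<beta>) N c =
      (\<Oplus>\<^bsub>Zl l\<^esub>d\<in>rcosets N. \<alpha> N d \<otimes>\<^bsub>Zl l\<^esub> \<beta> N (inv\<^bsub>F Mod N\<^esub> d <#> c))"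
    using N c by (simp add: cga_def group_algebra_def)
  then show "(\<alpha> \<otimes>\<^bsub>cga l F T\<^esub> \<beta>) N c \<in> carrier (Zl l)"
    using cl a b N by (simp add: cga_val Pi_iff)
next
  fix N N' c' n assume *: "N \<in> open_normal F T" "N' \<in> open_normal F T" "N \<subseteq> N'" "c' \<in> rcosets N'"
  note [simp] = open_normalD(7)[OF *(1)] open_normalD(7)[OF *(2)]
  have "(\<Sum>d\<in>carrier (F Mod N'). \<alpha> N' d n * \<beta> N' (inv\<^bsub>F Mod N'\<^esub> d \<otimes>\<^bsub>F Mod N'\<^esub> c') n) mod int l ^ n =
      (\<Sum>c\<in>{c\<in>carrier (F Mod N). N' <#> c = c'}. \<Sum>d\<in>carrier (F Mod N).
        \<alpha> N d n * \<beta> N (inv\<^bsub>F Mod N\<^esub> d \<otimes>\<^bsub>F Mod N\<^esub> c) n) mod int l ^ n"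
    by (rule pushforward_convolution[OF open_normalD(6)[OF *(1)] open_normalD(6)[OF *(2)] _ _ coarsen_hom[OF *(1-3)]])
       (use * cga_compat[OF a *(1-3)] cga_compat[OF b *(1-3)] in
          \<open>auto simp: open_normalD(5) mod_simps simp flip: fib_def\<close>)
  then show "(\<alpha> \<otimes>\<^bsub>cga l F T\<^esub> \<beta>) N' c' n = (\<Sum>c\<in>fib N N' c'. (\<alpha> \<otimes>\<^bsub>cga l F T\<^esub> \<beta>) N c n) mod int l ^ n"
    using * cga_mult_val[OF a b] by (auto simp: mod_sum_eq fib_def)
qed

lemma cga_of_closed:
  assumes f: "f \<in> carrier F"
  shows "cga_of l F T f \<in> carrier (cga l F T)"
  unfolding cga_of_def
proof (rule cga_memI)
  fix N N' c' n assume *: "N \<in> open_normal F T" "N' \<in> open_normal F T" "N \<subseteq> N'" "c' \<in> rcosets N'"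
  have "(\<Sum>c\<in>fib N N' c'. (if f \<in> c then \<one>\<^bsub>Zl l\<^esub> else \<zero>\<^bsub>Zl l\<^esub>) n) =
      (\<Sum>c\<in>fib N N' c'. if c = N #> f then 1 mod int l ^ n else 0)"
    by (intro sum.cong) (auto simp: fib_def rcoset_mem_iff[OF open_normalD(2)[OF *(1)] _ f] Zl_simps)
  also have "\<dots> = (if N #> f \<in> fib N N' c' then 1 mod int l ^ n else 0)"
    using finite_fib[OF *(1)] by simp
  also have "N #> f \<in> fib N N' c' \<longleftrightarrow> f \<in> c'"
    using rcoset_mem_iff[OF open_normalD(2)[OF *(2)] *(4) f] coarsen_rcoset[OF *(1-3) f]
      rcosetI[OF *(1) f] by (auto simp: fib_def)
  finally show "(if f \<in> c' then \<one>\<^bsub>Zl l\<^esub> else \<zero>\<^bsub>Zl l\<^esub>) n =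
      (\<Sum>c\<in>fib N N' c'. (if f \<in> c then \<one>\<^bsub>Zl l\<^esub> else \<zero>\<^bsub>Zl l\<^esub>) n) mod int l ^ n"
    by (simp add: Zl_simps)
qed simp

lemma cga_one: "\<one>\<^bsub>cga l F T\<^esub> = cga_of l F T \<one>"
proof -
  have "(c = N) = (\<one> \<in> c)" if "N \<in> open_normal F T" "c \<in> rcosets N" for N c
    using rcoset_mem_iff[OF open_normalD(2)[OF that(1)] that(2) F.one_closed]
      F.coset_mult_one[OF open_normalD(3)[OF that(1)]] by simp
  then show ?thesis
    by (auto simp: cga_simps cga_of_def group_algebra_def open_normalD(7) intro!: restrict_ext)
qed

lemma cga_of_mult:
  assumes f: "f \<in> carrier F" and g: "g \<in> carrier F"
  shows "cga_of l F T (f \<otimes> g) = cga_of l F T f \<otimes>\<^bsub>cga l F T\<^esub> cga_of l F T g"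
proof (rule cga_ext)
  fix N c assume N: "N \<in> open_normal F T" and c: "c \<in> rcosets N"
  note sg = open_normalD(2)[OF N]
  obtain h where h: "h \<in> carrier F" "c = N #> h" using c by (rule rcosetE)
  let ?u = "\<lambda>n. 1 mod int l ^ n"
  have fg: "g \<in> inv\<^bsub>F Mod N\<^esub> (N #> f) <#> c \<longleftrightarrow> f \<otimes> g \<in> c"
  proof -
    have "g \<in> inv\<^bsub>F Mod N\<^esub> (N #> f) <#> c \<longleftrightarrow> g \<in> N #> (inv f \<otimes> h)"
      using f h by (simp add: rcoset_inv[OF N] rcoset_mult[OF N])
    also have "\<dots> \<longleftrightarrow> N #> (inv f \<otimes> h) = N #> g"
      using f g h by (subst rcoset_mem_iff[OF sg]) (auto intro!: rcosetI[OF N])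
    also have "\<dots> \<longleftrightarrow> N #> h = N #> (f \<otimes> g)"
    proof
      assume "N #> (inv f \<otimes> h) = N #> g"
      then have "(N #> f) <#> (N #> (inv f \<otimes> h)) = (N #> f) <#> (N #> g)" by simp
      then show "N #> h = N #> (f \<otimes> g)"
        using f g h by (simp add: rcoset_mult[OF N] F.m_assoc[symmetric])
    next
      assume "N #> h = N #> (f \<otimes> g)"
      then have "(N #> inv f) <#> (N #> h) = (N #> inv f) <#> (N #> (f \<otimes> g))" by simp
      then show "N #> (inv f \<otimes> h) = N #> g"
        using f g h by (simp add: rcoset_mult[OF N] F.m_assoc[symmetric])
    qed
    also have "\<dots> \<longleftrightarrow> f \<otimes> g \<in> c"
      using rcoset_mem_iff[OF sg c] f g h by auto
    finally show ?thesis .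
  qed
  interpret Q: group "F Mod N" by (rule open_normalD(6)[OF N])
  have cl: "inv\<^bsub>F Mod N\<^esub> d <#> c \<in> rcosets N" if "d \<in> rcosets N" for d
    using Q.m_closed[OF Q.inv_closed, of d c] that c by (simp add: open_normalD(7)[OF N])
  have "(\<Sum>d\<in>rcosets N. cga_of l F T f N d n * cga_of l F T g N (inv\<^bsub>F Mod N\<^esub> d <#> c) n) =
      (\<Sum>d\<in>rcosets N. if d = N #> f then (if f \<otimes> g \<in> c then ?u n * ?u n else 0) else 0)" for n
    using N cl fg by (intro sum.cong refl) (auto simp: cga_of_def rcoset_mem_iff[OF sg _ f] Zl_simps)
  also have "\<dots> n = (if f \<otimes> g \<in> c then ?u n * ?u n else 0)" for n
    using open_normalD(5)[OF N] rcosetI[OF N f] by simp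
  finally show "cga_of l F T (f \<otimes> g) N c = (cga_of l F T f \<otimes>\<^bsub>cga l F T\<^esub> cga_of l F T g) N c"
    using N c f g by (simp add: cga_mult_val cga_of_closed) (auto simp: cga_of_def Zl_simps mod_simps)
qed (use f g in \<open>auto intro!: cga_of_closed cga_mult_closed\<close>)

section \<open>Inversion, augmentation and induced maps\<close>

lemma coset_inv_closed:
  assumes "N \<in> open_normal F T" "c \<in> rcosets N"
  shows "inv\<^bsub>F Mod N\<^esub> c \<in> rcosets N" "inv\<^bsub>F Mod N\<^esub> (inv\<^bsub>F Mod N\<^esub> c) = c"
proof -
  interpret Q: group "F Mod N" by (rule open_normalD(6)[OF assms(1)])
  show "inv\<^bsub>F Mod N\<^esub> c \<in> rcosets N" "inv\<^bsub>F Mod N\<^esub> (inv\<^bsub>F Mod N\<^esub> c) = c"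
    using Q.inv_closed[of c] Q.inv_inv[of c] assms(2) by (simp_all add: open_normalD(7)[OF assms(1)])
qed

lemma coarsen_inv:
  assumes "N \<in> open_normal F T" "N' \<in> open_normal F T" "N \<subseteq> N'" "c \<in> rcosets N"
  shows "N' <#> (inv\<^bsub>F Mod N\<^esub> c) = inv\<^bsub>F Mod N'\<^esub> (N' <#> c)"
  using assms(4)
  by (auto elim!: rcosetE simp: rcoset_inv[OF assms(1)] rcoset_inv[OF assms(2)]
      coarsen_rcoset[OF assms(1-3)])

lemma bar_val:
  "N \<in> open_normal F T \<Longrightarrow> c \<in> rcosets N \<Longrightarrow> bar F T \<alpha> N c = \<alpha> N (inv\<^bsub>F Mod N\<^esub> c)"
  by (simp add: bar_def)

lemma bar_closed:
  assumes a: "\<alpha> \<in> carrier (cga l F T)"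
  shows "bar F T \<alpha> \<in> carrier (cga l F T)"
  unfolding bar_def
proof (rule cga_memI)
  fix N N' c' n assume *: "N \<in> open_normal F T" "N' \<in> open_normal F T" "N \<subseteq> N'" "c' \<in> rcosets N'"
  have "(\<Sum>c\<in>fib N N' (inv\<^bsub>F Mod N'\<^esub> c'). \<alpha> N c n) = (\<Sum>c\<in>fib N N' c'. \<alpha> N (inv\<^bsub>F Mod N\<^esub> c) n)"
    by (rule sum.reindex_bij_witness[where i = "\<lambda>c. inv\<^bsub>F Mod N\<^esub> c" and j = "\<lambda>c. inv\<^bsub>F Mod N\<^esub> c"])
       (use * in \<open>auto simp: fib_def coset_inv_closed coarsen_inv[OF *(1-3)]\<close>)
  then show "\<alpha> N' (inv\<^bsub>F Mod N'\<^esub> c') n = (\<Sum>c\<in>fib N N' c'. \<alpha> N (inv\<^bsub>F Mod N\<^esub> c) n) mod int l ^ n"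
    by (simp add: cga_compat[OF a *(1-3) coset_inv_closed(1)[OF *(2,4)]])
qed (use a in \<open>auto intro!: cga_val coset_inv_closed\<close>)

lemma bar_bar:
  assumes "\<alpha> \<in> carrier (cga l F T)"
  shows "bar F T (bar F T \<alpha>) = \<alpha>"
  by (rule cga_ext) (use assms in \<open>auto intro!: bar_closed simp: bar_val coset_inv_closed\<close>)

lemma bar_add:
  assumes "\<alpha> \<in> carrier (cga l F T)" "\<beta> \<in> carrier (cga l F T)"
  shows "bar F T (\<alpha> \<oplus>\<^bsub>cga l F T\<^esub> \<beta>) = bar F T \<alpha> \<oplus>\<^bsub>cga l F T\<^esub> bar F T \<beta>"
  by (rule cga_ext[OF bar_closed[OF cga_add_closed[OF assms]] cga_add_closed[OF bar_closed bar_closed, OF assms]])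
     (simp add: bar_val coset_inv_closed cga_simps)

text \<open>Inversion reverses products: the sum for \<open>c\<^sup>-\<^sup>1\<close> turns into the sum for \<open>c\<close> under the
  substitution \<open>e = c d\<close>.\<close>

lemma bar_mult:
  assumes a: "\<alpha> \<in> carrier (cga l F T)" and b: "\<beta> \<in> carrier (cga l F T)"
  shows "bar F T (\<alpha> \<otimes>\<^bsub>cga l F T\<^esub> \<beta>) = bar F T \<beta> \<otimes>\<^bsub>cga l F T\<^esub> bar F T \<alpha>"
proof (rule cga_ext)
  fix N c assume N: "N \<in> open_normal F T" and c: "c \<in> rcosets N"
  interpret Q: group "F Mod N" by (rule open_normalD(6)[OF N])
  note [simp] = open_normalD(7)[OF N]
  note cl = Q.m_closed[simplified] Q.inv_closed[simplified]
  note ic = coset_inv_closed[OF N]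
  have canc: "inv\<^bsub>F Mod N\<^esub> e <#> (e <#> d) = d" "e <#> (inv\<^bsub>F Mod N\<^esub> e <#> d) = d"
    if "e \<in> rcosets N" "d \<in> rcosets N" for e d
    using Q.inv_solve_left[of d e "e <#> d"] Q.m_assoc[of e "inv\<^bsub>F Mod N\<^esub> e" d] Q.r_inv[of e] Q.l_one[of d] that cl
    by auto
  have invm: "inv\<^bsub>F Mod N\<^esub> (e <#> d) = inv\<^bsub>F Mod N\<^esub> d <#> inv\<^bsub>F Mod N\<^esub> e"
    if "e \<in> rcosets N" "d \<in> rcosets N" for e d
    using Q.inv_mult_group[of e d] that by simp
  have "(\<Sum>d\<in>rcosets N. \<alpha> N d n * \<beta> N (inv\<^bsub>F Mod N\<^esub> d <#> inv\<^bsub>F Mod N\<^esub> c) n) =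
      (\<Sum>e\<in>rcosets N. bar F T \<beta> N e n * bar F T \<alpha> N (inv\<^bsub>F Mod N\<^esub> e <#> c) n)" for n
    by (rule sum.reindex_bij_witness[where i = "\<lambda>e. inv\<^bsub>F Mod N\<^esub> c <#> e" and j = "\<lambda>d. c <#> d"])
       (use c N in \<open>auto simp: cl bar_val invm canc ic\<close>)
  then show "bar F T (\<alpha> \<otimes>\<^bsub>cga l F T\<^esub> \<beta>) N c = (bar F T \<beta> \<otimes>\<^bsub>cga l F T\<^esub> bar F T \<alpha>) N c"
    using N c a b by (simp add: bar_val cga_mult_val bar_closed ic)
qed (use a b in \<open>auto intro!: bar_closed cga_mult_closed\<close>)

lemma bar_cga_of:
  assumes f: "f \<in> carrier F"
  shows "bar F T (cga_of l F T f) = cga_of l F T (inv f)"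
proof (rule cga_ext)
  fix N c assume N: "N \<in> open_normal F T" and c: "c \<in> rcosets N"
  have "f \<in> inv\<^bsub>F Mod N\<^esub> c \<longleftrightarrow> inv\<^bsub>F Mod N\<^esub> c = N #> f"
    by (rule rcoset_mem_iff[OF open_normalD(2)[OF N] coset_inv_closed(1)[OF N c] f])
  also have "\<dots> \<longleftrightarrow> c = N #> inv f"
    using coset_inv_closed(2)[OF N c] rcoset_inv[OF N] f by (metis F.inv_closed F.inv_inv)
  also have "\<dots> \<longleftrightarrow> inv f \<in> c"
    using rcoset_mem_iff[OF open_normalD(2)[OF N] c F.inv_closed[OF f]] by simp
  finally show "bar F T (cga_of l F T f) N c = cga_of l F T (inv f) N c"
    using N c by (simp add: bar_val cga_of_def coset_inv_closed)
qed (use f in \<open>auto intro!: bar_closed cga_of_closed\<close>)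

lemma rcosets_carrier: "rcosets carrier F = {carrier F}"
  using F.coset_join2[OF _ F.subgroup_self] by (auto simp: RCOSETS_def)

lemma aug_closed: "\<alpha> \<in> carrier (cga l F T) \<Longrightarrow> augmentation F \<alpha> \<in> carrier (Zl l)"
  unfolding augmentation_def by (rule cga_val[OF _ carrier_open_normal]) (simp_all add: rcosets_carrier)

lemma aug_add: "augmentation F (\<alpha> \<oplus>\<^bsub>cga l F T\<^esub> \<beta>) = augmentation F \<alpha> \<oplus>\<^bsub>Zl l\<^esub> augmentation F \<beta>"
  by (simp add: augmentation_def cga_simps carrier_open_normal rcosets_carrier)

lemma aug_smult: "augmentation F (a \<odot>\<^bsub>cga l F T\<^esub> \<alpha>) = a \<otimes>\<^bsub>Zl l\<^esub> augmentation F \<alpha>"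
  by (simp add: augmentation_def cga_simps carrier_open_normal rcosets_carrier)

lemma aug_zero: "augmentation F \<zero>\<^bsub>cga l F T\<^esub> = \<zero>\<^bsub>Zl l\<^esub>"
  by (simp add: augmentation_def cga_simps carrier_open_normal rcosets_carrier)

lemma aug_cga_of: "f \<in> carrier F \<Longrightarrow> augmentation F (cga_of l F T f) = \<one>\<^bsub>Zl l\<^esub>"
  by (simp add: augmentation_def cga_of_def carrier_open_normal rcosets_carrier)

lemma aug_bar: "augmentation F (bar F T \<alpha>) = augmentation F \<alpha>"
  using coset_inv_closed(1)[OF carrier_open_normal, of "carrier F"]
  by (simp add: augmentation_def bar_val carrier_open_normal rcosets_carrier)

lemma aug_mult:
  assumes "\<alpha> \<in> carrier (cga l F T)" "\<beta> \<in> carrier (cga l F T)"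
  shows "augmentation F (\<alpha> \<otimes>\<^bsub>cga l F T\<^esub> \<beta>) = augmentation F \<alpha> \<otimes>\<^bsub>Zl l\<^esub> augmentation F \<beta>"
proof -
  have "inv\<^bsub>F Mod carrier F\<^esub> (carrier F) <#> carrier F = carrier F"
    using coset_inv_closed(1)[OF carrier_open_normal, of "carrier F"]
      F.subgroup_mult_id[OF F.subgroup_self] by (simp add: rcosets_carrier)
  then show ?thesis
    using cga_mult_val[OF assms carrier_open_normal, of "carrier F"]
    by (simp add: augmentation_def rcosets_carrier Zl_simps)
qed

text \<open>Continuity of \<open>\<phi>\<close> makes preimages of open normal subgroups open, so the cosets at which
  the induced map evaluates its argument are cosets of the inverse system.\<close>

lemma top_auto_preimage:
  assumes \<phi>: "\<phi> \<in> top_auto F T" and N: "N \<in> open_normal F T"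
  shows "\<phi> -` N \<inter> carrier F \<in> open_normal F T"
    and "c \<in> rcosets N \<Longrightarrow> \<phi> -` c \<inter> carrier F \<in> rcosets (\<phi> -` N \<inter> carrier F)"
proof -
  have hom: "\<phi> \<in> hom F F" and bij: "bij_betw \<phi> (carrier F) (carrier F)" and cont: "continuous_map T T \<phi>"
    using \<phi> homeomorphic_imp_continuous_map by (auto simp: top_auto_def auto_def Bij_def)
  interpret \<phi>: group_hom F F \<phi>
    using hom by (simp add: group_hom_def group_hom_axioms_def F.group_axioms)
  have cl: "\<phi> f \<in> carrier F" if "f \<in> carrier F" for f using that by simp
  have n: "subgroup N F" "\<And>a h. a \<in> carrier F \<Longrightarrow> h \<in> N \<Longrightarrow> a \<otimes> h \<otimes> inv a \<in> N"
    using open_normalD(1)[OF N] by (auto simp: F.normal_inv_iff)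
  have "\<one> \<in> \<phi> -` N \<inter> carrier F"
    using subgroup.one_closed[OF n(1)] by simp
  then have "\<phi> -` N \<inter> carrier F \<noteq> {}" by blast
  then have "subgroup (\<phi> -` N \<inter> carrier F) F"
    using n(1) by (intro F.subgroupI) (auto simp: subgroup.m_closed subgroup.m_inv_closed)
  moreover have "openin T (\<phi> -` N \<inter> carrier F)"
    using openin_continuous_map_preimage[OF cont open_normalD(4)[OF N]]
    by (simp add: topspace_eq vimage_def Int_def conj_commute)
  ultimately show "\<phi> -` N \<inter> carrier F \<in> open_normal F T"
    using n(2) by (auto simp: open_normal_def F.normal_inv_iff)
  assume "c \<in> rcosets N"
  then obtain h where h: "h \<in> carrier F" "c = N #> h" by (rule rcosetE)
  then obtain f where f: "f \<in> carrier F" "h = \<phi> f" using bij by (auto simp: bij_betw_def)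
  have "\<phi> -` c \<inter> carrier F = (\<phi> -` N \<inter> carrier F) #> f"
  proof
    show "(\<phi> -` N \<inter> carrier F) #> f \<subseteq> \<phi> -` c \<inter> carrier F"
      using f h by (auto simp: r_coset_def)
    show "\<phi> -` c \<inter> carrier F \<subseteq> (\<phi> -` N \<inter> carrier F) #> f"
    proof
      fix e assume e: "e \<in> \<phi> -` c \<inter> carrier F"
      then obtain u where u: "u \<in> N" "\<phi> e = u \<otimes> \<phi> f" using h f by (auto simp: r_coset_def)
      have uc: "u \<in> carrier F" using u(1) open_normalD(3)[OF N] by blast
      have "\<phi> (e \<otimes> inv f) = u" using u e f uc by (simp add: F.m_assoc)
      then have "e \<otimes> inv f \<in> \<phi> -` N \<inter> carrier F" using u e f by auto
      moreover have "e = e \<otimes> inv f \<otimes> f" using e f by (simp add: F.m_assoc)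
      ultimately show "e \<in> (\<phi> -` N \<inter> carrier F) #> f" unfolding r_coset_def by blast
    qed
  qed
  then show "\<phi> -` c \<inter> carrier F \<in> rcosets (\<phi> -` N \<inter> carrier F)"
    using f(1) by (auto simp: RCOSETS_def)
qed

text \<open>This value and linearity determine the induced map on the elements \<open>x\<^sub>j - 1\<close>, to which
  the Johnson map applies it at \<open>X\<^sub>j\<close>.\<close>

lemma cga_map_cga_of:
  assumes \<phi>: "\<phi> \<in> top_auto F T" and f: "f \<in> carrier F"
  shows "cga_map F T \<phi> (cga_of l F T f) = cga_of l F T (\<phi> f)"
  using top_auto_preimage[OF \<phi>] f
  by (auto simp: cga_map_def cga_of_def intro!: restrict_ext)

lemma cga_map_linear:
  assumes \<phi>: "\<phi> \<in> top_auto F T"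
  shows "cga_map F T \<phi> (\<alpha> \<oplus>\<^bsub>cga l F T\<^esub> a \<odot>\<^bsub>cga l F T\<^esub> \<beta>) =
    cga_map F T \<phi> \<alpha> \<oplus>\<^bsub>cga l F T\<^esub> a \<odot>\<^bsub>cga l F T\<^esub> cga_map F T \<phi> \<beta>"
  using top_auto_preimage[OF \<phi>]
  by (auto simp: cga_map_def cga_simps intro!: restrict_ext)


section \<open>Residual finiteness and \<open>l\<close>-adic powers\<close>

lemma compact_space: "compact_space T" and Hausdorff_space: "Hausdorff_space T"
  using pro_l by (simp_all add: pro_l_group_def profinite_group_def)

lemma continuous_mult:
  assumes "continuous_map Y T f" "continuous_map Y T g"
  shows "continuous_map Y T (\<lambda>y. f y \<otimes> g y)"
proof -
  have "continuous_map (prod_topology T T) T (\<lambda>(a, b). a \<otimes> b)"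
    using topological_group by (simp add: topological_group_def)
  from continuous_map_compose[OF continuous_map_pairedI[OF assms] this]
  show ?thesis by (simp add: o_def)
qed

lemma continuous_inv:
  assumes "continuous_map Y T f"
  shows "continuous_map Y T (\<lambda>y. inv f y)"
proof -
  have "continuous_map T T (\<lambda>a. inv a)"
    using topological_group by (simp add: topological_group_def)
  from continuous_map_compose[OF assms this] show ?thesis by (simp add: o_def)
qed

lemma continuous_const: "a \<in> carrier F \<Longrightarrow> continuous_map Y T (\<lambda>_. a)"
  by (simp add: topspace_eq)

text \<open>The tube lemma, in the form in which it makes sets of group elements open.\<close>

lemma openin_forall_compact:
  assumes K: "closedin T K" and V: "openin T V"
    and h: "continuous_map (prod_topology T T) T (\<lambda>(k, g). h k g)"
  shows "openin T {g \<in> carrier F. \<forall>k\<in>K. h k g \<in> V}"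
proof -
  let ?B = "{p \<in> topspace (prod_topology T T). (\<lambda>(k, g). h k g) p \<in> carrier F - V} \<inter> (K \<times> topspace T)"
  have "closedin T (carrier F - V)" using V topspace_eq by (metis closedin_diff closedin_topspace)
  then have "closedin (prod_topology T T) ?B"
    by (intro closedin_Int closedin_continuous_map_preimage[OF h]) (simp_all add: closedin_prod_Times_iff K)
  then have closed: "closedin T (snd ` ?B)"
    using closed_map_snd[OF compact_space] by (auto simp: closed_map_def)
  have hF: "h k g \<in> carrier F" if "k \<in> carrier F" "g \<in> carrier F" for k g
    using continuous_map_funspace[OF h] that by (auto simp: topspace_eq Pi_iff)
  have Kc: "K \<subseteq> carrier F" using closedin_subset[OF K] topspace_eq by simp
  have "{g \<in> carrier F. \<forall>k\<in>K. h k g \<in> V} = topspace T - snd ` ?B"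
  proof (intro Set.set_eqI iffI)
    fix g assume g: "g \<in> {g \<in> carrier F. \<forall>k\<in>K. h k g \<in> V}"
    then have "g \<noteq> snd p" if "p \<in> ?B" for p using that by (cases p) auto
    then show "g \<in> topspace T - snd ` ?B" using g topspace_eq by blast
  next
    fix g assume g: "g \<in> topspace T - snd ` ?B"
    have "h k g \<in> V" if k: "k \<in> K" for k
    proof (rule ccontr)
      assume "h k g \<notin> V"
      then have "(k, g) \<in> ?B" using g k hF[of k g] Kc by (auto simp: topspace_eq)
      then have "snd (k, g) \<in> snd ` ?B" by (rule imageI)
      then show False using g by simp
    qed
    then show "g \<in> {g \<in> carrier F. \<forall>k\<in>K. h k g \<in> V}" using g topspace_eq by simp
  qed
  moreover have "openin T (topspace T - snd ` ?B)" using closed by (simp only: closedin_def)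
  ultimately show ?thesis by (simp only:)
qed

text \<open>A clopen neighbourhood of 1 contains the open subgroup of the elements that preserve it
  under right multiplication, and the elements all of whose conjugates lie in that subgroup form
  an open normal subgroup.\<close>

lemma residually_finite:
  assumes a: "a \<in> carrier F" "a \<noteq> \<one>"
  obtains N where "N \<in> open_normal F T" "a \<notin> N"
proof -
  have "{\<one>} = connected_component_of_set T \<one>"
    using pro_l by (simp add: pro_l_group_def profinite_group_def)
  then have "{\<one>} \<in> connected_components_of T"
    unfolding connected_components_of_def using topspace_eq by blast
  moreover have "compactin T {\<one>}" by (simp add: topspace_eq)
  ultimately have "{\<one>} \<in> quasi_components_of T"
    using compact_quasi_eq_connected_components_of[OF compact_imp_locally_compact_space[OF compact_space] Hausdorff_space]
    by blast
  then obtain y where y: "{\<one>} = quasi_component_of_set T y"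
    by (auto simp: quasi_components_of_def)
  have "\<not> quasi_component_of T \<one> a"
  proof
    assume "quasi_component_of T \<one> a"
    moreover have "quasi_component_of T y \<one>" using y by blast
    ultimately have "quasi_component_of T y a" by (metis quasi_component_of_trans)
    then show False using y a(2) by blast
  qed
  then obtain C where C: "\<one> \<in> C" "closedin T C" "openin T C" "a \<notin> C"
    using a(1) topspace_eq by (auto simp: quasi_component_of)
  have Cc: "C \<subseteq> carrier F" using closedin_subset[OF C(2)] topspace_eq by simp
  have fs: "continuous_map (prod_topology T T) T fst" "continuous_map (prod_topology T T) T snd"
    by (rule continuous_map_fst continuous_map_snd)+
  define U where "U = {u \<in> carrier F. \<forall>c\<in>C. c \<otimes> u \<in> C} \<inter> {u \<in> carrier F. \<forall>c\<in>C. c \<otimes> inv u \<in> C}"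
  have "openin T U"
    unfolding U_def
    by (intro openin_Int openin_forall_compact C)
       (auto simp: case_prod_unfold intro!: continuous_mult continuous_inv fs)
  define N where "N = {g \<in> carrier F. \<forall>b\<in>carrier F. b \<otimes> g \<otimes> inv b \<in> U}"
  have openN: "openin T N"
    unfolding N_def using closedin_topspace[of T] \<open>openin T U\<close>
    by (intro openin_forall_compact)
       (auto simp: case_prod_unfold topspace_eq intro!: continuous_mult continuous_inv fs)
  have U1: "\<one> \<in> U" using Cc by (auto simp: U_def subset_iff)
  have Um: "u \<otimes> v \<in> U" if "u \<in> U" "v \<in> U" for u v
    using that Cc by (auto simp: U_def F.m_assoc[symmetric] F.inv_mult_group subset_iff)
  have Ui: "inv u \<in> U" if "u \<in> U" for u
    using that by (auto simp: U_def)
  have conj_mult: "b \<otimes> (g \<otimes> h) \<otimes> inv b = (b \<otimes> g \<otimes> inv b) \<otimes> (b \<otimes> h \<otimes> inv b)"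
    "b \<otimes> inv g \<otimes> inv b = inv (b \<otimes> g \<otimes> inv b)"
    if "b \<in> carrier F" "g \<in> carrier F" "h \<in> carrier F" for b g h
  proof -
    have "inv b \<otimes> (b \<otimes> y) = y" if "y \<in> carrier F" for y
      using that \<open>b \<in> carrier F\<close> by (simp add: F.m_assoc[symmetric])
    then show "b \<otimes> (g \<otimes> h) \<otimes> inv b = (b \<otimes> g \<otimes> inv b) \<otimes> (b \<otimes> h \<otimes> inv b)"
      "b \<otimes> inv g \<otimes> inv b = inv (b \<otimes> g \<otimes> inv b)"
      using that by (simp_all add: F.m_assoc F.inv_mult_group)
  qed
  have "subgroup N F"
  proof (rule F.subgroupI)
    have "\<one> \<in> N" using U1 by (simp add: N_def)
    then show "N \<noteq> {}" by blast
    show "inv g \<in> N" if "g \<in> N" for g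
      using that Ui conj_mult(2)[of _ g g] by (auto simp: N_def)
    show "g \<otimes> h \<in> N" if "g \<in> N" "h \<in> N" for g h
      using that Um conj_mult(1) by (auto simp: N_def)
  qed (auto simp: N_def)
  moreover have "b \<otimes> g \<otimes> inv b \<in> N" if "b \<in> carrier F" "g \<in> N" for b g
  proof -
    have "c \<otimes> (b \<otimes> g \<otimes> inv b) \<otimes> inv c = (c \<otimes> b) \<otimes> g \<otimes> inv (c \<otimes> b)" if "c \<in> carrier F" for c
      using that \<open>b \<in> carrier F\<close> \<open>g \<in> N\<close> by (simp add: N_def F.m_assoc F.inv_mult_group)
    then show ?thesis using that by (auto simp: N_def)
  qed
  ultimately have "N \<in> open_normal F T"
    using openN by (auto simp: open_normal_def F.normal_inv_iff)
  moreover have "a \<notin> N"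
  proof
    assume "a \<in> N"
    then have "\<forall>b\<in>carrier F. b \<otimes> a \<otimes> inv b \<in> U" unfolding N_def by blast
    then have "\<one> \<otimes> a \<otimes> inv \<one> \<in> U" by (rule bspec) simp
    then have "\<forall>c\<in>C. c \<otimes> a \<in> C" using a(1) by (simp add: U_def)
    then have "\<one> \<otimes> a \<in> C" using C(1) by (rule bspec)
    then show False using a(1) C(4) by simp
  qed
  ultimately show ?thesis by (rule that)
qed

lemma rcoset_clopen:
  assumes N: "N \<in> open_normal F T" and c: "c \<in> rcosets N"
  shows "openin T c" "closedin T c"
proof -
  have op: "openin T c" if cN: "c \<in> rcosets N" for c
  proof -
    obtain f where f: "f \<in> carrier F" "c = N #> f" using cN by (rule rcosetE)
    have "c = {y \<in> topspace T. y \<otimes> inv f \<in> N}"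
    proof
      show "c \<subseteq> {y \<in> topspace T. y \<otimes> inv f \<in> N}"
        using f open_normalD(3)[OF N] by (auto simp: r_coset_def topspace_eq F.m_assoc subset_iff)
      show "{y \<in> topspace T. y \<otimes> inv f \<in> N} \<subseteq> c"
      proof
        fix y assume "y \<in> {y \<in> topspace T. y \<otimes> inv f \<in> N}"
        then have "y \<in> carrier F" "y \<otimes> inv f \<in> N" by (auto simp: topspace_eq)
        moreover from this have "y = y \<otimes> inv f \<otimes> f" using f(1) by (simp add: F.m_assoc)
        ultimately show "y \<in> c" unfolding f(2) r_coset_def by blast
      qed
    qed
    moreover have "openin T {y \<in> topspace T. y \<otimes> inv f \<in> N}"
      by (rule openin_continuous_map_preimage[OF continuous_mult[OF continuous_map_id[unfolded id_def] continuous_const]])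
         (use f(1) open_normalD(4)[OF N] in auto)
    ultimately show ?thesis by simp
  qed
  then show "openin T c" using c by blast
  have "topspace T - c = \<Union>(rcosets N - {c})"
  proof -
    have "pairwise disjnt (rcosets N)"
      using F.rcos_disjoint[OF open_normalD(2)[OF N]] by (simp add: disjoint_def pairwise_def disjnt_def)
    then have "disjnt c (\<Union>(rcosets N - {c}))" using c by (auto simp: pairwise_def disjnt_def)
    then show ?thesis
      using F.rcosets_part_G[OF open_normalD(2)[OF N]] c by (auto simp: topspace_eq disjnt_def)
  qed
  then have "openin T (topspace T - c)" using op by auto
  then show "closedin T c"
    using openin_subset[OF op[OF c]] by (simp add: closedin_def)
qed

lemma pow_index_mem:
  assumes N: "N \<in> open_normal F T" and a: "a \<in> carrier F"
  obtains k where "a [^] (int l ^ k) \<in> N"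
proof -
  obtain k where k: "card (rcosets N) = l ^ k"
    using pro_l N by (auto simp: pro_l_group_def)
  interpret Q: group "F Mod N" by (rule open_normalD(6)[OF N])
  have hom: "(\<lambda>a. N #> a) \<in> hom F (F Mod N)"
    by (rule normal.r_coset_hom_Mod[OF open_normalD(1)[OF N]])
  have "N #> (a [^] (l ^ k)) = (N #> a) [^]\<^bsub>F Mod N\<^esub> (l ^ k)"
    using hom_nat_pow[OF hom a] F.group_axioms Q.group_axioms by blast
  also have "\<dots> = N"
    using Q.pow_order_eq_1[of "N #> a"] rcosetI[OF N a] k by (simp add: order_def open_normalD(7)[OF N])
  finally have "a [^] (l ^ k) \<in> N"
    using F.coset_join1[OF _ _ open_normalD(2)[OF N]] a by blast
  then have "a [^] (int l ^ k) \<in> N" by (simp add: int_pow_int flip: of_nat_power)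
  then show ?thesis by (rule that)
qed

text \<open>Modulo an open normal subgroup the powers \<open>a\<^sup>N\<^sup>(\<^sup>n\<^sup>)\<close> are eventually constant;
  compactness provides a point in all the cosets reached, and residual finiteness makes it the
  only limit.\<close>

lemma Zl_pow_limit:
  assumes a: "a \<in> carrier F" and N: "N \<in> carrier (Zl l)"
  shows "limitin T (\<lambda>n. a [^] N n) (Zl_pow F T a N) sequentially"
proof -
  have "\<exists>k. \<forall>n\<ge>k. a [^] N n \<in> M #> (a [^] N k)" if M: "M \<in> open_normal F T" for M
  proof -
    obtain k where k: "a [^] (int l ^ k) \<in> M" using pow_index_mem[OF M a] by blast
    have "a [^] N n \<in> M #> (a [^] N k)" if "n \<ge> k" for n
    proof -
      have "N n = int l ^ k * (N n div int l ^ k) + N k"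
        using Zl_mod_le[OF N that] mult_div_mod_eq[of "int l ^ k" "N n"] by simp
      then have "a [^] N n = (a [^] (int l ^ k)) [^] (N n div int l ^ k) \<otimes> a [^] N k"
        by (metis F.int_pow_mult F.int_pow_pow a)
      moreover have "(a [^] (int l ^ k)) [^] (N n div int l ^ k) \<in> M"
        by (rule F.subgroup_int_pow_closed[OF open_normalD(2)[OF M] k])
      ultimately show ?thesis unfolding r_coset_def by blast
    qed
    then show ?thesis by blast
  qed
  then obtain k where k: "\<And>M n. M \<in> open_normal F T \<Longrightarrow> n \<ge> k M \<Longrightarrow> a [^] N n \<in> M #> (a [^] N (k M))"
    by metis
  define D where "D M = M #> (a [^] N (k M))" for M
  have D: "D M \<in> rcosets M" if "M \<in> open_normal F T" for M
    using rcosetI[OF that] a by (simp add: D_def)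
  have tail: "\<exists>n0. \<forall>n\<ge>n0. a [^] N n \<in> \<Inter>\<F>" if F: "finite \<F>" "\<F> \<subseteq> D ` open_normal F T" for \<F>
  proof -
    obtain \<M> where M: "finite \<M>" "\<M> \<subseteq> open_normal F T" "\<F> = D ` \<M>"
      using finite_subset_image[OF F] by blast
    have "a [^] N n \<in> \<Inter>\<F>" if "n \<ge> (\<Sum>M\<in>\<M>. k M)" for n
    proof -
      have "k M \<le> n" if "M \<in> \<M>" for M
        using member_le_sum[OF that, of k] M(1) \<open>n \<ge> _\<close> by simp
      then show ?thesis using k M by (auto simp: D_def)
    qed
    then show ?thesis by blast
  qed
  have fip: "\<Inter>\<U> \<noteq> {}" if "\<forall>C\<in>\<U>. closedin T C" "\<forall>\<F>. finite \<F> \<and> \<F> \<subseteq> \<U> \<longrightarrow> \<Inter>\<F> \<noteq> {}" for \<U>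
    using compact_space that unfolding compact_space_fip by blast
  have "\<Inter>(D ` open_normal F T) \<noteq> {}"
  proof (rule fip)
    show "\<forall>C\<in>D ` open_normal F T. closedin T C" using D rcoset_clopen(2) by blast
    show "\<forall>\<F>. finite \<F> \<and> \<F> \<subseteq> D ` open_normal F T \<longrightarrow> \<Inter>\<F> \<noteq> {}"
    proof (intro allI impI, elim conjE)
      fix \<F> assume "finite \<F>" "\<F> \<subseteq> D ` open_normal F T"
      from tail[OF this] obtain n0 where "\<forall>n\<ge>n0. a [^] N n \<in> \<Inter>\<F>" by blast
      then have "a [^] N n0 \<in> \<Inter>\<F>" by simp
      then show "\<Inter>\<F> \<noteq> {}" by blast
    qed
  qed
  then obtain y where y: "\<And>M. M \<in> open_normal F T \<Longrightarrow> y \<in> D M" by blast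
  have yF: "y \<in> carrier F"
    using y[OF carrier_open_normal] D[OF carrier_open_normal] by (simp add: rcosets_carrier)
  have unique: "z = y" if z: "\<And>M. M \<in> open_normal F T \<Longrightarrow> z \<in> D M" for z
  proof (rule ccontr)
    assume "z \<noteq> y"
    have zF: "z \<in> carrier F"
      using z[OF carrier_open_normal] D[OF carrier_open_normal] by (simp add: rcosets_carrier)
    have "z \<otimes> inv y \<noteq> \<one>" using \<open>z \<noteq> y\<close> zF yF F.inv_solve_right' by force
    then obtain M where M: "M \<in> open_normal F T" "z \<otimes> inv y \<notin> M"
      using residually_finite[of "z \<otimes> inv y"] zF yF by blast
    have "M #> y = D M" 
      using rcoset_mem_iff[OF open_normalD(2)[OF M(1)] D[OF M(1)] yF] y[OF M(1)] by simp
    then have "z \<in> M #> y" using z[OF M(1)] by simp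
    then obtain u where "u \<in> M" "z = u \<otimes> y" by (auto simp: r_coset_def)
    moreover from this have "u \<in> carrier F" using open_normalD(3)[OF M(1)] by blast
    ultimately show False using M(2) yF by (simp add: F.m_assoc)
  qed
  have "limitin T (\<lambda>n. a [^] N n) y sequentially"
    unfolding limitin_def
  proof (intro conjI allI impI)
    show "y \<in> topspace T" using yF topspace_eq by simp
    fix V assume V: "openin T V \<and> y \<in> V"
    define \<U> where "\<U> = insert (topspace T - V) (D ` open_normal F T)"
    have "z \<notin> \<Inter>\<U>" for z
    proof
      assume "z \<in> \<Inter>\<U>"
      then have "z \<in> topspace T - V" "\<And>M. M \<in> open_normal F T \<Longrightarrow> z \<in> D M" by (auto simp: \<U>_def)
      with unique[of z] V show False by simp
    qed
    then have "\<Inter>\<U> = {}" by (simp add: set_eq_iff)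
    moreover have "closedin T C" if "C \<in> \<U>" for C
      using that D rcoset_clopen(2) V unfolding \<U>_def by blast
    ultimately obtain \<F> where \<F>: "finite \<F>" "\<F> \<subseteq> \<U>" "\<Inter>\<F> = {}" using fip[of \<U>] by blast
    have "finite (\<F> - {topspace T - V})" "\<F> - {topspace T - V} \<subseteq> D ` open_normal F T"
      using \<F>(1,2) unfolding \<U>_def by blast+
    from tail[OF this] obtain n0 where n0: "\<And>n. n \<ge> n0 \<Longrightarrow> a [^] N n \<in> \<Inter>(\<F> - {topspace T - V})" by blast
    have "a [^] N n \<in> V" if "n \<ge> n0" for n
    proof (rule ccontr)
      assume "a [^] N n \<notin> V"
      then have "a [^] N n \<in> topspace T - V" using a topspace_eq by simp
      then have "a [^] N n \<in> \<Inter>\<F>" using n0[OF that] by blast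
      then show False using \<F>(3) by blast
    qed
    then show "\<forall>\<^sub>F n in sequentially. a [^] N n \<in> V" unfolding eventually_sequentially by blast
  qed
  moreover have "z = y" if "limitin T (\<lambda>n. a [^] N n) z sequentially" for z
    using limitin_Hausdorff_unique[OF that calculation _ Hausdorff_space] by simp
  ultimately show ?thesis unfolding Zl_pow_def by (rule theI)
qed

lemma Zl_pow_closed: "a \<in> carrier F \<Longrightarrow> N \<in> carrier (Zl l) \<Longrightarrow> Zl_pow F T a N \<in> carrier F"
  using limitin_topspace[OF Zl_pow_limit] topspace_eq by blast

lemma Zl_pow_eventually:
  assumes "a \<in> carrier F" "N \<in> carrier (Zl l)" "b \<in> carrier F" "\<forall>\<^sub>F n in sequentially. a [^] N n = b"
  shows "Zl_pow F T a N = b"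
proof -
  have "limitin T (\<lambda>n. a [^] N n) b sequentially"
    by (rule limitin_eventually) (use assms topspace_eq in auto)
  then show ?thesis
    using limitin_Hausdorff_unique[OF Zl_pow_limit[OF assms(1,2)] _ _ Hausdorff_space] by simp
qed

lemma Zl_pow_zero: "a \<in> carrier F \<Longrightarrow> Zl_pow F T a \<zero>\<^bsub>Zl l\<^esub> = \<one>"
  using Z.zero_closed by (intro Zl_pow_eventually) (auto simp: Zl_simps(4))

lemma Zl_pow_one:
  assumes "a \<in> carrier F"
  shows "Zl_pow F T a \<one>\<^bsub>Zl l\<^esub> = a"
proof (rule Zl_pow_eventually)
  have "a [^] (1 mod int l ^ n) = a" if "n \<ge> 1" for n
  proof -
    have "1 < int l ^ n" using l_gt_1 that by (simp add: one_less_power)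
    then show ?thesis using assms by simp
  qed
  then show "\<forall>\<^sub>F n in sequentially. a [^] \<one>\<^bsub>Zl l\<^esub> n = a"
    unfolding Zl_simps(3) by (auto simp: eventually_sequentially)
qed (use assms in auto)


section \<open>The lower central series\<close>

lemma closure_subgroup:
  assumes K: "subgroup K F"
  shows "subgroup (T closure_of K) F"
proof (rule F.subgroupI)
  have Kc: "K \<subseteq> topspace T" using subgroup.subset[OF K] topspace_eq by simp
  show "T closure_of K \<subseteq> carrier F" using closure_of_subset_topspace[of T K] topspace_eq by simp
  show "T closure_of K \<noteq> {}" using closure_of_subset[OF Kc] subgroup.one_closed[OF K] by blast
  fix a assume a: "a \<in> T closure_of K"
  have "(\<lambda>a. inv a) ` (T closure_of K) \<subseteq> T closure_of ((\<lambda>a. inv a) ` K)"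
    by (rule continuous_map_image_closure_subset)
       (use topological_group in \<open>simp add: topological_group_def\<close>)
  also have "\<dots> \<subseteq> T closure_of K"
    by (rule closure_of_mono) (use K in \<open>auto intro: subgroup.m_inv_closed\<close>)
  finally show "inv a \<in> T closure_of K" using a by blast
  fix b assume b: "b \<in> T closure_of K"
  have "(\<lambda>(a, b). a \<otimes> b) ` (prod_topology T T closure_of (K \<times> K)) \<subseteq> T closure_of ((\<lambda>(a, b). a \<otimes> b) ` (K \<times> K))"
    by (rule continuous_map_image_closure_subset)
       (use topological_group in \<open>simp add: topological_group_def\<close>)
  also have "\<dots> \<subseteq> T closure_of K"
    by (rule closure_of_mono) (use K in \<open>auto intro: subgroup.m_closed\<close>)
  finally show "a \<otimes> b \<in> T closure_of K" using a b by (auto simp: closure_of_Times)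
qed

abbreviation "commutators K \<equiv>
  {a \<otimes> b \<otimes> inv a \<otimes> inv b | a b. a \<in> K \<and> b \<in> carrier F}"

lemma lcs_subgroup: "subgroup (lcs F T n) F"
proof (induction n rule: less_induct)
  case (less n)
  show ?case
  proof (cases "n \<le> 1")
    case True
    then consider "n = 0" | "n = Suc 0" by linarith
    then show ?thesis by cases (simp_all add: F.subgroup_self)
  next
    case False
    then obtain k where k: "n = Suc (Suc k)" by (metis One_nat_def Suc_le_D not_less_eq_eq)
    have "lcs F T (Suc k) \<subseteq> carrier F" using less[of "Suc k"] k by (simp add: subgroup.subset)
    then have "commutators (lcs F T (Suc k)) \<subseteq> carrier F" by auto
    then show ?thesis
      unfolding k lcs.simps topologically_generated_def
      by (intro closure_subgroup F.generate_is_subgroup)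
  qed
qed

lemma lcs_carrier: "lcs F T n \<subseteq> carrier F"
  by (rule subgroup.subset[OF lcs_subgroup])

lemma lcs_Suc_subset: "lcs F T (Suc (Suc n)) \<subseteq> lcs F T (Suc n)"
proof (induction n)
  case 0
  show ?case using lcs_carrier[of "Suc (Suc 0)"] by simp
next
  case (Suc n)
  have "commutators (lcs F T (Suc (Suc n))) \<subseteq> commutators (lcs F T (Suc n))" using Suc by blast
  then show ?case
    unfolding lcs.simps(3)[of F T "Suc n"] lcs.simps(3)[of F T n] topologically_generated_def
    by (intro closure_of_mono F.mono_generate)
qed

lemma lcs_antimono:
  assumes "n \<ge> 1" "n \<le> k"
  shows "lcs F T k \<subseteq> lcs F T n"
  using assms(2)
proof (induction k rule: dec_induct)
  case (step k)
  then obtain k' where "k = Suc k'" using assms(1) by (cases k) auto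
  then show ?case using step lcs_Suc_subset[of k'] by auto
qed simp

end


section \<open>The Magnus isomorphism and the powers of the augmentation ideal\<close>

text \<open>The ring axioms of the completed group algebra are pulled back from the tensor algebra,
  where associativity is a statement about cutting words into three pieces.\<close>

lemma ring_transport:
  assumes S: "ring S" and h: "h \<in> ring_iso R S"
    and closed: "\<And>a b. a \<in> carrier R \<Longrightarrow> b \<in> carrier R \<Longrightarrow> a \<otimes>\<^bsub>R\<^esub> b \<in> carrier R"
      "\<And>a b. a \<in> carrier R \<Longrightarrow> b \<in> carrier R \<Longrightarrow> a \<oplus>\<^bsub>R\<^esub> b \<in> carrier R"
      "\<one>\<^bsub>R\<^esub> \<in> carrier R" "\<zero>\<^bsub>R\<^esub> \<in> carrier R" and zero: "\<zero>\<^bsub>R\<^esub> \<oplus>\<^bsub>R\<^esub> \<zero>\<^bsub>R\<^esub> = \<zero>\<^bsub>R\<^esub>"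
  shows "ring R"
proof -
  interpret S: ring S by fact
  have hom: "h \<in> ring_hom R S" and bij: "bij_betw h (carrier R) (carrier S)"
    using h by (auto simp: ring_iso_def)
  let ?k = "inv_into (carrier R) h"
  have hk: "h (?k s) = s" "?k s \<in> carrier R" if "s \<in> carrier S" for s
    using bij that by (auto simp: bij_betw_def f_inv_into_f inv_into_into)
  have kh: "?k (h a) = a" if "a \<in> carrier R" for a
    using bij that by (simp add: bij_betw_def)
  have "h \<zero>\<^bsub>R\<^esub> \<oplus>\<^bsub>S\<^esub> h \<zero>\<^bsub>R\<^esub> = h \<zero>\<^bsub>R\<^esub>"
    using ring_hom_add[OF hom closed(4,4)] zero by simp
  then have zero': "h \<zero>\<^bsub>R\<^esub> = \<zero>\<^bsub>S\<^esub>"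
    using ring_hom_closed[OF hom closed(4)] S.add.l_cancel_one by simp
  have "?k \<in> ring_hom S R"
  proof (rule ring_hom_memI)
    fix s t assume st: "s \<in> carrier S" "t \<in> carrier S"
    show "?k s \<in> carrier R" using hk(2) st by simp
    show "?k (s \<otimes>\<^bsub>S\<^esub> t) = ?k s \<otimes>\<^bsub>R\<^esub> ?k t"
      using kh[OF closed(1)[OF hk(2) hk(2)], OF st] ring_hom_mult[OF hom hk(2) hk(2), OF st] hk(1) st
      by simp
    show "?k (s \<oplus>\<^bsub>S\<^esub> t) = ?k s \<oplus>\<^bsub>R\<^esub> ?k t"
      using kh[OF closed(2)[OF hk(2) hk(2)], OF st] ring_hom_add[OF hom hk(2) hk(2), OF st] hk(1) st
      by simp
  next
    show "?k \<one>\<^bsub>S\<^esub> = \<one>\<^bsub>R\<^esub>" using kh[OF closed(3)] ring_hom_one[OF hom] by simp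
  qed
  then have "?k \<in> ring_iso S R" using bij_betw_inv_into[OF bij] by (simp add: ring_iso_def)
  then have "ring (R \<lparr> zero := ?k \<zero>\<^bsub>S\<^esub> \<rparr>)"
    by (rule S.ring_iso_imp_img_ring)
  moreover have "?k \<zero>\<^bsub>S\<^esub> = \<zero>\<^bsub>R\<^esub>"
    using kh[OF closed(4)] zero' by simp
  ultimately show "ring R" by simp
qed

lemma additive_finsum:
  assumes "abelian_monoid R" "abelian_monoid S"
    and h: "\<And>a. a \<in> carrier R \<Longrightarrow> h a \<in> carrier S" "h \<zero>\<^bsub>R\<^esub> = \<zero>\<^bsub>S\<^esub>"
      "\<And>a b. a \<in> carrier R \<Longrightarrow> b \<in> carrier R \<Longrightarrow> h (a \<oplus>\<^bsub>R\<^esub> b) = h a \<oplus>\<^bsub>S\<^esub> h b"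
    and f: "\<And>i. i \<in> I \<Longrightarrow> f i \<in> carrier R" and "finite I"
  shows "h (\<Oplus>\<^bsub>R\<^esub>i\<in>I. f i) = (\<Oplus>\<^bsub>S\<^esub>i\<in>I. h (f i))"
  using assms(7) f
proof (induction I rule: finite_induct)
  case empty
  show ?case using h(2) by (simp add: abelian_monoid.finsum_empty assms(1,2))
next
  case (insert a I)
  interpret R: abelian_monoid R by fact
  interpret S: abelian_monoid S by fact
  have *: "f \<in> I \<rightarrow> carrier R" "(\<lambda>i. h (f i)) \<in> I \<rightarrow> carrier S" "f a \<in> carrier R" "h (f a) \<in> carrier S"
    using insert(4) h(1) by auto
  then show ?case using insert h(3)[OF *(3) R.finsum_closed[OF *(1)]] by simp
qed

lemma words_last:
  assumes "w \<in> words r" "w \<noteq> []"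
  shows "last w \<in> {1..r}" "butlast w \<in> words r"
proof -
  show "last w \<in> {1..r}" using last_in_set[OF assms(2)] assms(1) unfolding words_def by blast
  show "butlast w \<in> words r" using assms(1) by (auto simp: words_def dest: in_set_butlastD)
qed

lemma tensor_X_closed: "l > 0 \<Longrightarrow> tensor_X l r i \<in> carrier (tensor_algebra l r)"
  using Zl_cring[of l] by (auto simp: tensor_X_def tensor_simps cring.cring_simprules)

lemma tensor_mult_X_right:
  assumes "l > 0" "t \<in> carrier (tensor_algebra l r)" "j \<in> {1..r}" "w \<in> words r"
  shows "(t \<otimes>\<^bsub>tensor_algebra l r\<^esub> tensor_X l r j) w =
    (if w \<noteq> [] \<and> last w = j then t (butlast w) else \<zero>\<^bsub>Zl l\<^esub>)"
proof (cases w rule: rev_cases)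
  case Nil
  then show ?thesis
    using tensor_mult[OF assms(1,2) tensor_X_closed[OF assms(1)]]
    by (simp add: conv_Nil tensor_X_def Zl_simps)
next
  case (snoc u a)
  have u: "u \<in> words r" and ua: "u @ [a] \<in> words r" using assms(4) snoc by simp_all
  then have tu: "t u \<in> carrier (Zl l)" using assms(2) by (auto simp: tensor_simps)
  have *: "drop i (u @ [a]) = [j] \<longleftrightarrow> i = length u \<and> a = j" if "i \<le> Suc (length u)" for i
  proof
    assume "drop i (u @ [a]) = [j]"
    then have "length (drop i (u @ [a])) = 1" by simp
    then show "i = length u \<and> a = j" using \<open>drop i (u @ [a]) = [j]\<close> that by auto
  qed auto
  have "conv (\<lambda>v. t v n) (\<lambda>v. tensor_X l r j v n) (u @ [a]) =
      (\<Sum>i\<le>Suc (length u). if i = length u then (if a = j then t u n * (1 mod int l ^ n) else 0) else 0)" for n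
    unfolding conv_def using words_take_drop(2)[OF ua] *
    by (intro sum.cong) (auto simp: tensor_X_def Zl_simps)
  then have "(t \<otimes>\<^bsub>tensor_algebra l r\<^esub> tensor_X l r j) w = (\<lambda>n. if a = j then t u n mod int l ^ n else 0)"
    using tensor_mult[OF assms(1,2) tensor_X_closed[OF assms(1)]] assms(4) snoc
    by (simp add: mod_simps fun_eq_iff)
  then show ?thesis using snoc Zl_mod[OF tu] by (auto simp: Zl_simps)
qed

lemma tensor_mult_X_left:
  assumes "l > 0" "t \<in> carrier (tensor_algebra l r)" "j \<in> {1..r}" "w \<in> words r"
  shows "(tensor_X l r j \<otimes>\<^bsub>tensor_algebra l r\<^esub> t) w =
    (if w \<noteq> [] \<and> hd w = j then t (tl w) else \<zero>\<^bsub>Zl l\<^esub>)"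
proof (cases w)
  case Nil
  then show ?thesis
    using tensor_mult[OF assms(1) tensor_X_closed[OF assms(1)] assms(2)]
    by (simp add: conv_Nil tensor_X_def Zl_simps)
next
  case (Cons a u)
  have u: "u \<in> words r" and au: "a # u \<in> words r" using assms(4) Cons by simp_all
  then have tu: "t u \<in> carrier (Zl l)" using assms(2) by (auto simp: tensor_simps)
  have "conv (\<lambda>v. tensor_X l r j v n) (\<lambda>v. t v n) (a # u) =
      (\<Sum>i\<le>Suc (length u). if i = 1 then (if a = j then (1 mod int l ^ n) * t u n else 0) else 0)" for n
    unfolding conv_def using words_take_drop(1)[OF au]
    by (intro sum.cong) (auto simp: tensor_X_def Zl_simps take_Cons split: nat.splits)
  then have "(tensor_X l r j \<otimes>\<^bsub>tensor_algebra l r\<^esub> t) w = (\<lambda>n. if a = j then t u n mod int l ^ n else 0)"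
    using tensor_mult[OF assms(1) tensor_X_closed[OF assms(1)] assms(2)] assms(4) Cons
    by (simp add: mod_simps fun_eq_iff Suc_le_eq)
  then show ?thesis using Cons Zl_mod[OF tu] by (auto simp: Zl_simps)
qed

locale magnus = pro_l l F T for l :: nat and F :: "'a monoid" (structure) and T :: "'a topology" +
  fixes r :: nat and x :: "nat \<Rightarrow> 'a" and \<Theta> :: "'a cga \<Rightarrow> tensor"
  assumes x_closed: "x \<in> {1..r} \<rightarrow> carrier F"
    and magnus: "magnus_isomorphism l r F T x \<Theta>"
begin

abbreviation "A \<equiv> cga l F T"
abbreviation "TH \<equiv> tensor_algebra l r"
abbreviation "gel \<equiv> cga_of l F T"
abbreviation "Ipow \<equiv> aug_power l F T"

lemma Theta_iso: "\<Theta> \<in> ring_iso A TH"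
  using magnus by (simp add: magnus_isomorphism_def)

lemma cga_ring: "ring A"
proof (rule ring_transport[OF tensor_ring[OF l_pos] Theta_iso cga_mult_closed cga_add_closed _ cga_zero_closed])
  show "\<one>\<^bsub>A\<^esub> \<in> carrier A" by (simp add: cga_one cga_of_closed)
  show "\<zero>\<^bsub>A\<^esub> \<oplus>\<^bsub>A\<^esub> \<zero>\<^bsub>A\<^esub> = \<zero>\<^bsub>A\<^esub>" by (auto simp: cga_simps intro!: restrict_ext)
qed

sublocale A: ring A by (rule cga_ring)
sublocale TH: ring TH by (rule tensor_ring[OF l_pos])
sublocale Theta: ring_hom_ring A TH \<Theta>
  using Theta_iso by (intro ring_hom_ringI2 cga_ring TH.ring_axioms) (simp add: ring_iso_def)
sublocale aug: ring_hom_ring A "Zl l" "augmentation F"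
proof (rule ring_hom_ringI)
  show "augmentation F \<one>\<^bsub>A\<^esub> = \<one>\<^bsub>Zl l\<^esub>" by (simp add: cga_one aug_cga_of)
qed (auto simp: aug_closed aug_mult aug_add A.ring_axioms Z.ring_axioms)

lemma Theta_bij: "bij_betw \<Theta> (carrier A) (carrier TH)"
  using Theta_iso by (simp add: ring_iso_def)

lemma Theta_inj: "\<alpha> \<in> carrier A \<Longrightarrow> \<beta> \<in> carrier A \<Longrightarrow> \<Theta> \<alpha> = \<Theta> \<beta> \<Longrightarrow> \<alpha> = \<beta>"
  using Theta_bij by (auto simp: bij_betw_def inj_on_def)

lemma Theta_inv:
  assumes "t \<in> carrier TH"
  shows "inv_into (carrier A) \<Theta> t \<in> carrier A" "\<Theta> (inv_into (carrier A) \<Theta> t) = t"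
  using assms Theta_bij by (auto simp: bij_betw_def f_inv_into_f inv_into_into)

lemma Theta_smult: "a \<in> carrier (Zl l) \<Longrightarrow> \<alpha> \<in> carrier A \<Longrightarrow> \<Theta> (a \<odot>\<^bsub>A\<^esub> \<alpha>) = a \<odot>\<^bsub>TH\<^esub> \<Theta> \<alpha>"
  using magnus by (simp add: magnus_isomorphism_def)

lemma gen_closed: "i \<in> {1..r} \<Longrightarrow> x i \<in> carrier F" "i \<in> {1..r} \<Longrightarrow> gel (x i) \<in> carrier A"
  using x_closed by (auto intro: cga_of_closed)

lemma Theta_gen:
  assumes "i \<in> {1..r}"
  shows "\<Theta> (gel (x i) \<ominus>\<^bsub>A\<^esub> \<one>\<^bsub>A\<^esub>) = tensor_X l r i"
proof -
  have "\<Theta> (gel (x i)) = \<one>\<^bsub>TH\<^esub> \<oplus>\<^bsub>TH\<^esub> tensor_X l r i"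
    using magnus assms by (simp add: magnus_isomorphism_def)
  moreover have "\<Theta> (gel (x i) \<ominus>\<^bsub>A\<^esub> \<one>\<^bsub>A\<^esub>) = \<Theta> (gel (x i)) \<ominus>\<^bsub>TH\<^esub> \<one>\<^bsub>TH\<^esub>"
    using gen_closed(2)[OF assms] by (simp add: A.minus_eq TH.minus_eq)
  ultimately show ?thesis
    using tensor_X_closed[OF l_pos, of r i]
    by (simp add: TH.minus_eq TH.add.m_comm[of "\<one>\<^bsub>TH\<^esub>"] TH.a_assoc TH.r_neg)
qed

lemma coeff_closed: "\<alpha> \<in> carrier A \<Longrightarrow> w \<in> words r \<Longrightarrow> \<Theta> \<alpha> w \<in> carrier (Zl l)"
  using Theta.hom_closed[of \<alpha>] by (auto simp: tensor_simps)

lemma Theta_eqI: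
  assumes "\<alpha> \<in> carrier A" "\<beta> \<in> carrier A" "\<And>w. w \<in> words r \<Longrightarrow> \<Theta> \<alpha> w = \<Theta> \<beta> w"
  shows "\<alpha> = \<beta>"
proof (rule Theta_inj[OF assms(1,2)], rule PiE_ext)
  show "\<Theta> \<alpha> \<in> words r \<rightarrow>\<^sub>E carrier (Zl l)" "\<Theta> \<beta> \<in> words r \<rightarrow>\<^sub>E carrier (Zl l)"
    using assms(1,2)[THEN Theta.hom_closed] by (simp_all add: tensor_simps)
qed (use assms(3) in auto)

lemma coeff_add:
  "\<alpha> \<in> carrier A \<Longrightarrow> \<beta> \<in> carrier A \<Longrightarrow> w \<in> words r \<Longrightarrow> \<Theta> (\<alpha> \<oplus>\<^bsub>A\<^esub> \<beta>) w = \<Theta> \<alpha> w \<oplus>\<^bsub>Zl l\<^esub> \<Theta> \<beta> w"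
  by (simp add: tensor_simps)

lemma coeff_zero: "w \<in> words r \<Longrightarrow> \<Theta> \<zero>\<^bsub>A\<^esub> w = \<zero>\<^bsub>Zl l\<^esub>"
  by (simp add: tensor_simps)

lemma coeff_neg:
  assumes "\<alpha> \<in> carrier A" "w \<in> words r"
  shows "\<Theta> (\<ominus>\<^bsub>A\<^esub> \<alpha>) w = \<ominus>\<^bsub>Zl l\<^esub> \<Theta> \<alpha> w"
proof -
  have "\<Theta> (\<ominus>\<^bsub>A\<^esub> \<alpha>) w \<oplus>\<^bsub>Zl l\<^esub> \<Theta> \<alpha> w = \<zero>\<^bsub>Zl l\<^esub>"
    using assms coeff_add[of "\<ominus>\<^bsub>A\<^esub> \<alpha>" \<alpha> w] coeff_zero[OF assms(2)] by (simp add: A.l_neg)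
  then show ?thesis
    using coeff_closed[OF assms] coeff_closed[OF A.a_inv_closed[OF assms(1)] assms(2)] Z.minus_equality
    by metis
qed

lemma coeff_minus:
  "\<alpha> \<in> carrier A \<Longrightarrow> \<beta> \<in> carrier A \<Longrightarrow> w \<in> words r \<Longrightarrow> \<Theta> (\<alpha> \<ominus>\<^bsub>A\<^esub> \<beta>) w = \<Theta> \<alpha> w \<ominus>\<^bsub>Zl l\<^esub> \<Theta> \<beta> w"
  by (simp only: A.minus_eq Z.minus_eq coeff_add coeff_neg A.a_inv_closed)

lemma coeff_finsum:
  assumes "finite I" "\<And>i. i \<in> I \<Longrightarrow> f i \<in> carrier A" "w \<in> words r"
  shows "\<Theta> (\<Oplus>\<^bsub>A\<^esub>i\<in>I. f i) w = (\<Oplus>\<^bsub>Zl l\<^esub>i\<in>I. \<Theta> (f i) w)"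
  by (rule additive_finsum[where h = "\<lambda>\<alpha>. \<Theta> \<alpha> w", OF A.abelian_monoid_axioms Z.abelian_monoid_axioms])
     (use assms in \<open>auto simp only: coeff_closed coeff_add coeff_zero\<close>)

text \<open>Multiplication by \<open>x\<^sub>i - 1\<close> appends the letter \<open>i\<close> to every word; from the left it
  prepends it.\<close>

lemma coeff_mult_gen_right:
  assumes "\<alpha> \<in> carrier A" "i \<in> {1..r}" "w \<in> words r"
  shows "\<Theta> (\<alpha> \<otimes>\<^bsub>A\<^esub> (gel (x i) \<ominus>\<^bsub>A\<^esub> \<one>\<^bsub>A\<^esub>)) w = (if w \<noteq> [] \<and> last w = i then \<Theta> \<alpha> (butlast w) else \<zero>\<^bsub>Zl l\<^esub>)"
  using assms gen_closed(2)[OF assms(2)] Theta_gen[OF assms(2)]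
    tensor_mult_X_right[OF l_pos Theta.hom_closed[OF assms(1)] assms(2,3)] by simp

lemma coeff_mult_gen_left:
  assumes "\<alpha> \<in> carrier A" "i \<in> {1..r}" "w \<in> words r"
  shows "\<Theta> ((gel (x i) \<ominus>\<^bsub>A\<^esub> \<one>\<^bsub>A\<^esub>) \<otimes>\<^bsub>A\<^esub> \<alpha>) w = (if w \<noteq> [] \<and> hd w = i then \<Theta> \<alpha> (tl w) else \<zero>\<^bsub>Zl l\<^esub>)"
  using assms gen_closed(2)[OF assms(2)] Theta_gen[OF assms(2)]
    tensor_mult_X_left[OF l_pos Theta.hom_closed[OF assms(1)] assms(2,3)] by simp

lemma Z_finsum_delta:
  assumes "finite I" "j \<in> I" "a \<in> carrier (Zl l)"
  shows "(\<Oplus>\<^bsub>Zl l\<^esub>i\<in>I. if j = i then a else \<zero>\<^bsub>Zl l\<^esub>) = a"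
  using Z.add.finprod_singleton[OF assms(2,1), of "\<lambda>_. a"] assms(3) by (simp add: finsum_def)

lemma Z_finsum_neutral:
  assumes "\<And>i. i \<in> I \<Longrightarrow> f i = \<zero>\<^bsub>Zl l\<^esub>"
  shows "(\<Oplus>\<^bsub>Zl l\<^esub>i\<in>I. f i) = \<zero>\<^bsub>Zl l\<^esub>"
  using Z.finsum_cong'[of I I "\<lambda>_. \<zero>\<^bsub>Zl l\<^esub>" f] assms Z.finsum_zero by auto

text \<open>The expansion that defines the Fox derivatives, read off word by word.\<close>

lemma coeff_fox_expansion:
  assumes s: "s \<in> carrier (Zl l)" and d: "\<And>i. i \<in> {1..r} \<Longrightarrow> d i \<in> carrier A" and w: "w \<in> words r"
  shows "\<Theta> ((s \<odot>\<^bsub>A\<^esub> \<one>\<^bsub>A\<^esub>) \<oplus>\<^bsub>A\<^esub> (\<Oplus>\<^bsub>A\<^esub>i\<in>{1..r}. d i \<otimes>\<^bsub>A\<^esub> (gel (x i) \<ominus>\<^bsub>A\<^esub> \<one>\<^bsub>A\<^esub>))) w =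
    (if w = [] then s else \<Theta> (d (last w)) (butlast w))"
proof -
  have cl: "d i \<otimes>\<^bsub>A\<^esub> (gel (x i) \<ominus>\<^bsub>A\<^esub> \<one>\<^bsub>A\<^esub>) \<in> carrier A" if "i \<in> {1..r}" for i
    using d[OF that] gen_closed(2)[OF that] by simp
  have "\<Theta> (\<Oplus>\<^bsub>A\<^esub>i\<in>{1..r}. d i \<otimes>\<^bsub>A\<^esub> (gel (x i) \<ominus>\<^bsub>A\<^esub> \<one>\<^bsub>A\<^esub>)) w =
      (\<Oplus>\<^bsub>Zl l\<^esub>i\<in>{1..r}. \<Theta> (d i \<otimes>\<^bsub>A\<^esub> (gel (x i) \<ominus>\<^bsub>A\<^esub> \<one>\<^bsub>A\<^esub>)) w)"
    by (rule coeff_finsum) (use cl w in auto)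
  also have "\<dots> = (if w = [] then \<zero>\<^bsub>Zl l\<^esub> else \<Theta> (d (last w)) (butlast w))"
  proof (cases "w = []")
    case True
    have "\<Theta> (d i \<otimes>\<^bsub>A\<^esub> (gel (x i) \<ominus>\<^bsub>A\<^esub> \<one>\<^bsub>A\<^esub>)) w = \<zero>\<^bsub>Zl l\<^esub>" if "i \<in> {1..r}" for i
      using coeff_mult_gen_right[OF d[OF that] that w] True by simp
    then have "(\<Oplus>\<^bsub>Zl l\<^esub>i\<in>{1..r}. \<Theta> (d i \<otimes>\<^bsub>A\<^esub> (gel (x i) \<ominus>\<^bsub>A\<^esub> \<one>\<^bsub>A\<^esub>)) w) = \<zero>\<^bsub>Zl l\<^esub>"
      by (rule Z_finsum_neutral)
    then show ?thesis using True by simp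
  next
    case False
    then obtain u j where w': "w = u @ [j]" by (meson rev_exhaust)
    then have j: "j \<in> {1..r}" and u: "u \<in> words r" using w by auto
    have "(\<Oplus>\<^bsub>Zl l\<^esub>i\<in>{1..r}. \<Theta> (d i \<otimes>\<^bsub>A\<^esub> (gel (x i) \<ominus>\<^bsub>A\<^esub> \<one>\<^bsub>A\<^esub>)) w) =
        (\<Oplus>\<^bsub>Zl l\<^esub>i\<in>{1..r}. if j = i then \<Theta> (d j) u else \<zero>\<^bsub>Zl l\<^esub>)"
      by (rule Z.finsum_cong')
         (use d w w' u j coeff_closed[OF d[OF j] u] in \<open>auto simp only: coeff_mult_gen_right last_snoc butlast_snoc split: if_splits\<close>)
    then show ?thesis
      using Z_finsum_delta[OF _ j coeff_closed[OF d[OF j] u]] False w' by simp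
  qed
  finally have *: "\<Theta> (\<Oplus>\<^bsub>A\<^esub>i\<in>{1..r}. d i \<otimes>\<^bsub>A\<^esub> (gel (x i) \<ominus>\<^bsub>A\<^esub> \<one>\<^bsub>A\<^esub>)) w =
      (if w = [] then \<zero>\<^bsub>Zl l\<^esub> else \<Theta> (d (last w)) (butlast w))" .
  have s1: "\<Theta> (s \<odot>\<^bsub>A\<^esub> \<one>\<^bsub>A\<^esub>) w = (if w = [] then s else \<zero>\<^bsub>Zl l\<^esub>)"
    using s w by (simp add: Theta_smult tensor_simps)
  have dw: "\<Theta> (d (last w)) (butlast w) \<in> carrier (Zl l)" if "w \<noteq> []"
  proof -
    note words_last[OF w that]
    with d coeff_closed show ?thesis by blast
  qed
  have sum_cl: "(\<Oplus>\<^bsub>A\<^esub>i\<in>{1..r}. d i \<otimes>\<^bsub>A\<^esub> (gel (x i) \<ominus>\<^bsub>A\<^esub> \<one>\<^bsub>A\<^esub>)) \<in> carrier A"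
    using cl by (intro A.finsum_closed) auto
  show ?thesis
    unfolding coeff_add[OF cga_smult_closed[OF s A.one_closed] sum_cl w] s1 *
    using s dw by simp
qed

text \<open>Both sides are algebra homomorphisms that send every generator to 1; the expansion of
  \<open>\<alpha>\<close> along the generators reduces the comparison to constants.\<close>

lemma aug_eq_coeff:
  assumes a: "\<alpha> \<in> carrier A"
  shows "augmentation F \<alpha> = \<Theta> \<alpha> []"
proof -
  define d where "d i = inv_into (carrier A) \<Theta> (\<lambda>w\<in>words r. \<Theta> \<alpha> (w @ [i]))" for i
  have d: "d i \<in> carrier A" "\<Theta> (d i) = (\<lambda>w\<in>words r. \<Theta> \<alpha> (w @ [i]))" if "i \<in> {1..r}" for i
  proof -
    have "(\<lambda>w\<in>words r. \<Theta> \<alpha> (w @ [i])) \<in> carrier TH"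
      using coeff_closed[OF a] that by (auto simp: tensor_simps)
    from Theta_inv[OF this] show "d i \<in> carrier A" "\<Theta> (d i) = (\<lambda>w\<in>words r. \<Theta> \<alpha> (w @ [i]))"
      unfolding d_def by simp_all
  qed
  let ?s = "\<Theta> \<alpha> []"
  let ?sum = "\<Oplus>\<^bsub>A\<^esub>i\<in>{1..r}. d i \<otimes>\<^bsub>A\<^esub> (gel (x i) \<ominus>\<^bsub>A\<^esub> \<one>\<^bsub>A\<^esub>)"
  have s: "?s \<in> carrier (Zl l)" using coeff_closed[OF a] by simp
  have cl: "d i \<otimes>\<^bsub>A\<^esub> (gel (x i) \<ominus>\<^bsub>A\<^esub> \<one>\<^bsub>A\<^esub>) \<in> carrier A" if "i \<in> {1..r}" for i
    using d(1)[OF that] gen_closed(2)[OF that] by simp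
  then have sum_cl: "?sum \<in> carrier A" by (intro A.finsum_closed) auto
  have "\<alpha> = (?s \<odot>\<^bsub>A\<^esub> \<one>\<^bsub>A\<^esub>) \<oplus>\<^bsub>A\<^esub> ?sum"
  proof (rule Theta_eqI[OF a])
    show "(?s \<odot>\<^bsub>A\<^esub> \<one>\<^bsub>A\<^esub>) \<oplus>\<^bsub>A\<^esub> ?sum \<in> carrier A"
      using cga_smult_closed[OF s] sum_cl by simp
    fix w assume w: "w \<in> words r"
    have "\<Theta> (d (last w)) (butlast w) = \<Theta> \<alpha> w" if "w \<noteq> []"
    proof -
      note words_last[OF w that]
      with d that show ?thesis by simp
    qed
    then show "\<Theta> \<alpha> w = \<Theta> ((?s \<odot>\<^bsub>A\<^esub> \<one>\<^bsub>A\<^esub>) \<oplus>\<^bsub>A\<^esub> ?sum) w"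
      using coeff_fox_expansion[OF s d(1) w] by simp
  qed
  then have "augmentation F \<alpha> = augmentation F ((?s \<odot>\<^bsub>A\<^esub> \<one>\<^bsub>A\<^esub>) \<oplus>\<^bsub>A\<^esub> ?sum)"
    by (rule arg_cong)
  then have "augmentation F \<alpha> = (?s \<otimes>\<^bsub>Zl l\<^esub> \<one>\<^bsub>Zl l\<^esub>) \<oplus>\<^bsub>Zl l\<^esub> augmentation F ?sum"
    by (simp only: aug_add aug_smult aug.hom_one)
  moreover have "augmentation F ?sum = (\<Oplus>\<^bsub>Zl l\<^esub>i\<in>{1..r}. augmentation F (d i \<otimes>\<^bsub>A\<^esub> (gel (x i) \<ominus>\<^bsub>A\<^esub> \<one>\<^bsub>A\<^esub>)))"
    by (rule additive_finsum[where h = "augmentation F", OF A.abelian_monoid_axioms Z.abelian_monoid_axioms])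
       (use cl in \<open>auto simp: aug_closed aug_add aug_zero\<close>)
  moreover have "augmentation F (d i \<otimes>\<^bsub>A\<^esub> (gel (x i) \<ominus>\<^bsub>A\<^esub> \<one>\<^bsub>A\<^esub>)) = \<zero>\<^bsub>Zl l\<^esub>" if "i \<in> {1..r}" for i
    using d(1)[OF that] gen_closed[OF that] by (simp add: A.minus_eq aug_cga_of Z.r_neg)
  then have "(\<Oplus>\<^bsub>Zl l\<^esub>i\<in>{1..r}. augmentation F (d i \<otimes>\<^bsub>A\<^esub> (gel (x i) \<ominus>\<^bsub>A\<^esub> \<one>\<^bsub>A\<^esub>))) = \<zero>\<^bsub>Zl l\<^esub>"
    by (rule Z_finsum_neutral)
  ultimately show ?thesis using s by simp
qed

text \<open>The elements whose Magnus expansion starts in degree \<open>n\<close> or later. They are the \<open>n\<close>-th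
  power of the augmentation ideal, and membership is read off from coefficients.\<close>

definition J :: "nat \<Rightarrow> 'a cga set" where
  "J n = {\<alpha> \<in> carrier A. \<forall>w\<in>words r. length w < n \<longrightarrow> \<Theta> \<alpha> w = \<zero>\<^bsub>Zl l\<^esub>}"

lemma J_mult:
  assumes "\<alpha> \<in> J m" "\<beta> \<in> J n"
  shows "\<alpha> \<otimes>\<^bsub>A\<^esub> \<beta> \<in> J (m + n)"
proof -
  have ab: "\<alpha> \<in> carrier A" "\<beta> \<in> carrier A" using assms by (auto simp: J_def)
  have "\<Theta> (\<alpha> \<otimes>\<^bsub>A\<^esub> \<beta>) w = \<zero>\<^bsub>Zl l\<^esub>" if w: "w \<in> words r" "length w < m + n" for w
  proof -
    have "\<Theta> \<alpha> (take i w) k * \<Theta> \<beta> (drop i w) k = 0" if "i \<le> length w" for i k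
    proof (cases "i < m")
      case True
      then have "\<Theta> \<alpha> (take i w) = \<zero>\<^bsub>Zl l\<^esub>" using assms(1) words_take_drop(1)[OF w(1)] by (simp add: J_def)
      then show ?thesis by (simp add: Zl_simps)
    next
      case False
      then have "\<Theta> \<beta> (drop i w) = \<zero>\<^bsub>Zl l\<^esub>"
        using assms(2) words_take_drop(2)[OF w(1)] w(2) that by (simp add: J_def)
      then show ?thesis by (simp add: Zl_simps)
    qed
    then have "conv (\<lambda>v. \<Theta> \<alpha> v k) (\<lambda>v. \<Theta> \<beta> v k) w = 0" for k
      unfolding conv_def by (intro sum.neutral) auto
    then show ?thesis
      using tensor_mult[OF l_pos Theta.hom_closed Theta.hom_closed, OF ab] w(1) ab by (simp add: Zl_simps)
  qed
  then show ?thesis using ab by (simp add: J_def)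
qed

lemma J_zero: "J 0 = carrier A"
  by (simp add: J_def)

lemma J_mono: "m \<le> n \<Longrightarrow> J n \<subseteq> J m"
  by (auto simp: J_def)

lemma J_ideal: "ideal (J n) A"
proof (rule idealI[OF A.ring_axioms])
  show "subgroup (J n) (add_monoid A)"
  proof (rule A.add.subgroupI)
    show "J n \<noteq> {}" using coeff_zero A.zero_closed unfolding J_def by blast
    show "\<ominus>\<^bsub>A\<^esub> a \<in> J n" if "a \<in> J n" for a
      using that by (auto simp only: J_def coeff_neg A.a_inv_closed mem_Collect_eq Z.minus_zero)
    show "a \<oplus>\<^bsub>A\<^esub> b \<in> J n" if "a \<in> J n" "b \<in> J n" for a b
      using that by (auto simp only: J_def coeff_add A.a_closed mem_Collect_eq Z.l_zero Z.zero_closed)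
  qed (auto simp: J_def)
  show "x \<otimes>\<^bsub>A\<^esub> a \<in> J n" if "a \<in> J n" "x \<in> carrier A" for a x
    using J_mult[of x 0 a n] that by (simp add: J_zero)
  show "a \<otimes>\<^bsub>A\<^esub> x \<in> J n" if "a \<in> J n" "x \<in> carrier A" for a x
    using J_mult[of a n x 0] that by (simp add: J_zero)
qed

lemma aug_ideal_eq: "aug_ideal l F T = J 1"
  by (auto simp: aug_ideal_def J_def aug_eq_coeff)

text \<open>Cutting off the first letter writes an expansion that starts in degree \<open>n + 1\<close> as a
  combination of \<open>x\<^sub>i - 1\<close> times expansions that start in degree \<open>n\<close>.\<close>

lemma aug_power_eq: "Ipow n = J n"
proof (induction n)
  case 0
  show ?case by (simp add: J_zero)
next
  case (Suc n)
  have 1: "\<alpha> \<in> J (Suc n)" if "\<alpha> \<in> ideal_prod A (J 1) (J n)" for \<alpha>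
    using that
  proof induction
    case (prod i j)
    then show ?case using J_mult[of i 1 j n] by simp
  next
    case (sum s1 s2)
    then show ?case by (intro additive_subgroup.a_closed[OF ideal.axioms(1)[OF J_ideal]])
  qed
  have 2: "\<alpha> \<in> ideal_prod A (J 1) (J n)" if a: "\<alpha> \<in> J (Suc n)" for \<alpha>
  proof -
    have ac: "\<alpha> \<in> carrier A" using a by (simp add: J_def)
    define e where "e i = inv_into (carrier A) \<Theta> (\<lambda>w\<in>words r. \<Theta> \<alpha> (i # w))" for i
    have e: "e i \<in> carrier A" "\<Theta> (e i) = (\<lambda>w\<in>words r. \<Theta> \<alpha> (i # w))" if "i \<in> {1..r}" for i
    proof -
      have "(\<lambda>w\<in>words r. \<Theta> \<alpha> (i # w)) \<in> carrier TH"
        using coeff_closed[OF ac] that by (auto simp: tensor_simps)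
      from Theta_inv[OF this] show "e i \<in> carrier A" "\<Theta> (e i) = (\<lambda>w\<in>words r. \<Theta> \<alpha> (i # w))"
        unfolding e_def by simp_all
    qed
    have eJ: "e i \<in> J n" if "i \<in> {1..r}" for i
      using e[OF that] a that by (auto simp: J_def)
    have gJ: "gel (x i) \<ominus>\<^bsub>A\<^esub> \<one>\<^bsub>A\<^esub> \<in> J 1" if "i \<in> {1..r}" for i
      using gen_closed(2)[OF that] Theta_gen[OF that] by (simp add: J_def tensor_X_def)
    let ?t = "\<lambda>i. (gel (x i) \<ominus>\<^bsub>A\<^esub> \<one>\<^bsub>A\<^esub>) \<otimes>\<^bsub>A\<^esub> e i"
    have t: "?t i \<in> carrier A" if "i \<in> {1..r}" for i
      using e(1)[OF that] gen_closed(2)[OF that] by simp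
    have "\<alpha> = (\<Oplus>\<^bsub>A\<^esub>i\<in>{1..r}. ?t i)"
    proof (rule Theta_eqI[OF ac])
      show "(\<Oplus>\<^bsub>A\<^esub>i\<in>{1..r}. ?t i) \<in> carrier A" using t by (intro A.finsum_closed) auto
      fix w assume w: "w \<in> words r"
      have "\<Theta> (\<Oplus>\<^bsub>A\<^esub>i\<in>{1..r}. ?t i) w = (\<Oplus>\<^bsub>Zl l\<^esub>i\<in>{1..r}. \<Theta> (?t i) w)"
        by (rule coeff_finsum) (use t w in auto)
      also have "\<dots> = \<Theta> \<alpha> w"
      proof (cases w)
        case Nil
        have "\<Theta> (?t i) w = \<zero>\<^bsub>Zl l\<^esub>" if "i \<in> {1..r}" for i
          using coeff_mult_gen_left[OF e(1)[OF that] that w] Nil by simp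
        then have "(\<Oplus>\<^bsub>Zl l\<^esub>i\<in>{1..r}. \<Theta> (?t i) w) = \<zero>\<^bsub>Zl l\<^esub>"
          by (rule Z_finsum_neutral)
        then show ?thesis using a Nil by (simp add: J_def)
      next
        case (Cons j u)
        then have j: "j \<in> {1..r}" and u: "u \<in> words r" using w by auto
        have "(\<Oplus>\<^bsub>Zl l\<^esub>i\<in>{1..r}. \<Theta> (?t i) w) = (\<Oplus>\<^bsub>Zl l\<^esub>i\<in>{1..r}. if j = i then \<Theta> (e j) u else \<zero>\<^bsub>Zl l\<^esub>)"
          by (rule Z.finsum_cong')
             (use e(1) w Cons u j coeff_closed[OF e(1)[OF j] u] in \<open>auto simp only: coeff_mult_gen_left list.sel split: if_splits\<close>)
        then show ?thesis
          using Z_finsum_delta[OF _ j coeff_closed[OF e(1)[OF j] u]] Cons e(2)[OF j] u by simp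
      qed
      finally show "\<Theta> \<alpha> w = \<Theta> (\<Oplus>\<^bsub>A\<^esub>i\<in>{1..r}. ?t i) w" by simp
    qed
    moreover have "(\<Oplus>\<^bsub>A\<^esub>i\<in>I. ?t i) \<in> ideal_prod A (J 1) (J n)" if "finite I" "I \<subseteq> {1..r}" for I
      using that
    proof (induction I rule: finite_induct)
      case empty
      have "\<zero>\<^bsub>A\<^esub> \<in> J k" for k using coeff_zero by (simp add: J_def)
      then have "\<zero>\<^bsub>A\<^esub> \<otimes>\<^bsub>A\<^esub> \<zero>\<^bsub>A\<^esub> \<in> ideal_prod A (J 1) (J n)" by (intro ideal_prod.prod)
      then show ?case by simp
    next
      case (insert i I)
      then have "(\<Oplus>\<^bsub>A\<^esub>i\<in>insert i I. ?t i) = ?t i \<oplus>\<^bsub>A\<^esub> (\<Oplus>\<^bsub>A\<^esub>i\<in>I. ?t i)"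
        using t by (intro A.finsum_insert) auto
      then show ?case
        using insert gJ eJ by (auto intro!: ideal_prod.sum ideal_prod.prod)
    qed
    ultimately show ?thesis by simp
  qed
  show ?case using 1 2 Suc by (auto simp: aug_ideal_eq)
qed


section \<open>Fox derivatives\<close>

text \<open>In terms of coefficients the \<open>j\<close>-th Fox derivative keeps the words that end in the letter
  \<open>j\<close> and deletes that letter.\<close>

lemma fox:
  assumes a: "\<alpha> \<in> carrier A" and j: "j \<in> {1..r}"
  shows fox_closed: "fox l r F T x j \<alpha> \<in> carrier A"
    and coeff_fox: "\<And>w. w \<in> words r \<Longrightarrow> \<Theta> (fox l r F T x j \<alpha>) w = \<Theta> \<alpha> (w @ [j])"
proof -
  define P where "P d \<longleftrightarrow> d \<in> {1..r} \<rightarrow>\<^sub>E carrier A \<and>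
    \<alpha> = (augmentation F \<alpha> \<odot>\<^bsub>A\<^esub> \<one>\<^bsub>A\<^esub>) \<oplus>\<^bsub>A\<^esub>
      (\<Oplus>\<^bsub>A\<^esub>i\<in>{1..r}. d i \<otimes>\<^bsub>A\<^esub> (gel (x i) \<ominus>\<^bsub>A\<^esub> \<one>\<^bsub>A\<^esub>))" for d
  define d where "d = (\<lambda>i\<in>{1..r}. inv_into (carrier A) \<Theta> (\<lambda>w\<in>words r. \<Theta> \<alpha> (w @ [i])))"
  have d: "d i \<in> carrier A" "\<Theta> (d i) = (\<lambda>w\<in>words r. \<Theta> \<alpha> (w @ [i]))" if i: "i \<in> {1..r}" for i
  proof -
    have "(\<lambda>w\<in>words r. \<Theta> \<alpha> (w @ [i])) \<in> carrier TH"
      using coeff_closed[OF a] i by (auto simp: tensor_simps)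
    from Theta_inv[OF this] show "d i \<in> carrier A" "\<Theta> (d i) = (\<lambda>w\<in>words r. \<Theta> \<alpha> (w @ [i]))"
      using i by (simp_all add: d_def)
  qed
  have s: "augmentation F \<alpha> \<in> carrier (Zl l)" by (rule aug_closed[OF a])
  have sum_closed: "(augmentation F \<alpha> \<odot>\<^bsub>A\<^esub> \<one>\<^bsub>A\<^esub>) \<oplus>\<^bsub>A\<^esub>
      (\<Oplus>\<^bsub>A\<^esub>i\<in>{1..r}. e i \<otimes>\<^bsub>A\<^esub> (gel (x i) \<ominus>\<^bsub>A\<^esub> \<one>\<^bsub>A\<^esub>)) \<in> carrier A"
    if e: "\<And>i. i \<in> {1..r} \<Longrightarrow> e i \<in> carrier A" for e
  proof (rule A.a_closed[OF cga_smult_closed[OF s A.one_closed]], rule A.finsum_closed, rule Pi_I)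
    fix i assume i: "i \<in> {1..r}"
    show "e i \<otimes>\<^bsub>A\<^esub> (gel (x i) \<ominus>\<^bsub>A\<^esub> \<one>\<^bsub>A\<^esub>) \<in> carrier A"
      using e[OF i] gen_closed(2)[OF i] by simp
  qed
  have "P d"
    unfolding P_def
  proof
    show "d \<in> {1..r} \<rightarrow>\<^sub>E carrier A" using d(1) by (auto simp: d_def)
    show "\<alpha> = (augmentation F \<alpha> \<odot>\<^bsub>A\<^esub> \<one>\<^bsub>A\<^esub>) \<oplus>\<^bsub>A\<^esub>
      (\<Oplus>\<^bsub>A\<^esub>i\<in>{1..r}. d i \<otimes>\<^bsub>A\<^esub> (gel (x i) \<ominus>\<^bsub>A\<^esub> \<one>\<^bsub>A\<^esub>))"
    proof (rule Theta_eqI[OF a sum_closed[OF d(1)]])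
      fix w assume w: "w \<in> words r"
      have "\<Theta> (d (last w)) (butlast w) = \<Theta> \<alpha> w" if "w \<noteq> []"
        using d(2)[OF words_last(1)[OF w that]] words_last(2)[OF w that] that by simp
      then show "\<Theta> \<alpha> w = \<Theta> ((augmentation F \<alpha> \<odot>\<^bsub>A\<^esub> \<one>\<^bsub>A\<^esub>) \<oplus>\<^bsub>A\<^esub>
          (\<Oplus>\<^bsub>A\<^esub>i\<in>{1..r}. d i \<otimes>\<^bsub>A\<^esub> (gel (x i) \<ominus>\<^bsub>A\<^esub> \<one>\<^bsub>A\<^esub>))) w"
        using coeff_fox_expansion[OF s d(1) w] aug_eq_coeff[OF a] by simp
    qed
  qed
  moreover have "e = d" if e: "P e" for e
  proof (rule PiE_ext)
    show ee: "e \<in> {1..r} \<rightarrow>\<^sub>E carrier A" and "d \<in> {1..r} \<rightarrow>\<^sub>E carrier A"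
      using e \<open>P d\<close> by (simp_all add: P_def)
    fix i assume i: "i \<in> {1..r}"
    have ec: "e k \<in> carrier A" if "k \<in> {1..r}" for k using PiE_mem[OF ee that] .
    show "e i = d i"
    proof (rule Theta_eqI[OF ec[OF i] d(1)[OF i]])
      fix w assume w: "w \<in> words r"
      then have wi: "w @ [i] \<in> words r" using i by simp
      have "\<Theta> \<alpha> (w @ [i]) = \<Theta> ((augmentation F \<alpha> \<odot>\<^bsub>A\<^esub> \<one>\<^bsub>A\<^esub>) \<oplus>\<^bsub>A\<^esub>
          (\<Oplus>\<^bsub>A\<^esub>i\<in>{1..r}. e i \<otimes>\<^bsub>A\<^esub> (gel (x i) \<ominus>\<^bsub>A\<^esub> \<one>\<^bsub>A\<^esub>))) (w @ [i])"
        using e unfolding P_def by (metis (no_types))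
      also have "\<dots> = \<Theta> (e i) w"
        using coeff_fox_expansion[OF s ec wi] by simp
      finally show "\<Theta> (e i) w = \<Theta> (d i) w" using d(2)[OF i] w by simp
    qed
  qed
  ultimately have "(THE d. P d) = d" by (rule the_equality)
  then have "fox l r F T x j \<alpha> = d j" by (simp add: fox_def P_def)
  then show "fox l r F T x j \<alpha> \<in> carrier A"
    "\<And>w. w \<in> words r \<Longrightarrow> \<Theta> (fox l r F T x j \<alpha>) w = \<Theta> \<alpha> (w @ [j])"
    using d[OF j] by simp_all
qed

lemma fox_minus:
  assumes "\<alpha> \<in> carrier A" "\<beta> \<in> carrier A" "j \<in> {1..r}"
  shows "fox l r F T x j (\<alpha> \<ominus>\<^bsub>A\<^esub> \<beta>) = fox l r F T x j \<alpha> \<ominus>\<^bsub>A\<^esub> fox l r F T x j \<beta>"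
proof (rule Theta_eqI)
  show "fox l r F T x j (\<alpha> \<ominus>\<^bsub>A\<^esub> \<beta>) \<in> carrier A"
    "fox l r F T x j \<alpha> \<ominus>\<^bsub>A\<^esub> fox l r F T x j \<beta> \<in> carrier A"
    by (intro fox_closed A.minus_closed assms)+
  fix w assume w: "w \<in> words r"
  then have wj: "w @ [j] \<in> words r" using assms(3) by simp
  show "\<Theta> (fox l r F T x j (\<alpha> \<ominus>\<^bsub>A\<^esub> \<beta>)) w = \<Theta> (fox l r F T x j \<alpha> \<ominus>\<^bsub>A\<^esub> fox l r F T x j \<beta>) w"
    unfolding coeff_fox[OF A.minus_closed[OF assms(1,2)] assms(3) w] coeff_minus[OF assms(1,2) wj]
      coeff_minus[OF fox_closed[OF assms(1,3)] fox_closed[OF assms(2,3)] w]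
      coeff_fox[OF assms(1,3) w] coeff_fox[OF assms(2,3) w] ..
qed

lemma fox_J:
  assumes "\<alpha> \<in> J (Suc n)" "j \<in> {1..r}"
  shows "fox l r F T x j \<alpha> \<in> J n"
proof -
  have a: "\<alpha> \<in> carrier A" using assms(1) unfolding J_def by blast
  have "\<Theta> (fox l r F T x j \<alpha>) w = \<zero>\<^bsub>Zl l\<^esub>" if w: "w \<in> words r" "length w < n" for w
  proof -
    have "w @ [j] \<in> words r" "length (w @ [j]) < Suc n" using w assms(2) by simp_all
    then have "\<Theta> \<alpha> (w @ [j]) = \<zero>\<^bsub>Zl l\<^esub>" using assms(1) unfolding J_def by blast
    then show ?thesis using coeff_fox[OF a assms(2) w(1)] by simp
  qed
  then show ?thesis using fox_closed[OF a assms(2)] unfolding J_def by blast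
qed

lemma coeff_one: "w \<in> words r \<Longrightarrow> \<Theta> \<one>\<^bsub>A\<^esub> w = (if w = [] then \<one>\<^bsub>Zl l\<^esub> else \<zero>\<^bsub>Zl l\<^esub>)"
  by (simp add: tensor_simps)

lemma coeff_gen:
  assumes "i \<in> {1..r}" "w \<in> words r"
  shows "\<Theta> (gel (x i)) w = (if w = [] \<or> w = [i] then \<one>\<^bsub>Zl l\<^esub> else \<zero>\<^bsub>Zl l\<^esub>)"
proof -
  have "\<Theta> (gel (x i)) = \<one>\<^bsub>TH\<^esub> \<oplus>\<^bsub>TH\<^esub> tensor_X l r i"
    using magnus assms(1) by (simp add: magnus_isomorphism_def)
  then show ?thesis using assms(2) by (simp add: tensor_simps tensor_X_def)
qed

lemma fox_gen:
  assumes "i \<in> {1..r}" "j \<in> {1..r}"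
  shows "fox l r F T x i (gel (x j)) = (if i = j then \<one>\<^bsub>A\<^esub> else \<zero>\<^bsub>A\<^esub>)"
proof (rule Theta_eqI[OF fox_closed[OF gen_closed(2)[OF assms(2)] assms(1)]])
  fix w assume w: "w \<in> words r"
  then have "w @ [i] \<in> words r" using assms(1) by simp
  then show "\<Theta> (fox l r F T x i (gel (x j))) w = \<Theta> (if i = j then \<one>\<^bsub>A\<^esub> else \<zero>\<^bsub>A\<^esub>) w"
    using coeff_fox[OF gen_closed(2)[OF assms(2)] assms(1) w] coeff_gen[OF assms(2), of "w @ [i]"]
      coeff_one[OF w] coeff_zero[OF w] by auto
qed simp


section \<open>Group elements and the filtration by powers of the augmentation ideal\<close>

lemma continuous_to_Zl:
  assumes val: "\<And>f. f \<in> carrier F \<Longrightarrow> h f \<in> carrier (Zl l)"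
    and open_fib: "\<And>n k. openin T {f \<in> carrier F. h f n = k}"
  shows "continuous_map T (Zl_topology l) h"
  unfolding Zl_topology_def
proof (rule continuous_map_into_subtopology)
  show "continuous_map T (product_topology (\<lambda>n. discrete_topology UNIV) UNIV) h"
    unfolding continuous_map_componentwise_UNIV
  proof
    fix n
    have "openin T {f \<in> topspace T. h f n \<in> U}" for U
    proof -
      have "{f \<in> topspace T. h f n \<in> U} = (\<Union>k\<in>U. {f \<in> carrier F. h f n = k})" by (auto simp: topspace_eq)
      then show ?thesis using open_fib by auto
    qed
    then show "continuous_map T (discrete_topology UNIV) (\<lambda>f. h f n)"
      by (simp add: continuous_map_def)
  qed
qed (use val topspace_eq in auto)

lemma continuous_gel: "continuous_map T (cga_topology l F T) gel"
  unfolding cga_topology_def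
proof (rule continuous_map_into_subtopology)
  show "gel \<in> topspace T \<rightarrow> carrier A" using cga_of_closed topspace_eq by auto
  show "continuous_map T (product_topology (\<lambda>N. product_topology (\<lambda>c. Zl_topology l) (rcosets N)) (open_normal F T)) gel"
  proof (rule continuous_map_componentwise[THEN iffD2], intro conjI ballI)
    show "gel ` topspace T \<subseteq> extensional (open_normal F T)" by (auto simp: cga_of_def)
    fix N assume N: "N \<in> open_normal F T"
    show "continuous_map T (product_topology (\<lambda>c. Zl_topology l) (rcosets N)) (\<lambda>f. gel f N)"
    proof (rule continuous_map_componentwise[THEN iffD2], intro conjI ballI)
      show "(\<lambda>f. gel f N) ` topspace T \<subseteq> extensional (rcosets N)" using N by (auto simp: cga_of_def)
      fix c assume c: "c \<in> rcosets N"
      have gc: "gel f N c = (if f \<in> c then \<one>\<^bsub>Zl l\<^esub> else \<zero>\<^bsub>Zl l\<^esub>)" for f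
        using N c by (simp add: cga_of_def)
      have cc: "c \<subseteq> carrier F" using openin_subset[OF rcoset_clopen(1)[OF N c]] topspace_eq by simp
      show "continuous_map T (Zl_topology l) (\<lambda>f. gel f N c)"
      proof (rule continuous_to_Zl)
        fix n k
        have "{f \<in> carrier F. gel f N c n = k} =
          (if \<one>\<^bsub>Zl l\<^esub> n = k then c else {}) \<union> (if \<zero>\<^bsub>Zl l\<^esub> n = k then topspace T - c else {})"
          using cc by (auto simp: gc topspace_eq)
        moreover have "openin T c" "openin T (topspace T - c)"
          using rcoset_clopen[OF N c] by (auto simp: closedin_def)
        ultimately show "openin T {f \<in> carrier F. gel f N c n = k}" by (auto intro!: openin_Un)
      qed (simp add: gc)
    qed
  qed
qed

lemma continuous_coeff:
  assumes w: "w \<in> words r"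
  shows "continuous_map T (discrete_topology UNIV) (\<lambda>f. \<Theta> (gel f) w n)"
proof -
  have "continuous_map (cga_topology l F T) (tensor_topology l r) \<Theta>"
    using magnus by (simp add: magnus_isomorphism_def homeomorphic_imp_continuous_map)
  then have 1: "continuous_map T (tensor_topology l r) (\<lambda>f. \<Theta> (gel f))"
    using continuous_map_compose[OF continuous_gel] by (simp add: o_def)
  have "continuous_map (tensor_topology l r) (Zl_topology l) (\<lambda>t. t w)"
    unfolding tensor_topology_def by (rule continuous_map_product_projection[OF w])
  from continuous_map_compose[OF 1 this] have 2: "continuous_map T (Zl_topology l) (\<lambda>f. \<Theta> (gel f) w)"
    by (simp add: o_def)
  have "continuous_map (Zl_topology l) (discrete_topology UNIV) (\<lambda>a. a n)"
    unfolding Zl_topology_def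
    by (rule continuous_map_from_subtopology[OF continuous_map_product_projection]) simp
  from continuous_map_compose[OF 2 this] show ?thesis by (simp add: o_def)
qed

lemma gel_one: "gel \<one> = \<one>\<^bsub>A\<^esub>"
  by (simp add: cga_one)

lemma gel_inv:
  assumes "f \<in> carrier F"
  shows "gel f \<otimes>\<^bsub>A\<^esub> gel (inv f) = \<one>\<^bsub>A\<^esub>" "gel (inv f) \<otimes>\<^bsub>A\<^esub> gel f = \<one>\<^bsub>A\<^esub>"
  using assms by (simp_all add: gel_one flip: cga_of_mult)

text \<open>The dimension subgroups: the elements congruent to 1 modulo the \<open>n\<close>-th power of the
  augmentation ideal.\<close>

definition dimsub :: "nat \<Rightarrow> 'a set" where
  "dimsub n = {f \<in> carrier F. gel f \<ominus>\<^bsub>A\<^esub> \<one>\<^bsub>A\<^esub> \<in> J n}"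

lemma J_closed: "\<alpha> \<in> J n \<Longrightarrow> \<alpha> \<in> carrier A"
  unfolding J_def by blast

lemma J_add: "\<alpha> \<in> J n \<Longrightarrow> \<beta> \<in> J n \<Longrightarrow> \<alpha> \<oplus>\<^bsub>A\<^esub> \<beta> \<in> J n"
  by (rule additive_subgroup.a_closed[OF ideal.axioms(1)[OF J_ideal]])

lemma J_neg: "\<alpha> \<in> J n \<Longrightarrow> \<ominus>\<^bsub>A\<^esub> \<alpha> \<in> J n"
  by (rule additive_subgroup.a_inv_closed[OF ideal.axioms(1)[OF J_ideal]])

lemma J_minus: "\<alpha> \<in> J n \<Longrightarrow> \<beta> \<in> J n \<Longrightarrow> \<alpha> \<ominus>\<^bsub>A\<^esub> \<beta> \<in> J n"
  unfolding A.minus_eq by (intro J_add J_neg)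

lemma J_left: "\<alpha> \<in> carrier A \<Longrightarrow> \<beta> \<in> J n \<Longrightarrow> \<alpha> \<otimes>\<^bsub>A\<^esub> \<beta> \<in> J n"
  by (rule ideal.I_l_closed[OF J_ideal])

lemma J_right: "\<beta> \<in> J n \<Longrightarrow> \<alpha> \<in> carrier A \<Longrightarrow> \<beta> \<otimes>\<^bsub>A\<^esub> \<alpha> \<in> J n"
  by (rule ideal.I_r_closed[OF J_ideal])

lemma dimsub_subgroup: "subgroup (dimsub n) F"
proof (rule F.subgroupI)
  show "dimsub n \<subseteq> carrier F" unfolding dimsub_def by blast
  have "gel \<one> \<ominus>\<^bsub>A\<^esub> \<one>\<^bsub>A\<^esub> = \<zero>\<^bsub>A\<^esub>"
    unfolding gel_one A.minus_eq by (rule A.r_neg[OF A.one_closed])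
  also have "\<dots> \<in> J n" by (rule additive_subgroup.zero_closed[OF ideal.axioms(1)[OF J_ideal]])
  finally have "\<one> \<in> dimsub n" by (simp add: dimsub_def)
  then show "dimsub n \<noteq> {}" by blast
  fix f assume f: "f \<in> dimsub n"
  then have fc: "f \<in> carrier F" and fJ: "gel f \<ominus>\<^bsub>A\<^esub> \<one>\<^bsub>A\<^esub> \<in> J n" unfolding dimsub_def by blast+
  have gi: "gel (inv f) \<in> carrier A" "gel f \<in> carrier A" using fc by (auto intro: cga_of_closed)
  have "gel (inv f) \<ominus>\<^bsub>A\<^esub> \<one>\<^bsub>A\<^esub> = \<ominus>\<^bsub>A\<^esub> (gel (inv f) \<otimes>\<^bsub>A\<^esub> (gel f \<ominus>\<^bsub>A\<^esub> \<one>\<^bsub>A\<^esub>))"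
    using gi gel_inv(2)[OF fc] by (simp add: A.minus_eq A.r_distr A.minus_add A.r_minus A.a_comm)
  moreover have "\<ominus>\<^bsub>A\<^esub> (gel (inv f) \<otimes>\<^bsub>A\<^esub> (gel f \<ominus>\<^bsub>A\<^esub> \<one>\<^bsub>A\<^esub>)) \<in> J n"
    by (intro J_neg J_left gi fJ)
  ultimately show "inv f \<in> dimsub n" using fc by (simp add: dimsub_def)
  fix g assume g: "g \<in> dimsub n"
  then have gc: "g \<in> carrier F" and gJ: "gel g \<ominus>\<^bsub>A\<^esub> \<one>\<^bsub>A\<^esub> \<in> J n" unfolding dimsub_def by blast+
  have gA: "gel g \<in> carrier A" using gc by (rule cga_of_closed)
  have "gel (f \<otimes> g) \<ominus>\<^bsub>A\<^esub> \<one>\<^bsub>A\<^esub> = gel f \<otimes>\<^bsub>A\<^esub> (gel g \<ominus>\<^bsub>A\<^esub> \<one>\<^bsub>A\<^esub>) \<oplus>\<^bsub>A\<^esub> (gel f \<ominus>\<^bsub>A\<^esub> \<one>\<^bsub>A\<^esub>)"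
  proof -
    have "gel f \<otimes>\<^bsub>A\<^esub> gel g \<oplus>\<^bsub>A\<^esub> \<ominus>\<^bsub>A\<^esub> gel f \<oplus>\<^bsub>A\<^esub> (gel f \<oplus>\<^bsub>A\<^esub> \<ominus>\<^bsub>A\<^esub> \<one>\<^bsub>A\<^esub>) =
        gel f \<otimes>\<^bsub>A\<^esub> gel g \<oplus>\<^bsub>A\<^esub> (\<ominus>\<^bsub>A\<^esub> gel f \<oplus>\<^bsub>A\<^esub> gel f) \<oplus>\<^bsub>A\<^esub> \<ominus>\<^bsub>A\<^esub> \<one>\<^bsub>A\<^esub>"
      using gi(2) gA by (simp add: A.a_assoc)
    also have "\<dots> = gel f \<otimes>\<^bsub>A\<^esub> gel g \<oplus>\<^bsub>A\<^esub> \<ominus>\<^bsub>A\<^esub> \<one>\<^bsub>A\<^esub>" using gi(2) gA by (simp add: A.l_neg)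
    finally show ?thesis
      using gi(2) gA by (simp add: cga_of_mult[OF fc gc] A.minus_eq A.r_distr A.r_minus)
  qed
  moreover have "gel f \<otimes>\<^bsub>A\<^esub> (gel g \<ominus>\<^bsub>A\<^esub> \<one>\<^bsub>A\<^esub>) \<oplus>\<^bsub>A\<^esub> (gel f \<ominus>\<^bsub>A\<^esub> \<one>\<^bsub>A\<^esub>) \<in> J n"
    by (intro J_add J_left gi fJ gJ)
  ultimately show "f \<otimes> g \<in> dimsub n" using fc gc by (simp add: dimsub_def)
qed

text \<open>Modulo \<open>l\<^sup>k\<close> every coefficient of the Magnus expansion is a locally constant function of
  the group element, so prescribing coefficients cuts out a closed set.\<close>

lemma dimsub_closed: "closedin T (dimsub n)"
proof -
  define W where "W = {(w, k :: nat). w \<in> words r \<and> length w < n}"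
  define E where "E p = {f \<in> topspace T. \<Theta> (gel f) (fst p) (snd p) \<in> {\<Theta> \<one>\<^bsub>A\<^esub> (fst p) (snd p)}}" for p
  have cl: "closedin T (E p)" if "p \<in> W" for p
    unfolding E_def
    by (rule closedin_continuous_map_preimage[OF continuous_coeff]) (use that in \<open>auto simp: W_def\<close>)
  have eq: "\<Theta> (gel f \<ominus>\<^bsub>A\<^esub> \<one>\<^bsub>A\<^esub>) w = \<zero>\<^bsub>Zl l\<^esub> \<longleftrightarrow> (\<forall>k. \<Theta> (gel f) w k = \<Theta> \<one>\<^bsub>A\<^esub> w k)"
    if "f \<in> carrier F" "w \<in> words r" for f w
  proof -
    note c = coeff_closed[OF cga_of_closed[OF that(1)] that(2)] coeff_closed[OF A.one_closed that(2)]
    have "\<Theta> (gel f \<ominus>\<^bsub>A\<^esub> \<one>\<^bsub>A\<^esub>) w = \<Theta> (gel f) w \<ominus>\<^bsub>Zl l\<^esub> \<Theta> \<one>\<^bsub>A\<^esub> w"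
      by (rule coeff_minus[OF cga_of_closed[OF that(1)] A.one_closed that(2)])
    then have "\<Theta> (gel f \<ominus>\<^bsub>A\<^esub> \<one>\<^bsub>A\<^esub>) w = \<zero>\<^bsub>Zl l\<^esub> \<longleftrightarrow> \<Theta> (gel f) w = \<Theta> \<one>\<^bsub>A\<^esub> w"
      using Z.r_right_minus_eq[OF c] by (simp only:)
    then show ?thesis by (simp only: fun_eq_iff)
  qed
  have "dimsub n = \<Inter>(insert (topspace T) (E ` W))"
  proof (intro Set.set_eqI iffI)
    fix f assume f: "f \<in> dimsub n"
    then have fc: "f \<in> carrier F" unfolding dimsub_def by blast
    have "f \<in> E p" if pW: "p \<in> W" for p
    proof -
      obtain w k where p: "p = (w, k)" "w \<in> words r" "length w < n" using pW by (auto simp: W_def)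
      then have "\<Theta> (gel f \<ominus>\<^bsub>A\<^esub> \<one>\<^bsub>A\<^esub>) w = \<zero>\<^bsub>Zl l\<^esub>" using f unfolding dimsub_def J_def by blast
      then have "\<forall>k. \<Theta> (gel f) w k = \<Theta> \<one>\<^bsub>A\<^esub> w k" unfolding eq[OF fc p(2)] .
      then show ?thesis using fc unfolding E_def p(1) fst_conv snd_conv topspace_eq by blast
    qed
    then show "f \<in> \<Inter>(insert (topspace T) (E ` W))" using fc topspace_eq by blast
  next
    fix f assume f: "f \<in> \<Inter>(insert (topspace T) (E ` W))"
    then have fc: "f \<in> carrier F" using topspace_eq by blast
    have "\<Theta> (gel f \<ominus>\<^bsub>A\<^esub> \<one>\<^bsub>A\<^esub>) w = \<zero>\<^bsub>Zl l\<^esub>" if w: "w \<in> words r" "length w < n" for w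
      unfolding eq[OF fc w(1)]
    proof
      fix k
      have "(w, k) \<in> W" using w by (simp add: W_def)
      then have "f \<in> E (w, k)" using f by blast
      then show "\<Theta> (gel f) w k = \<Theta> \<one>\<^bsub>A\<^esub> w k" by (simp add: E_def)
    qed
    moreover have "gel f \<ominus>\<^bsub>A\<^esub> \<one>\<^bsub>A\<^esub> \<in> carrier A" using cga_of_closed[OF fc] by simp
    ultimately show "f \<in> dimsub n" using fc unfolding dimsub_def J_def by blast
  qed
  moreover have "closedin T (\<Inter>(insert (topspace T) (E ` W)))"
    by (rule closedin_Inter) (use cl in auto)
  ultimately show ?thesis by simp
qed

lemma dimsub_1: "dimsub 1 = carrier F"
proof -
  have "\<Theta> (gel f \<ominus>\<^bsub>A\<^esub> \<one>\<^bsub>A\<^esub>) [] = \<zero>\<^bsub>Zl l\<^esub>" if f: "f \<in> carrier F" for f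
  proof -
    have "\<Theta> (gel f \<ominus>\<^bsub>A\<^esub> \<one>\<^bsub>A\<^esub>) [] = augmentation F (gel f \<ominus>\<^bsub>A\<^esub> \<one>\<^bsub>A\<^esub>)"
      using aug_eq_coeff[of "gel f \<ominus>\<^bsub>A\<^esub> \<one>\<^bsub>A\<^esub>"] cga_of_closed[OF f] by simp
    also have "\<dots> = \<zero>\<^bsub>Zl l\<^esub>"
      using cga_of_closed[OF f] by (simp add: A.minus_eq aug_cga_of[OF f] Z.r_neg)
    finally show ?thesis .
  qed
  then have "gel f \<ominus>\<^bsub>A\<^esub> \<one>\<^bsub>A\<^esub> \<in> J 1" if "f \<in> carrier F" for f
    using cga_of_closed[OF that] that by (simp add: J_def)
  then show ?thesis unfolding dimsub_def by blast
qed

text \<open>With \<open>u = a - 1\<close> and \<open>v = b - 1\<close> one has \<open>a b a\<^sup>-\<^sup>1 b\<^sup>-\<^sup>1 - 1 = (u v - v u) a\<^sup>-\<^sup>1 b\<^sup>-\<^sup>1\<close>.\<close>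

lemma dimsub_commutator:
  assumes a: "a \<in> dimsub n" and b: "b \<in> carrier F"
  shows "a \<otimes> b \<otimes> inv a \<otimes> inv b \<in> dimsub (Suc n)"
proof -
  have ac: "a \<in> carrier F" and aJ: "gel a \<ominus>\<^bsub>A\<^esub> \<one>\<^bsub>A\<^esub> \<in> J n" using a unfolding dimsub_def by blast+
  have bJ: "gel b \<ominus>\<^bsub>A\<^esub> \<one>\<^bsub>A\<^esub> \<in> J 1" using b dimsub_1 unfolding dimsub_def by blast
  define p q p' q' where "p = gel a" and "q = gel b" and "p' = gel (inv a)" and "q' = gel (inv b)"
  have cl: "p \<in> carrier A" "q \<in> carrier A" "p' \<in> carrier A" "q' \<in> carrier A"
    using ac b by (auto simp: p_def q_def p'_def q'_def intro: cga_of_closed)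
  have "q \<otimes>\<^bsub>A\<^esub> p \<otimes>\<^bsub>A\<^esub> (p' \<otimes>\<^bsub>A\<^esub> q') = \<one>\<^bsub>A\<^esub>"
  proof -
    have "q \<otimes>\<^bsub>A\<^esub> p \<otimes>\<^bsub>A\<^esub> (p' \<otimes>\<^bsub>A\<^esub> q') = q \<otimes>\<^bsub>A\<^esub> (p \<otimes>\<^bsub>A\<^esub> p') \<otimes>\<^bsub>A\<^esub> q'" using cl by (simp add: A.m_assoc)
    then show ?thesis using cl gel_inv(1)[OF ac] gel_inv(1)[OF b] by (simp add: p_def p'_def q_def q'_def)
  qed
  then have "p \<otimes>\<^bsub>A\<^esub> q \<otimes>\<^bsub>A\<^esub> p' \<otimes>\<^bsub>A\<^esub> q' \<ominus>\<^bsub>A\<^esub> \<one>\<^bsub>A\<^esub> = (p \<otimes>\<^bsub>A\<^esub> q \<ominus>\<^bsub>A\<^esub> q \<otimes>\<^bsub>A\<^esub> p) \<otimes>\<^bsub>A\<^esub> (p' \<otimes>\<^bsub>A\<^esub> q')"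
    using cl by (simp add: A.minus_eq A.l_distr A.l_minus A.m_assoc)
  also have "p \<otimes>\<^bsub>A\<^esub> q \<ominus>\<^bsub>A\<^esub> q \<otimes>\<^bsub>A\<^esub> p =
      (p \<ominus>\<^bsub>A\<^esub> \<one>\<^bsub>A\<^esub>) \<otimes>\<^bsub>A\<^esub> (q \<ominus>\<^bsub>A\<^esub> \<one>\<^bsub>A\<^esub>) \<ominus>\<^bsub>A\<^esub> (q \<ominus>\<^bsub>A\<^esub> \<one>\<^bsub>A\<^esub>) \<otimes>\<^bsub>A\<^esub> (p \<ominus>\<^bsub>A\<^esub> \<one>\<^bsub>A\<^esub>)"
  proof -
    define u v where "u = p \<ominus>\<^bsub>A\<^esub> \<one>\<^bsub>A\<^esub>" and "v = q \<ominus>\<^bsub>A\<^esub> \<one>\<^bsub>A\<^esub>"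
    have uv: "u \<in> carrier A" "v \<in> carrier A" using cl by (simp_all add: u_def v_def)
    have pq: "p = u \<oplus>\<^bsub>A\<^esub> \<one>\<^bsub>A\<^esub>" "q = v \<oplus>\<^bsub>A\<^esub> \<one>\<^bsub>A\<^esub>"
      using cl by (simp_all add: u_def v_def A.minus_eq A.a_assoc A.l_neg)
    have "p \<otimes>\<^bsub>A\<^esub> q = u \<otimes>\<^bsub>A\<^esub> v \<oplus>\<^bsub>A\<^esub> (u \<oplus>\<^bsub>A\<^esub> v \<oplus>\<^bsub>A\<^esub> \<one>\<^bsub>A\<^esub>)" "q \<otimes>\<^bsub>A\<^esub> p = v \<otimes>\<^bsub>A\<^esub> u \<oplus>\<^bsub>A\<^esub> (u \<oplus>\<^bsub>A\<^esub> v \<oplus>\<^bsub>A\<^esub> \<one>\<^bsub>A\<^esub>)"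
      using uv by (simp_all add: pq A.l_distr A.r_distr A.a_ac)
    moreover have "(s \<oplus>\<^bsub>A\<^esub> e) \<ominus>\<^bsub>A\<^esub> (t \<oplus>\<^bsub>A\<^esub> e) = s \<ominus>\<^bsub>A\<^esub> t"
      if "s \<in> carrier A" "t \<in> carrier A" "e \<in> carrier A" for s t e
    proof -
      have "(s \<oplus>\<^bsub>A\<^esub> e) \<ominus>\<^bsub>A\<^esub> (t \<oplus>\<^bsub>A\<^esub> e) = s \<oplus>\<^bsub>A\<^esub> \<ominus>\<^bsub>A\<^esub> t \<oplus>\<^bsub>A\<^esub> (e \<oplus>\<^bsub>A\<^esub> \<ominus>\<^bsub>A\<^esub> e)"
        using that by (simp only: A.minus_eq A.minus_add A.a_ac A.a_closed A.a_inv_closed)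
      then show ?thesis using that by (simp add: A.r_neg A.minus_eq)
    qed
    ultimately show ?thesis using uv unfolding u_def[symmetric] v_def[symmetric] by simp
  qed
  finally have "p \<otimes>\<^bsub>A\<^esub> q \<otimes>\<^bsub>A\<^esub> p' \<otimes>\<^bsub>A\<^esub> q' \<ominus>\<^bsub>A\<^esub> \<one>\<^bsub>A\<^esub> =
      ((p \<ominus>\<^bsub>A\<^esub> \<one>\<^bsub>A\<^esub>) \<otimes>\<^bsub>A\<^esub> (q \<ominus>\<^bsub>A\<^esub> \<one>\<^bsub>A\<^esub>) \<ominus>\<^bsub>A\<^esub> (q \<ominus>\<^bsub>A\<^esub> \<one>\<^bsub>A\<^esub>) \<otimes>\<^bsub>A\<^esub> (p \<ominus>\<^bsub>A\<^esub> \<one>\<^bsub>A\<^esub>)) \<otimes>\<^bsub>A\<^esub> (p' \<otimes>\<^bsub>A\<^esub> q')" .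
  moreover have "\<dots> \<in> J (Suc n)"
  proof (rule J_right[OF J_minus])
    show "(p \<ominus>\<^bsub>A\<^esub> \<one>\<^bsub>A\<^esub>) \<otimes>\<^bsub>A\<^esub> (q \<ominus>\<^bsub>A\<^esub> \<one>\<^bsub>A\<^esub>) \<in> J (Suc n)"
      using J_mult[OF aJ bJ] by (simp add: p_def q_def)
    show "(q \<ominus>\<^bsub>A\<^esub> \<one>\<^bsub>A\<^esub>) \<otimes>\<^bsub>A\<^esub> (p \<ominus>\<^bsub>A\<^esub> \<one>\<^bsub>A\<^esub>) \<in> J (Suc n)"
      using J_mult[OF bJ aJ] by (simp add: p_def q_def)
  qed (use cl in simp)
  moreover have "gel (a \<otimes> b \<otimes> inv a \<otimes> inv b) = p \<otimes>\<^bsub>A\<^esub> q \<otimes>\<^bsub>A\<^esub> p' \<otimes>\<^bsub>A\<^esub> q'"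
    using ac b by (simp add: cga_of_mult p_def q_def p'_def q'_def)
  ultimately show ?thesis using ac b by (simp add: dimsub_def)
qed

text \<open>Commutators with \<open>F\<close> raise the degree by one, and passing to the closed subgroup that they
  generate stays inside, because dimension subgroups are closed.\<close>

lemma lcs_subset_dimsub: "lcs F T (Suc n) \<subseteq> dimsub (Suc n)"
proof (induction n)
  case 0
  show ?case using dimsub_1 by simp
next
  case (Suc n)
  have "commutators (lcs F T (Suc n)) \<subseteq> dimsub (Suc (Suc n))"
    using Suc dimsub_commutator by blast
  then have "generate F (commutators (lcs F T (Suc n))) \<subseteq> dimsub (Suc (Suc n))"
    by (rule F.generate_subgroup_incl[OF _ dimsub_subgroup])
  then show ?case
    unfolding lcs.simps topologically_generated_def by (rule closure_of_minimal[OF _ dimsub_closed])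
qed


section \<open>The abelianisation\<close>


text \<open>The coefficient at the one-letter word \<open>[i]\<close> is a continuous homomorphism from \<open>F\<close> to the
  \<open>l\<close>-adic integers that sends \<open>x\<^sub>j\<close> to the Kronecker delta. It detects the \<open>i\<close>-th coordinate
  of a class in \<open>H\<close>.\<close>

lemma coeff1_mult:
  assumes f: "f \<in> carrier F" and g: "g \<in> carrier F" and i: "i \<in> {1..r}"
  shows "\<Theta> (gel (f \<otimes> g)) [i] n = (\<Theta> (gel f) [i] n + \<Theta> (gel g) [i] n) mod int l ^ n"
proof -
  note gc = cga_of_closed[OF f] cga_of_closed[OF g]
  have e: "\<Theta> (gel h) [] = \<one>\<^bsub>Zl l\<^esub>" if "h \<in> carrier F" for h
    using aug_eq_coeff[OF cga_of_closed[OF that]] aug_cga_of[OF that] by simp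
  have "\<Theta> (gel (f \<otimes> g)) = \<Theta> (gel f) \<otimes>\<^bsub>TH\<^esub> \<Theta> (gel g)"
    using gc by (simp add: cga_of_mult[OF f g])
  then have "\<Theta> (gel (f \<otimes> g)) [i] n = conv (\<lambda>v. \<Theta> (gel f) v n) (\<lambda>v. \<Theta> (gel g) v n) [i] mod int l ^ n"
    using i by (simp add: tensor_mult[OF l_pos Theta.hom_closed[OF gc(1)] Theta.hom_closed[OF gc(2)]])
  also have "conv (\<lambda>v. \<Theta> (gel f) v n) (\<lambda>v. \<Theta> (gel g) v n) [i] =
      \<Theta> (gel f) [i] n * (1 mod int l ^ n) + (1 mod int l ^ n) * \<Theta> (gel g) [i] n"
    by (simp add: conv_Cons conv_Nil e[OF f] e[OF g] Zl_simps(3))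
  also have "\<dots> mod int l ^ n = (\<Theta> (gel f) [i] n * 1 + 1 * \<Theta> (gel g) [i] n) mod int l ^ n"
    by (intro mod_add_cong mod_mult_cong) simp_all
  finally show ?thesis by simp
qed

lemma coeff1_one: "i \<in> {1..r} \<Longrightarrow> \<Theta> (gel \<one>) [i] = \<zero>\<^bsub>Zl l\<^esub>"
  using coeff_one[of "[i]"] by (simp add: gel_one)

lemma coeff1_gen: "i \<in> {1..r} \<Longrightarrow> j \<in> {1..r} \<Longrightarrow> \<Theta> (gel (x j)) [i] = (if i = j then \<one>\<^bsub>Zl l\<^esub> else \<zero>\<^bsub>Zl l\<^esub>)"
  using coeff_gen[of j "[i]"] by simp

lemma coeff1_pow:
  assumes f: "f \<in> carrier F" and i: "i \<in> {1..r}"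
  shows "\<Theta> (gel (f [^] (z :: int))) [i] n mod int l ^ n = (z * \<Theta> (gel f) [i] n) mod int l ^ n"
proof (induction z rule: int_induct[of _ 0])
  case base
  show ?case using coeff1_one[OF i] by (simp add: Zl_simps)
next
  case (step1 z)
  have "f [^] (z + 1) = f [^] z \<otimes> f" using f by (simp add: F.int_pow_mult)
  then have "\<Theta> (gel (f [^] (z + 1))) [i] n = (\<Theta> (gel (f [^] z)) [i] n + \<Theta> (gel f) [i] n) mod int l ^ n"
    using coeff1_mult[OF _ f i] f by simp
  also have "\<dots> = (z * \<Theta> (gel f) [i] n + \<Theta> (gel f) [i] n) mod int l ^ n"
    by (rule mod_add_cong[OF step1(2) refl])
  finally show ?case by (simp add: distrib_right)
next
  case (step2 z)
  have "f [^] z = f [^] (z - 1) \<otimes> f"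
    using f F.int_pow_mult[OF f, of "z - 1" 1] by simp
  then have "\<Theta> (gel (f [^] z)) [i] n = (\<Theta> (gel (f [^] (z - 1))) [i] n + \<Theta> (gel f) [i] n) mod int l ^ n"
    using coeff1_mult[OF _ f i] f by simp
  then have *: "(\<Theta> (gel (f [^] (z - 1))) [i] n + \<Theta> (gel f) [i] n) mod int l ^ n = (z * \<Theta> (gel f) [i] n) mod int l ^ n"
    using step2(2) by simp
  have "\<Theta> (gel (f [^] (z - 1))) [i] n mod int l ^ n =
      ((\<Theta> (gel (f [^] (z - 1))) [i] n + \<Theta> (gel f) [i] n) - \<Theta> (gel f) [i] n) mod int l ^ n" by simp
  also have "\<dots> = (z * \<Theta> (gel f) [i] n - \<Theta> (gel f) [i] n) mod int l ^ n"
    by (rule mod_diff_cong[OF * refl])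
  finally show ?case by (simp add: left_diff_distrib)
qed

text \<open>Modulo \<open>l\<^sup>n\<close> the coefficient is locally constant, so its value at the limit is its value at
  a late member of the sequence of powers.\<close>

lemma coeff1_Zl_pow:
  assumes f: "f \<in> carrier F" and N: "N \<in> carrier (Zl l)" and i: "i \<in> {1..r}"
  shows "\<Theta> (gel (Zl_pow F T f N)) [i] = N \<otimes>\<^bsub>Zl l\<^esub> \<Theta> (gel f) [i]"
proof
  fix n
  have w: "[i] \<in> words r" using i by simp
  let ?y = "Zl_pow F T f N"
  have val: "\<Theta> (gel h) [i] \<in> carrier (Zl l)" if "h \<in> carrier F" for h
    by (rule coeff_closed[OF cga_of_closed[OF that] w])
  have "limitin (discrete_topology UNIV) ((\<lambda>f. \<Theta> (gel f) [i] n) \<circ> (\<lambda>k. f [^] N k)) (\<Theta> (gel ?y) [i] n) sequentially"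
    by (rule continuous_map_limit[OF continuous_coeff[OF w] Zl_pow_limit[OF f N]])
  then have "\<forall>\<^sub>F k in sequentially. \<Theta> (gel (f [^] N k)) [i] n \<in> {\<Theta> (gel ?y) [i] n}"
    unfolding limitin_def by (auto simp: o_def)
  then obtain k0 where "\<And>k. k \<ge> k0 \<Longrightarrow> \<Theta> (gel (f [^] N k)) [i] n = \<Theta> (gel ?y) [i] n"
    by (auto simp: eventually_sequentially)
  then have "\<Theta> (gel ?y) [i] n = \<Theta> (gel (f [^] N (max k0 n))) [i] n" by simp
  also have "\<dots> = \<Theta> (gel (f [^] N (max k0 n))) [i] n mod int l ^ n"
    using Zl_mod[OF val, of "f [^] N (max k0 n)"] f by simp
  also have "\<dots> = (N (max k0 n) * \<Theta> (gel f) [i] n) mod int l ^ n" by (rule coeff1_pow[OF f i])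
  also have "\<dots> = (N n * \<Theta> (gel f) [i] n) mod int l ^ n"
    by (rule mod_mult_cong) (use Zl_mod_le[OF N, of n "max k0 n"] Zl_mod[OF N] in simp_all)
  finally show "\<Theta> (gel ?y) [i] n = (N \<otimes>\<^bsub>Zl l\<^esub> \<Theta> (gel f) [i]) n" by (simp add: Zl_simps)
qed

lemma coeff1_lcs2:
  assumes "f \<in> lcs F T 2" "i \<in> {1..r}"
  shows "\<Theta> (gel f) [i] = \<zero>\<^bsub>Zl l\<^esub>"
proof -
  have fD: "f \<in> dimsub 2" using assms(1) lcs_subset_dimsub[of 1] by (auto simp: numeral_2_eq_2)
  then have f: "f \<in> carrier F" unfolding dimsub_def by blast
  have w: "[i] \<in> words r" "length [i] < 2" using assms(2) by simp_all
  have "\<Theta> (gel f \<ominus>\<^bsub>A\<^esub> \<one>\<^bsub>A\<^esub>) [i] = \<zero>\<^bsub>Zl l\<^esub>" using fD w unfolding dimsub_def J_def by blast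
  then have "\<Theta> (gel f) [i] \<ominus>\<^bsub>Zl l\<^esub> \<Theta> \<one>\<^bsub>A\<^esub> [i] = \<zero>\<^bsub>Zl l\<^esub>"
    unfolding coeff_minus[OF cga_of_closed[OF f] A.one_closed w(1)] .
  then have "\<Theta> (gel f) [i] = \<Theta> \<one>\<^bsub>A\<^esub> [i]"
    unfolding Z.r_right_minus_eq[OF coeff_closed[OF cga_of_closed[OF f] w(1)] coeff_closed[OF A.one_closed w(1)]] .
  then show ?thesis using coeff_one[OF w(1)] by simp
qed

lemma coeff1_foldr:
  assumes i: "i \<in> {1..r}" and "distinct ks" and c: "c \<in> carrier (Zl l)"
    and y: "\<And>k. k \<in> set ks \<Longrightarrow> y k \<in> carrier F"
      "\<And>k. k \<in> set ks \<Longrightarrow> \<Theta> (gel (y k)) [i] = (if k = i then c else \<zero>\<^bsub>Zl l\<^esub>)"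
  shows "foldr (\<lambda>k z. y k \<otimes> z) ks \<one> \<in> carrier F \<and>
    \<Theta> (gel (foldr (\<lambda>k z. y k \<otimes> z) ks \<one>)) [i] = (if i \<in> set ks then c else \<zero>\<^bsub>Zl l\<^esub>)"
  using assms(2) y
proof (induction ks)
  case Nil
  show ?case using coeff1_one[OF i] by simp
next
  case (Cons k ks)
  let ?p = "foldr (\<lambda>k z. y k \<otimes> z) ks \<one>"
  have p: "?p \<in> carrier F" "\<Theta> (gel ?p) [i] = (if i \<in> set ks then c else \<zero>\<^bsub>Zl l\<^esub>)"
    using Cons by auto
  have k: "y k \<in> carrier F" "\<Theta> (gel (y k)) [i] = (if k = i then c else \<zero>\<^bsub>Zl l\<^esub>)"
    using Cons(3,4) by auto
  have "\<Theta> (gel (y k \<otimes> ?p)) [i] = (\<lambda>n. (\<Theta> (gel (y k)) [i] n + \<Theta> (gel ?p) [i] n) mod int l ^ n)"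
    using coeff1_mult[OF k(1) p(1) i] by (simp add: fun_eq_iff)
  also have "\<dots> = (if i \<in> set (k # ks) then c else \<zero>\<^bsub>Zl l\<^esub>)"
    using k(2) p(2) Cons(2) Zl_mod[OF c] by (auto simp: Zl_simps fun_eq_iff)
  finally show ?case using p(1) k(1) by simp
qed

lemma foldr_delta:
  assumes "distinct ks" "y j \<in> carrier F" "\<And>k. k \<in> set ks \<Longrightarrow> k \<noteq> j \<Longrightarrow> y k = \<one>"
  shows "foldr (\<lambda>k z. y k \<otimes> z) ks \<one> = (if j \<in> set ks then y j else \<one>)"
  using assms(1,3)
proof (induction ks)
  case (Cons k ks)
  then have "foldr (\<lambda>k z. y k \<otimes> z) ks \<one> = (if j \<in> set ks then y j else \<one>)" by auto
  then show ?case using Cons(2,3) assms(2) by (cases "k = j") auto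
qed simp

text \<open>The basis vector \<open>X\<^sub>j\<close> has the expected coordinates. That no other family of coordinates
  describes the same class is where the one-letter coefficients enter: they vanish on the
  commutator subgroup and recover each exponent.\<close>

lemma H_coord_gen:
  assumes j: "j \<in> {1..r}"
  shows "H_coord l r F T x (H_X F T x j) = (\<lambda>i\<in>{1..r}. if i = j then \<one>\<^bsub>Zl l\<^esub> else \<zero>\<^bsub>Zl l\<^esub>)"
  unfolding H_coord_def H_X_def
proof (rule the_equality)
  let ?d = "\<lambda>i\<in>{1..r}. if i = j then \<one>\<^bsub>Zl l\<^esub> else \<zero>\<^bsub>Zl l\<^esub>"
  have "ordered_prod F r (\<lambda>i. Zl_pow F T (x i) (?d i)) = Zl_pow F T (x j) (?d j)"
    unfolding ordered_prod_def
  proof (subst foldr_delta[where j = j])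
    show "Zl_pow F T (x j) (?d j) \<in> carrier F"
      using gen_closed(1)[OF j] j by (simp add: Zl_pow_one)
    show "Zl_pow F T (x k) (?d k) = \<one>" if "k \<in> set [1..<Suc r]" "k \<noteq> j" for k
    proof -
      have "k \<in> {1..r}" using that(1) by auto
      then show ?thesis using that(2) gen_closed(1)[of k] by (simp add: Zl_pow_zero)
    qed
  qed (use j in \<open>auto simp: simp del: upt_Suc\<close>)
  then have "ordered_prod F r (\<lambda>i. Zl_pow F T (x i) (?d i)) = x j"
    using gen_closed(1)[OF j] j by (simp add: Zl_pow_one)
  then show "?d \<in> {1..r} \<rightarrow>\<^sub>E carrier (Zl l) \<and>
      lcs F T 2 #> x j = lcs F T 2 #> ordered_prod F r (\<lambda>i. Zl_pow F T (x i) (?d i))"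
    by auto
  fix a assume a: "a \<in> {1..r} \<rightarrow>\<^sub>E carrier (Zl l) \<and>
      lcs F T 2 #> x j = lcs F T 2 #> ordered_prod F r (\<lambda>i. Zl_pow F T (x i) (a i))"
  let ?p = "ordered_prod F r (\<lambda>i. Zl_pow F T (x i) (a i))"
  have ac: "a k \<in> carrier (Zl l)" if "k \<in> {1..r}" for k using a that by auto
  have "a i = ?d i" if i: "i \<in> {1..r}" for i
  proof -
    have p: "?p \<in> carrier F \<and> \<Theta> (gel ?p) [i] = (if i \<in> set [1..<Suc r] then a i else \<zero>\<^bsub>Zl l\<^esub>)"
      unfolding ordered_prod_def
    proof (rule coeff1_foldr[OF i _ ac[OF i]])
      fix k assume "k \<in> set [1..<Suc r]"
      then have k: "k \<in> {1..r}" by auto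
      show "Zl_pow F T (x k) (a k) \<in> carrier F" by (rule Zl_pow_closed[OF gen_closed(1)[OF k] ac[OF k]])
      show "\<Theta> (gel (Zl_pow F T (x k) (a k))) [i] = (if k = i then a i else \<zero>\<^bsub>Zl l\<^esub>)"
        using coeff1_Zl_pow[OF gen_closed(1)[OF k] ac[OF k] i] coeff1_gen[OF i k] ac[OF k] by auto
    qed simp
    have "x j \<in> lcs F T 2 #> ?p"
      using a F.rcos_self[OF gen_closed(1)[OF j] lcs_subgroup[of 2]] by simp
    then obtain u where u: "u \<in> lcs F T 2" "x j = u \<otimes> ?p" unfolding r_coset_def by blast
    have uc: "u \<in> carrier F" using u(1) lcs_carrier by blast
    have "\<Theta> (gel (x j)) [i] n = a i n" for n
      using coeff1_mult[OF uc conjunct1[OF p] i, of n] coeff1_lcs2[OF u(1) i] conjunct2[OF p] u(2) i Zl_mod[OF ac[OF i]]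
      by (simp add: Zl_simps del: upt_Suc)
    then show ?thesis using coeff1_gen[OF i j] i by (simp add: fun_eq_iff)
  qed
  then show "a = ?d" using a by (intro PiE_ext[of a "{1..r}" "\<lambda>_. carrier (Zl l)" ?d]) auto
qed

lemma H_emb_gen: "j \<in> {1..r} \<Longrightarrow> H_emb l r F T x (H_X F T x j) = tensor_X l r j"
  by (auto simp: H_emb_def H_coord_gen tensor_X_def length_Suc_conv intro!: restrict_ext)

text \<open>The map on \<open>H\<close> takes direct images of cosets, so triviality modulo \<open>F(2)\<close> puts the image
  inside the coset, and surjectivity of \<open>\<phi>\<close> makes it all of the coset.\<close>

lemma H_map_trivial:
  assumes \<phi>: "\<phi> \<in> top_auto F T" and ker: "\<And>f. f \<in> carrier F \<Longrightarrow> \<phi> f \<otimes> inv f \<in> lcs F T 2"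
    and h: "h \<in> carrier (H F T)"
  shows "H_map \<phi> h = h"
proof -
  have bij: "bij_betw \<phi> (carrier F) (carrier F)"
    using \<phi> by (auto simp: top_auto_def auto_def Bij_def)
  then have cl: "\<phi> f \<in> carrier F" if "f \<in> carrier F" for f using that by (auto simp: bij_betw_def)
  let ?L = "lcs F T 2"
  note L = lcs_subgroup[of 2]
  have same: "?L #> \<phi> f = ?L #> f" if f: "f \<in> carrier F" for f
  proof -
    have "\<phi> f = (\<phi> f \<otimes> inv f) \<otimes> f" using f cl[OF f] by (simp add: F.m_assoc)
    then have "\<phi> f \<in> ?L #> f" using ker[OF f] unfolding r_coset_def by blast
    then show ?thesis using F.repr_independence[OF _ f L] by simp
  qed
  have hc: "h \<in> rcosets ?L" using h by (simp add: H_def FactGroup_def)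
  have hF: "h \<subseteq> carrier F" using subgroup.rcosets_carrier[OF L F.group_axioms hc] .
  have "\<phi> ` h = h"
  proof (intro Set.equalityI subsetI)
    fix y assume "y \<in> \<phi> ` h"
    then obtain f where f: "f \<in> h" "y = \<phi> f" by blast
    have fc: "f \<in> carrier F" using f(1) hF by blast
    then have "h = ?L #> y" using rcoset_mem_iff[OF L hc fc] f same[OF fc] by simp
    then show "y \<in> h" using rcoset_mem_iff[OF L hc cl[OF fc]] f(2) by simp
  next
    fix y assume y: "y \<in> h"
    then have "y \<in> carrier F" using hF by blast
    then obtain f where f: "f \<in> carrier F" "y = \<phi> f" using bij unfolding bij_betw_def by blast
    have "h = ?L #> f" using rcoset_mem_iff[OF L hc cl[OF f(1)]] f y same[OF f(1)] by simp
    then have "f \<in> h" using rcoset_mem_iff[OF L hc f(1)] by simp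
    then show "y \<in> \<phi> ` h" using f(2) by blast
  qed
  then show ?thesis by (simp add: H_map_def)
qed

end


section \<open>Unipotent matrices\<close>

text \<open>When the products vanish, the entry of \<open>(Id + B)(Id + C)\<close> at \<open>(i, j)\<close> is what is linear
  in \<open>B\<close> and \<open>C\<close>: the Kronecker delta plus \<open>B(i, j) + C(i, j)\<close>.\<close>

lemma one_plus_matrix_mult:
  fixes R :: "'b ring" (structure) and r :: nat and B C :: "nat \<times> nat \<Rightarrow> 'b"
  defines "I \<equiv> \<lambda>B. \<lambda>(i, j)\<in>{1..r} \<times> {1..r}. (if i = j then \<one> else \<zero>) \<oplus> B (i, j)"
  assumes "ring R"
    and B: "\<And>i j. i \<in> {1..r} \<Longrightarrow> j \<in> {1..r} \<Longrightarrow> B (i, j) \<in> carrier R"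
    and C: "\<And>i j. i \<in> {1..r} \<Longrightarrow> j \<in> {1..r} \<Longrightarrow> C (i, j) \<in> carrier R"
    and neg: "\<And>i j. i \<in> {1..r} \<Longrightarrow> j \<in> {1..r} \<Longrightarrow> B (i, j) \<oplus> C (i, j) = \<zero>"
    and square: "\<And>i j k. i \<in> {1..r} \<Longrightarrow> k \<in> {1..r} \<Longrightarrow> j \<in> {1..r} \<Longrightarrow> B (i, k) \<otimes> C (k, j) = \<zero>"
  shows "I B \<otimes>\<^bsub>matrix_ring r R\<^esub> I C = \<one>\<^bsub>matrix_ring r R\<^esub>"
proof -
  interpret ring R by fact
  have entry: "(\<Oplus>k\<in>{1..r}. I B (i, k) \<otimes> I C (k, j)) = (if i = j then \<one> else \<zero>)"
    if i: "i \<in> {1..r}" and j: "j \<in> {1..r}" for i j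
  proof -
    let ?u = "\<lambda>k. if i = k then C (k, j) else \<zero>"
    let ?v = "\<lambda>k. if j = k then B (i, k) else \<zero>"
    let ?w = "\<lambda>k. if i = k then (if i = j then \<one> else \<zero>) else \<zero>"
    have cl: "?u \<in> {1..r} \<rightarrow> carrier R" "?v \<in> {1..r} \<rightarrow> carrier R" "?w \<in> {1..r} \<rightarrow> carrier R"
      using B[OF i] C[OF _ j] by auto
    have sing: "(\<Oplus>k\<in>{1..r}. if n = k then f k else \<zero>) = f n"
      if "n \<in> {1..r}" "f \<in> {1..r} \<rightarrow> carrier R" for n and f :: "nat \<Rightarrow> 'b"
      using add.finprod_singleton[OF that(1) _ that(2)] by (simp add: finsum_def)
    have "(\<Oplus>k\<in>{1..r}. I B (i, k) \<otimes> I C (k, j)) = (\<Oplus>k\<in>{1..r}. ?u k \<oplus> (?v k \<oplus> ?w k))"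
    proof (rule finsum_cong')
      fix k assume k: "k \<in> {1..r}"
      note c = B[OF i k] C[OF k j] B[OF i j] C[OF i j]
      have "I B (i, k) \<otimes> I C (k, j) =
          ((if i = k then \<one> else \<zero>) \<oplus> B (i, k)) \<otimes> ((if k = j then \<one> else \<zero>) \<oplus> C (k, j))"
        using i j k by (simp add: I_def)
      also have "\<dots> = ?u k \<oplus> (?v k \<oplus> ?w k)"
        using c square[OF i k j] by (cases "i = k"; cases "k = j") (auto simp: l_distr r_distr a_ac)
      finally show "I B (i, k) \<otimes> I C (k, j) = ?u k \<oplus> (?v k \<oplus> ?w k)" .
    qed (use B[OF i] C[OF _ j] i j in auto)
    also have "\<dots> = (\<Oplus>k\<in>{1..r}. ?u k) \<oplus> ((\<Oplus>k\<in>{1..r}. ?v k) \<oplus> (\<Oplus>k\<in>{1..r}. ?w k))"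
    proof -
      have "(\<lambda>k. ?v k \<oplus> ?w k) \<in> {1..r} \<rightarrow> carrier R" using cl by auto
      then show ?thesis using cl by (simp only: finsum_addf)
    qed
    also have "(\<Oplus>k\<in>{1..r}. ?u k) = C (i, j)"
      using sing[OF i, of "\<lambda>k. C (k, j)"] C[OF _ j] by auto
    also have "(\<Oplus>k\<in>{1..r}. ?v k) = B (i, j)"
      using sing[OF j, of "\<lambda>k. B (i, k)"] B[OF i] by auto
    also have "(\<Oplus>k\<in>{1..r}. ?w k) = (if i = j then \<one> else \<zero>)"
      using sing[OF i, of "\<lambda>k. if i = j then \<one> else \<zero>"] by auto
    also have "C (i, j) \<oplus> (B (i, j) \<oplus> (if i = j then \<one> else \<zero>)) = (if i = j then \<one> else \<zero>)"
      using B[OF i j] C[OF i j] neg[OF i j] by (simp add: a_assoc[symmetric] a_comm[of "C (i, j)"])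
    finally show ?thesis .
  qed
  show ?thesis
    unfolding matrix_ring_def using entry by (auto intro!: restrict_ext)
qed

lemma one_plus_matrix_unit:
  fixes R :: "'b ring" (structure) and B :: "nat \<times> nat \<Rightarrow> 'b"
  assumes "ring R"
    and B: "\<And>i j. i \<in> {1..r} \<Longrightarrow> j \<in> {1..r} \<Longrightarrow> B (i, j) \<in> carrier R"
    and square: "\<And>i j k. i \<in> {1..r} \<Longrightarrow> k \<in> {1..r} \<Longrightarrow> j \<in> {1..r} \<Longrightarrow> B (i, k) \<otimes> B (k, j) = \<zero>"
  shows "(\<lambda>(i, j)\<in>{1..r} \<times> {1..r}. (if i = j then \<one> else \<zero>) \<oplus> B (i, j)) \<in> Units (matrix_ring r R)"
proof -
  interpret ring R by fact
  let ?I = "\<lambda>B. \<lambda>(i, j)\<in>{1..r} \<times> {1..r}. (if i = j then \<one> else \<zero>) \<oplus> B (i, j)"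
  define C where "C p = \<ominus> B p" for p
  have C: "C (i, j) \<in> carrier R" if "i \<in> {1..r}" "j \<in> {1..r}" for i j
    using B[OF that] by (simp add: C_def)
  have "?I B \<otimes>\<^bsub>matrix_ring r R\<^esub> ?I C = \<one>\<^bsub>matrix_ring r R\<^esub>"
  proof (rule one_plus_matrix_mult[where B = B and C = C, OF ring_axioms B C])
    show "B (i, j) \<oplus> C (i, j) = \<zero>" if "i \<in> {1..r}" "j \<in> {1..r}" for i j
      using B[OF that] by (simp add: C_def r_neg)
    show "B (i, k) \<otimes> C (k, j) = \<zero>" if "i \<in> {1..r}" "k \<in> {1..r}" "j \<in> {1..r}" for i j k
      using B[OF that(1,2)] B[OF that(2,3)] square[OF that] by (simp add: C_def r_minus)
  qed
  moreover have "?I C \<otimes>\<^bsub>matrix_ring r R\<^esub> ?I B = \<one>\<^bsub>matrix_ring r R\<^esub>"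
  proof (rule one_plus_matrix_mult[where B = C and C = B, OF ring_axioms C B])
    show "C (i, j) \<oplus> B (i, j) = \<zero>" if "i \<in> {1..r}" "j \<in> {1..r}" for i j
      using B[OF that] by (simp add: C_def l_neg)
    show "C (i, k) \<otimes> B (k, j) = \<zero>" if "i \<in> {1..r}" "k \<in> {1..r}" "j \<in> {1..r}" for i j k
      using B[OF that(1,2)] B[OF that(2,3)] square[OF that] by (simp add: C_def l_minus)
  qed
  moreover have "?I B \<in> carrier (matrix_ring r R)" "?I C \<in> carrier (matrix_ring r R)"
    using B C by (auto simp: matrix_ring_def)
  ultimately show ?thesis unfolding Units_def by blast
qed


section \<open>The Magnus cocycle of an automorphism that acts trivially modulo \<open>F(m + 1)\<close>\<close>

context magnus
begin

lemma J_Suc: "J (Suc n) = ideal_prod A (J 1) (J n)"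
  using aug_power.simps(2)[of l F T n] unfolding aug_power_eq aug_ideal_eq .

text \<open>An anti-automorphism that preserves \<open>I\<close> maps \<open>I \<cdot> I\<^sup>n\<close> into \<open>I\<^sup>n \<cdot> I\<close>.\<close>

lemma bar_J: "\<alpha> \<in> J n \<Longrightarrow> bar F T \<alpha> \<in> J n"
proof (induction n arbitrary: \<alpha>)
  case 0
  then show ?case by (simp add: J_zero bar_closed)
next
  case (Suc n)
  have "\<alpha> \<in> ideal_prod A (J 1) (J n)" using Suc(2) by (simp only: J_Suc[of n])
  then show ?case
  proof induction
    case (prod i j)
    have i: "i \<in> carrier A" and j: "j \<in> carrier A" using prod J_closed by blast+
    have "bar F T i \<in> J 1"
      using prod(1) aug_bar[of i] bar_closed[OF i] unfolding aug_ideal_eq[symmetric] aug_ideal_def by simp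
    then show ?case
      using J_mult[OF Suc.IH[OF prod(2)], of "bar F T i" 1] by (simp add: bar_mult[OF i j])
  next
    case (sum s t)
    have "s \<in> ideal_prod A (J 1) (J n) \<Longrightarrow> s \<in> carrier A" for s
      using J_closed[of s "Suc n"] by (simp only: J_Suc[of n])
    then show ?case using sum J_add by (simp add: bar_add)
  qed
qed

lemma coset_eq_iff:
  assumes "\<alpha> \<in> carrier A" "\<beta> \<in> carrier A"
  shows "J n +>\<^bsub>A\<^esub> \<alpha> = J n +>\<^bsub>A\<^esub> \<beta> \<longleftrightarrow> \<alpha> \<ominus>\<^bsub>A\<^esub> \<beta> \<in> J n"
  using A.quotient_eq_iff_same_a_r_cos[OF J_ideal assms] by simp

lemma mem_coset:
  assumes "\<alpha> \<in> carrier A"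
  shows "\<beta> \<in> J n +>\<^bsub>A\<^esub> \<alpha> \<longleftrightarrow> \<beta> \<in> carrier A \<and> \<beta> \<ominus>\<^bsub>A\<^esub> \<alpha> \<in> J n"
proof
  assume "\<beta> \<in> J n +>\<^bsub>A\<^esub> \<alpha>"
  then obtain h where h: "h \<in> J n" "\<beta> = h \<oplus>\<^bsub>A\<^esub> \<alpha>" by (auto simp: a_r_coset_def')
  have hc: "h \<in> carrier A" by (rule J_closed[OF h(1)])
  then have "\<beta> \<ominus>\<^bsub>A\<^esub> \<alpha> = h" using assms by (simp add: h(2) A.minus_eq A.a_assoc A.r_neg)
  then show "\<beta> \<in> carrier A \<and> \<beta> \<ominus>\<^bsub>A\<^esub> \<alpha> \<in> J n" using h hc assms by simp
next
  assume b: "\<beta> \<in> carrier A \<and> \<beta> \<ominus>\<^bsub>A\<^esub> \<alpha> \<in> J n"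
  then have "\<beta> = (\<beta> \<ominus>\<^bsub>A\<^esub> \<alpha>) \<oplus>\<^bsub>A\<^esub> \<alpha>" using assms by (simp add: A.minus_eq A.a_assoc A.l_neg)
  then show "\<beta> \<in> J n +>\<^bsub>A\<^esub> \<alpha>" using b unfolding a_r_coset_def' by blast
qed

lemma bar_zero: "bar F T \<zero>\<^bsub>A\<^esub> = \<zero>\<^bsub>A\<^esub>"
  by (rule cga_ext) (auto simp: bar_closed bar_val cga_simps coset_inv_closed cga_zero_closed[unfolded cga_simps])

lemma bar_one: "bar F T \<one>\<^bsub>A\<^esub> = \<one>\<^bsub>A\<^esub>"
  using bar_cga_of[OF F.one_closed] by (simp add: gel_one)

lemma bar_minus:
  assumes "\<alpha> \<in> carrier A" "\<beta> \<in> carrier A"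
  shows "bar F T (\<alpha> \<ominus>\<^bsub>A\<^esub> \<beta>) = bar F T \<alpha> \<ominus>\<^bsub>A\<^esub> bar F T \<beta>"
proof -
  have "bar F T (\<alpha> \<ominus>\<^bsub>A\<^esub> \<beta>) \<oplus>\<^bsub>A\<^esub> bar F T \<beta> = bar F T (\<alpha> \<ominus>\<^bsub>A\<^esub> \<beta> \<oplus>\<^bsub>A\<^esub> \<beta>)"
    using assms by (simp add: bar_add)
  also have "\<alpha> \<ominus>\<^bsub>A\<^esub> \<beta> \<oplus>\<^bsub>A\<^esub> \<beta> = \<alpha>" using assms by (simp add: A.minus_eq A.a_assoc A.l_neg)
  finally have "bar F T \<alpha> = bar F T (\<alpha> \<ominus>\<^bsub>A\<^esub> \<beta>) \<oplus>\<^bsub>A\<^esub> bar F T \<beta>" by simp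
  then show ?thesis
    using bar_closed[OF A.minus_closed[OF assms]] bar_closed[OF assms(2)]
    by (simp add: A.minus_eq A.a_assoc A.r_neg)
qed

lemma bar_coset:
  assumes a: "\<alpha> \<in> carrier A"
  shows "bar F T ` (J n +>\<^bsub>A\<^esub> \<alpha>) = J n +>\<^bsub>A\<^esub> bar F T \<alpha>"
proof (intro Set.equalityI subsetI)
  fix \<gamma> assume "\<gamma> \<in> bar F T ` (J n +>\<^bsub>A\<^esub> \<alpha>)"
  then obtain \<beta> where b: "\<beta> \<in> carrier A" "\<beta> \<ominus>\<^bsub>A\<^esub> \<alpha> \<in> J n" "\<gamma> = bar F T \<beta>"
    using mem_coset[OF a] by blast
  have "\<gamma> \<ominus>\<^bsub>A\<^esub> bar F T \<alpha> \<in> J n" using bar_J[OF b(2)] by (simp only: b(3) bar_minus[OF b(1) a])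
  then show "\<gamma> \<in> J n +>\<^bsub>A\<^esub> bar F T \<alpha>" using mem_coset[OF bar_closed[OF a]] bar_closed[OF b(1)] b(3) by blast
next
  fix \<gamma> assume "\<gamma> \<in> J n +>\<^bsub>A\<^esub> bar F T \<alpha>"
  then have g: "\<gamma> \<in> carrier A" "\<gamma> \<ominus>\<^bsub>A\<^esub> bar F T \<alpha> \<in> J n" using mem_coset[OF bar_closed[OF a]] by blast+
  have "bar F T \<gamma> \<ominus>\<^bsub>A\<^esub> \<alpha> \<in> J n"
    using bar_J[OF g(2)] by (simp only: bar_minus[OF g(1) bar_closed[OF a]] bar_bar[OF a])
  then have "bar F T \<gamma> \<in> J n +>\<^bsub>A\<^esub> \<alpha>" using mem_coset[OF a] bar_closed[OF g(1)] by blast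
  then have "bar F T (bar F T \<gamma>) \<in> bar F T ` (J n +>\<^bsub>A\<^esub> \<alpha>)" by (rule imageI)
  then show "\<gamma> \<in> bar F T ` (J n +>\<^bsub>A\<^esub> \<alpha>)" by (simp only: bar_bar[OF g(1)])
qed

text \<open>Within \<open>I\<^sup>n\<close> the degree \<open>n\<close> part is a complete invariant modulo \<open>I\<^sup>n\<^sup>+\<^sup>1\<close>. This is the
  injectivity of the isomorphism on graded pieces.\<close>

lemma component_eq_iff:
  assumes a: "\<alpha> \<in> J n" and b: "\<beta> \<in> J n"
  shows "component r n (\<Theta> \<alpha>) = component r n (\<Theta> \<beta>) \<longleftrightarrow> \<alpha> \<ominus>\<^bsub>A\<^esub> \<beta> \<in> J (Suc n)"
proof -
  note ac = J_closed[OF a] and bc = J_closed[OF b]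
  have diff: "\<Theta> (\<alpha> \<ominus>\<^bsub>A\<^esub> \<beta>) w = \<zero>\<^bsub>Zl l\<^esub> \<longleftrightarrow> \<Theta> \<alpha> w = \<Theta> \<beta> w" if w: "w \<in> words r" for w
    unfolding coeff_minus[OF ac bc w] by (rule Z.r_right_minus_eq[OF coeff_closed[OF ac w] coeff_closed[OF bc w]])
  have "component r n (\<Theta> \<alpha>) = component r n (\<Theta> \<beta>) \<longleftrightarrow> (\<forall>w\<in>words r. length w = n \<longrightarrow> \<Theta> \<alpha> w = \<Theta> \<beta> w)"
    unfolding component_def by (auto simp: fun_eq_iff restrict_def)
  also have "\<dots> \<longleftrightarrow> (\<forall>w\<in>words r. length w < Suc n \<longrightarrow> \<Theta> \<alpha> w = \<Theta> \<beta> w)"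
    using a b unfolding J_def less_Suc_eq by auto
  also have "\<dots> \<longleftrightarrow> \<alpha> \<ominus>\<^bsub>A\<^esub> \<beta> \<in> J (Suc n)"
    using diff A.minus_closed[OF ac bc] unfolding J_def by auto
  finally show ?thesis .
qed

lemma Theta_gr_coset:
  assumes a: "\<alpha> \<in> J n"
  shows "Theta_gr r n \<Theta> (J (Suc n) +>\<^bsub>A\<^esub> \<alpha>) = component r n (\<Theta> \<alpha>)"
  unfolding Theta_gr_def
proof (rule the_elem_image_unique)
  note ac = J_closed[OF a]
  have "\<alpha> \<in> J (Suc n) +>\<^bsub>A\<^esub> \<alpha>"
    using mem_coset[OF ac] ac additive_subgroup.zero_closed[OF ideal.axioms(1)[OF J_ideal]]
    by (simp add: A.minus_eq A.r_neg)
  then show "J (Suc n) +>\<^bsub>A\<^esub> \<alpha> \<noteq> {}" by blast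
  fix \<beta> assume "\<beta> \<in> J (Suc n) +>\<^bsub>A\<^esub> \<alpha>"
  then have b: "\<beta> \<in> carrier A" "\<beta> \<ominus>\<^bsub>A\<^esub> \<alpha> \<in> J (Suc n)" using mem_coset[OF ac] by blast+
  have "\<beta> \<ominus>\<^bsub>A\<^esub> \<alpha> \<in> J n" using b(2) J_mono[of n "Suc n"] by auto
  then have "(\<beta> \<ominus>\<^bsub>A\<^esub> \<alpha>) \<oplus>\<^bsub>A\<^esub> \<alpha> \<in> J n" using a by (rule J_add)
  moreover have "(\<beta> \<ominus>\<^bsub>A\<^esub> \<alpha>) \<oplus>\<^bsub>A\<^esub> \<alpha> = \<beta>" using b(1) ac by (simp add: A.minus_eq A.a_assoc A.l_neg)
  ultimately have "\<beta> \<in> J n" by simp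
  then show "component r n (\<Theta> \<beta>) = component r n (\<Theta> \<alpha>)"
    using component_eq_iff[OF _ a] b(2) by blast
qed

lemma Theta_gr_inv:
  assumes a: "\<alpha> \<in> J n"
  shows "inv_into (gr l F T n) (Theta_gr r n \<Theta>) (component r n (\<Theta> \<alpha>)) = J (Suc n) +>\<^bsub>A\<^esub> \<alpha>"
proof (rule inv_into_f_eq)
  show "inj_on (Theta_gr r n \<Theta>) (gr l F T n)"
  proof (rule inj_onI)
    fix c d assume "c \<in> gr l F T n" "d \<in> gr l F T n" and eq: "Theta_gr r n \<Theta> c = Theta_gr r n \<Theta> d"
    then obtain \<beta> \<gamma> where b: "\<beta> \<in> J n" "c = J (Suc n) +>\<^bsub>A\<^esub> \<beta>" and g: "\<gamma> \<in> J n" "d = J (Suc n) +>\<^bsub>A\<^esub> \<gamma>"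
      unfolding gr_def aug_power_eq by auto
    have "\<beta> \<ominus>\<^bsub>A\<^esub> \<gamma> \<in> J (Suc n)"
      using eq Theta_gr_coset[OF b(1)] Theta_gr_coset[OF g(1)] component_eq_iff[OF b(1) g(1)] b(2) g(2) by simp
    then show "c = d" using coset_eq_iff[OF J_closed[OF b(1)] J_closed[OF g(1)]] b(2) g(2) by simp
  qed
  show "J (Suc n) +>\<^bsub>A\<^esub> \<alpha> \<in> gr l F T n" using a unfolding gr_def aug_power_eq by simp
  show "Theta_gr r n \<Theta> (J (Suc n) +>\<^bsub>A\<^esub> \<alpha>) = component r n (\<Theta> \<alpha>)" by (rule Theta_gr_coset[OF a])
qed

lemma fox_gr_coset:
  assumes a: "\<alpha> \<in> carrier A" and i: "i \<in> {1..r}"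
  shows "fox_gr l r F T x n i (J (Suc (Suc n)) +>\<^bsub>A\<^esub> \<alpha>) = J (Suc n) +>\<^bsub>A\<^esub> fox l r F T x i \<alpha>"
  unfolding fox_gr_def aug_power_eq
proof (rule the_elem_image_unique)
  have "\<alpha> \<in> J (Suc (Suc n)) +>\<^bsub>A\<^esub> \<alpha>"
    using mem_coset[OF a] a additive_subgroup.zero_closed[OF ideal.axioms(1)[OF J_ideal]]
    by (simp add: A.minus_eq A.r_neg)
  then show "J (Suc (Suc n)) +>\<^bsub>A\<^esub> \<alpha> \<noteq> {}" by blast
  fix \<beta> assume "\<beta> \<in> J (Suc (Suc n)) +>\<^bsub>A\<^esub> \<alpha>"
  then have b: "\<beta> \<in> carrier A" "\<beta> \<ominus>\<^bsub>A\<^esub> \<alpha> \<in> J (Suc (Suc n))" using mem_coset[OF a] by blast+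
  have "fox l r F T x i \<beta> \<ominus>\<^bsub>A\<^esub> fox l r F T x i \<alpha> \<in> J (Suc n)"
    using fox_J[OF b(2) i] by (simp only: fox_minus[OF b(1) a i])
  then show "J (n + 1) +>\<^bsub>A\<^esub> fox l r F T x i \<beta> = J (Suc n) +>\<^bsub>A\<^esub> fox l r F T x i \<alpha>"
    using coset_eq_iff[OF fox_closed[OF b(1) i] fox_closed[OF a i], of "Suc n"] by simp
qed

text \<open>Since \<open>X\<^sub>j\<close> is the expansion of \<open>x\<^sub>j - 1\<close>, the automorphism \<open>\<phi>\<^sup>*\<close> sends it to the
  expansion of \<open>\<phi>(x\<^sub>j) - 1\<close>.\<close>

lemma tensor_map_X:
  assumes \<phi>: "\<phi> \<in> top_auto F T" and j: "j \<in> {1..r}"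
  shows "tensor_map l F T \<Theta> \<phi> (tensor_X l r j) = \<Theta> (gel (\<phi> (x j)) \<ominus>\<^bsub>A\<^esub> \<one>\<^bsub>A\<^esub>)"
proof -
  have hom: "\<phi> \<in> hom F F" using \<phi> by (auto simp: top_auto_def auto_def)
  let ?m = "\<ominus>\<^bsub>Zl l\<^esub> \<one>\<^bsub>Zl l\<^esub>"
  \<comment> \<open>Written as a scalar multiple of \<open>1 \<in> F\<close>, the element \<open>-1\<close> is fixed by the induced map.\<close>
  have neg: "?m \<odot>\<^bsub>A\<^esub> \<one>\<^bsub>A\<^esub> = \<ominus>\<^bsub>A\<^esub> \<one>\<^bsub>A\<^esub>"
  proof (rule Theta_eqI)
    show "?m \<odot>\<^bsub>A\<^esub> \<one>\<^bsub>A\<^esub> \<in> carrier A" by (intro cga_smult_closed) simp_all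
    fix w assume w: "w \<in> words r"
    have "\<Theta> (?m \<odot>\<^bsub>A\<^esub> \<one>\<^bsub>A\<^esub>) w = ?m \<otimes>\<^bsub>Zl l\<^esub> \<Theta> \<one>\<^bsub>A\<^esub> w"
      using w Theta_smult[of ?m "\<one>\<^bsub>A\<^esub>"] by (simp add: tensor_simps(5))
    also have "\<dots> = \<ominus>\<^bsub>Zl l\<^esub> \<Theta> \<one>\<^bsub>A\<^esub> w"
      using coeff_closed[OF A.one_closed w] by (simp only: Z.l_minus Z.one_closed Z.l_one)
    finally show "\<Theta> (?m \<odot>\<^bsub>A\<^esub> \<one>\<^bsub>A\<^esub>) w = \<Theta> (\<ominus>\<^bsub>A\<^esub> \<one>\<^bsub>A\<^esub>) w"
      by (simp only: coeff_neg[OF A.one_closed w])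
  qed simp
  have "inv_into (carrier A) \<Theta> (tensor_X l r j) = gel (x j) \<ominus>\<^bsub>A\<^esub> \<one>\<^bsub>A\<^esub>"
    unfolding Theta_gen[OF j, symmetric]
    by (rule inv_into_f_f) (use Theta_bij gen_closed(2)[OF j] in \<open>auto simp: bij_betw_def\<close>)
  moreover have "cga_map F T \<phi> (gel (x j) \<ominus>\<^bsub>A\<^esub> \<one>\<^bsub>A\<^esub>) = gel (\<phi> (x j)) \<ominus>\<^bsub>A\<^esub> \<one>\<^bsub>A\<^esub>"
    unfolding A.minus_eq neg[symmetric] cga_map_linear[OF \<phi>]
    unfolding gel_one[symmetric] cga_map_cga_of[OF \<phi> F.one_closed] cga_map_cga_of[OF \<phi> gen_closed(1)[OF j]]
      hom_one[OF hom F.group_axioms F.group_axioms] ..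
  ultimately show ?thesis by (simp add: tensor_map_def)
qed

text \<open>For \<open>\<phi>\<close> trivial modulo \<open>F(2)\<close> the map induced on \<open>H\<close> is the identity, so the value of
  the Johnson map on \<open>X\<^sub>j\<close> is the Magnus expansion of \<open>\<phi>(x\<^sub>j) - x\<^sub>j\<close>.\<close>

lemma johnson_gen:
  assumes \<phi>: "\<phi> \<in> top_auto F T" and ker: "\<And>f. f \<in> carrier F \<Longrightarrow> \<phi> f \<otimes> inv f \<in> lcs F T 2"
    and j: "j \<in> {1..r}" and \<phi>x: "\<phi> (x j) \<in> carrier F"
  shows "johnson l r F T x \<Theta> \<phi> (H_X F T x j) = \<Theta> (gel (\<phi> (x j)) \<ominus>\<^bsub>A\<^esub> gel (x j))"
proof -
  have HX: "H_X F T x j \<in> carrier (H F T)"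
    using F.rcosetsI[OF lcs_carrier gen_closed(1)[OF j]] by (simp add: H_X_def H_def FactGroup_def)
  have triv: "H_map \<phi> h = h" if "h \<in> carrier (H F T)" for h by (rule H_map_trivial[OF \<phi> ker that])
  have "inj_on (H_map \<phi>) (carrier (H F T))" using triv by (auto intro!: inj_onI)
  then have "inv_into (carrier (H F T)) (H_map \<phi>) (H_X F T x j) = H_X F T x j"
    using HX triv[OF HX] by (rule inv_into_f_eq)
  then have "johnson l r F T x \<Theta> \<phi> (H_X F T x j) =
      \<Theta> (gel (\<phi> (x j)) \<ominus>\<^bsub>A\<^esub> \<one>\<^bsub>A\<^esub>) \<ominus>\<^bsub>TH\<^esub> \<Theta> (gel (x j) \<ominus>\<^bsub>A\<^esub> \<one>\<^bsub>A\<^esub>)"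
    unfolding johnson_def by (simp add: H_emb_gen[OF j] tensor_map_X[OF \<phi> j] Theta_gen[OF j])
  also have "\<dots> = \<Theta> ((gel (\<phi> (x j)) \<ominus>\<^bsub>A\<^esub> \<one>\<^bsub>A\<^esub>) \<ominus>\<^bsub>A\<^esub> (gel (x j) \<ominus>\<^bsub>A\<^esub> \<one>\<^bsub>A\<^esub>))"
    using gen_closed(2)[OF j] cga_of_closed[OF \<phi>x]
    by (simp only: A.minus_eq TH.minus_eq Theta.hom_add Theta.hom_a_inv A.a_closed A.a_inv_closed A.one_closed)
  also have "(gel (\<phi> (x j)) \<ominus>\<^bsub>A\<^esub> \<one>\<^bsub>A\<^esub>) \<ominus>\<^bsub>A\<^esub> (gel (x j) \<ominus>\<^bsub>A\<^esub> \<one>\<^bsub>A\<^esub>) = gel (\<phi> (x j)) \<ominus>\<^bsub>A\<^esub> gel (x j)"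
  proof -
    have "p \<ominus>\<^bsub>A\<^esub> e \<ominus>\<^bsub>A\<^esub> (q \<ominus>\<^bsub>A\<^esub> e) = p \<ominus>\<^bsub>A\<^esub> q" if "p \<in> carrier A" "q \<in> carrier A" "e \<in> carrier A" for p q e
    proof -
      have "p \<ominus>\<^bsub>A\<^esub> e \<ominus>\<^bsub>A\<^esub> (q \<ominus>\<^bsub>A\<^esub> e) = p \<oplus>\<^bsub>A\<^esub> \<ominus>\<^bsub>A\<^esub> q \<oplus>\<^bsub>A\<^esub> (e \<oplus>\<^bsub>A\<^esub> \<ominus>\<^bsub>A\<^esub> e)"
        using that by (simp only: A.minus_eq A.minus_add A.minus_minus A.a_ac A.a_closed A.a_inv_closed)
      then show ?thesis using that by (simp add: A.r_neg A.minus_eq)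
    qed
    then show ?thesis using gen_closed(2)[OF j] cga_of_closed[OF \<phi>x] by simp
  qed
  finally show ?thesis .
qed

text \<open>Both matrices have at \<open>(i, j)\<close> the class of the Kronecker delta plus the bar of the
  \<open>i\<close>-th Fox derivative of \<open>\<phi>(x\<^sub>j) - x\<^sub>j\<close>: the cocycle because the derivatives of \<open>x\<^sub>j\<close> are
  Kronecker deltas, the other one because \<open>\<phi>(x\<^sub>j) - x\<^sub>j\<close> lies in \<open>I\<^sup>m\<^sup>+\<^sup>1\<close> and represents
  the class of \<open>\<tau>(X\<^sub>j)\<close> there. The entries besides the delta lie in \<open>I\<^sup>m\<close>, and
  \<open>2 m \<ge> m + 1\<close> makes their products vanish modulo \<open>I\<^sup>m\<^sup>+\<^sup>1\<close>.\<close>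

theorem magnus_cocycle_johnson:
  assumes \<phi>: "\<phi> \<in> top_auto F T" and m: "m \<ge> 1"
    and ker: "\<And>f. f \<in> carrier F \<Longrightarrow> \<phi> f \<otimes> inv f \<in> lcs F T (m + 1)"
  shows "magnus_cocycle_mod l r F T x m \<phi> \<in> Units (matrix_ring r (cga_mod l F T (m + 1)))"
    and "magnus_cocycle_mod l r F T x m \<phi> =
      \<one>\<^bsub>matrix_ring r (cga_mod l F T (m + 1))\<^esub> \<oplus>\<^bsub>matrix_ring r (cga_mod l F T (m + 1))\<^esub>
      bar_matrix r F T (fox_matrix l r F T x \<Theta> m (johnson_component l r F T x \<Theta> m \<phi>))"
proof -
  let ?I = "J (Suc m)"
  let ?\<pi> = "\<lambda>\<alpha>. ?I +>\<^bsub>A\<^esub> \<alpha>"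
  interpret Q: ring "A Quot ?I" by (rule ideal.quotient_is_ring[OF J_ideal])
  interpret \<pi>: ring_hom_ring A "A Quot ?I" ?\<pi> by (rule ideal.rcos_ring_hom_ring[OF J_ideal])
  have cl: "\<phi> f \<in> carrier F" if "f \<in> carrier F" for f
    using \<phi> that by (auto simp: top_auto_def auto_def hom_def)
  have ker2: "\<phi> f \<otimes> inv f \<in> lcs F T 2" if "f \<in> carrier F" for f
    using ker[OF that] lcs_antimono[of 2 "m + 1"] m by auto
  define u where "u j = gel (\<phi> (x j)) \<ominus>\<^bsub>A\<^esub> gel (x j)" for j
  have u: "u j \<in> J (Suc m)" if j: "j \<in> {1..r}" for j
  proof -
    let ?g = "\<phi> (x j) \<otimes> inv x j"
    have xj: "x j \<in> carrier F" "\<phi> (x j) \<in> carrier F" using gen_closed(1)[OF j] cl by auto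
    have "?g \<in> dimsub (Suc m)" using ker[OF xj(1)] lcs_subset_dimsub[of m] by auto
    then have "gel ?g \<ominus>\<^bsub>A\<^esub> \<one>\<^bsub>A\<^esub> \<in> J (Suc m)" unfolding dimsub_def by blast
    then have "(gel ?g \<ominus>\<^bsub>A\<^esub> \<one>\<^bsub>A\<^esub>) \<otimes>\<^bsub>A\<^esub> gel (x j) \<in> J (Suc m)" by (rule J_right[OF _ cga_of_closed[OF xj(1)]])
    moreover have "gel ?g \<otimes>\<^bsub>A\<^esub> gel (x j) = gel (\<phi> (x j))"
      using xj by (simp add: F.m_assoc flip: cga_of_mult)
    then have "(gel ?g \<ominus>\<^bsub>A\<^esub> \<one>\<^bsub>A\<^esub>) \<otimes>\<^bsub>A\<^esub> gel (x j) = u j"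
      using xj cga_of_closed[of ?g] cga_of_closed[OF xj(1)] by (simp add: u_def A.minus_eq A.l_distr A.l_minus)
    ultimately show ?thesis by simp
  qed
  have uc: "u j \<in> carrier A" if "j \<in> {1..r}" for j by (rule J_closed[OF u[OF that]])
  define B where "B = (\<lambda>(i, j). bar F T (fox l r F T x i (u j)))"
  have B: "B (i, j) \<in> J m" if "i \<in> {1..r}" "j \<in> {1..r}" for i j
    unfolding B_def prod.case by (rule bar_J[OF fox_J[OF u[OF that(2)] that(1)]])
  have Bc: "B (i, j) \<in> carrier A" if "i \<in> {1..r}" "j \<in> {1..r}" for i j
    by (rule J_closed[OF B[OF that]])
  have cocycle: "magnus_cocycle l r F T x \<phi> (i, j) = (if i = j then \<one>\<^bsub>A\<^esub> else \<zero>\<^bsub>A\<^esub>) \<oplus>\<^bsub>A\<^esub> B (i, j)"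
    if i: "i \<in> {1..r}" and j: "j \<in> {1..r}" for i j
  proof -
    let ?f = "\<lambda>\<alpha>. fox l r F T x i \<alpha>"
    have g: "gel (\<phi> (x j)) \<in> carrier A" "gel (x j) \<in> carrier A"
      using cga_of_closed[OF cl[OF gen_closed(1)[OF j]]] gen_closed(2)[OF j] by auto
    have "?f (u j) = ?f (gel (\<phi> (x j))) \<ominus>\<^bsub>A\<^esub> ?f (gel (x j))" unfolding u_def by (rule fox_minus[OF g i])
    then have "B (i, j) = bar F T (?f (gel (\<phi> (x j)))) \<ominus>\<^bsub>A\<^esub> bar F T (?f (gel (x j)))"
      unfolding B_def by (simp add: bar_minus fox_closed[OF g(1) i] fox_closed[OF g(2) i])
    also have "bar F T (?f (gel (x j))) = (if i = j then \<one>\<^bsub>A\<^esub> else \<zero>\<^bsub>A\<^esub>)"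
      by (simp add: fox_gen[OF i j] bar_one bar_zero)
    finally have "B (i, j) = bar F T (?f (gel (\<phi> (x j)))) \<ominus>\<^bsub>A\<^esub> (if i = j then \<one>\<^bsub>A\<^esub> else \<zero>\<^bsub>A\<^esub>)" .
    moreover have "e \<oplus>\<^bsub>A\<^esub> (p \<ominus>\<^bsub>A\<^esub> e) = p" if "p \<in> carrier A" "e \<in> carrier A" for p e
    proof -
      have "e \<oplus>\<^bsub>A\<^esub> (p \<ominus>\<^bsub>A\<^esub> e) = p \<oplus>\<^bsub>A\<^esub> (e \<oplus>\<^bsub>A\<^esub> \<ominus>\<^bsub>A\<^esub> e)"
        using that by (simp only: A.minus_eq A.a_ac A.a_closed A.a_inv_closed)
      then show ?thesis using that by (simp add: A.r_neg)
    qed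
    ultimately show ?thesis
      using i j bar_closed[OF fox_closed[OF g(1) i]] by (simp add: magnus_cocycle_def)
  qed
  have lhs: "magnus_cocycle_mod l r F T x m \<phi> = (\<lambda>(i, j)\<in>{1..r} \<times> {1..r}.
      (if i = j then \<one>\<^bsub>A Quot ?I\<^esub> else \<zero>\<^bsub>A Quot ?I\<^esub>) \<oplus>\<^bsub>A Quot ?I\<^esub> ?\<pi> (B (i, j)))"
    unfolding magnus_cocycle_mod_def aug_power_eq
  proof (rule restrict_ext)
    fix p assume p: "p \<in> {1..r} \<times> {1..r}"
    obtain i j where ij: "p = (i, j)" by (cases p)
    have "?\<pi> (magnus_cocycle l r F T x \<phi> (i, j)) = ?\<pi> (if i = j then \<one>\<^bsub>A\<^esub> else \<zero>\<^bsub>A\<^esub>) \<oplus>\<^bsub>A Quot ?I\<^esub> ?\<pi> (B (i, j))"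
      using cocycle[of i j] Bc[of i j] p ij by simp
    also have "?\<pi> (if i = j then \<one>\<^bsub>A\<^esub> else \<zero>\<^bsub>A\<^esub>) = (if i = j then \<one>\<^bsub>A Quot ?I\<^esub> else \<zero>\<^bsub>A Quot ?I\<^esub>)"
      using \<pi>.hom_one \<pi>.hom_zero by simp
    finally show "J (m + 1) +>\<^bsub>A\<^esub> magnus_cocycle l r F T x \<phi> p =
        (case p of (i, j) \<Rightarrow> (if i = j then \<one>\<^bsub>A Quot ?I\<^esub> else \<zero>\<^bsub>A Quot ?I\<^esub>) \<oplus>\<^bsub>A Quot ?I\<^esub> ?\<pi> (B (i, j)))"
      by (simp add: ij)
  qed
  have johnson: "bar_matrix r F T (fox_matrix l r F T x \<Theta> m (johnson_component l r F T x \<Theta> m \<phi>)) (i, j) = ?\<pi> (B (i, j))"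
    if i: "i \<in> {1..r}" and j: "j \<in> {1..r}" for i j
  proof -
    have "johnson_component l r F T x \<Theta> m \<phi> (H_X F T x j) = component r (m + 1) (\<Theta> (u j))"
      unfolding johnson_component_def u_def
      by (subst johnson_gen[OF \<phi> ker2 j cl[OF gen_closed(1)[OF j]]]) simp_all
    then have "inv_into (gr l F T (m + 1)) (Theta_gr r (m + 1) \<Theta>) (johnson_component l r F T x \<Theta> m \<phi> (H_X F T x j))
        = J (Suc (Suc m)) +>\<^bsub>A\<^esub> u j"
      using Theta_gr_inv[OF u[OF j]] by simp
    then have "fox_matrix l r F T x \<Theta> m (johnson_component l r F T x \<Theta> m \<phi>) (i, j) = ?\<pi> (fox l r F T x i (u j))"
      using i j fox_gr_coset[OF uc[OF j] i, of m] by (simp add: fox_matrix_def)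
    then show ?thesis
      using i j bar_coset[OF fox_closed[OF uc[OF j] i], of "Suc m"] by (simp add: bar_matrix_def B_def)
  qed
  have Q_eq: "cga_mod l F T (m + 1) = A Quot ?I" by (simp only: aug_power_eq Suc_eq_plus1)
  show "magnus_cocycle_mod l r F T x m \<phi> =
      \<one>\<^bsub>matrix_ring r (cga_mod l F T (m + 1))\<^esub> \<oplus>\<^bsub>matrix_ring r (cga_mod l F T (m + 1))\<^esub>
      bar_matrix r F T (fox_matrix l r F T x \<Theta> m (johnson_component l r F T x \<Theta> m \<phi>))"
    unfolding lhs Q_eq using johnson by (auto simp: matrix_ring_def intro!: restrict_ext)
  show "magnus_cocycle_mod l r F T x m \<phi> \<in> Units (matrix_ring r (cga_mod l F T (m + 1)))"
    unfolding lhs Q_eq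
  proof (rule one_plus_matrix_unit[OF Q.ring_axioms, where B = "\<lambda>p. ?\<pi> (B p)"])
    show "?\<pi> (B (i, j)) \<in> carrier (A Quot ?I)" if "i \<in> {1..r}" "j \<in> {1..r}" for i j
      by (rule \<pi>.hom_closed[OF Bc[OF that]])
    show "?\<pi> (B (i, k)) \<otimes>\<^bsub>A Quot ?I\<^esub> ?\<pi> (B (k, j)) = \<zero>\<^bsub>A Quot ?I\<^esub>"
      if i: "i \<in> {1..r}" and k: "k \<in> {1..r}" and j: "j \<in> {1..r}" for i j k
    proof -
      have "B (i, k) \<otimes>\<^bsub>A\<^esub> B (k, j) \<in> J (m + m)" by (rule J_mult[OF B[OF i k] B[OF k j]])
      then have BB: "B (i, k) \<otimes>\<^bsub>A\<^esub> B (k, j) \<in> ?I" using J_mono[of "Suc m" "m + m"] m by auto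
      have "?\<pi> (B (i, k)) \<otimes>\<^bsub>A Quot ?I\<^esub> ?\<pi> (B (k, j)) = ?\<pi> (B (i, k) \<otimes>\<^bsub>A\<^esub> B (k, j))"
        using \<pi>.hom_mult[OF Bc[OF i k] Bc[OF k j]] by simp
      also have "\<dots> = ?\<pi> \<zero>\<^bsub>A\<^esub>"
        using coset_eq_iff[OF J_closed[OF BB] A.zero_closed, of "Suc m"] BB J_closed[OF BB]
        by (simp add: A.minus_eq)
      also have "\<dots> = \<zero>\<^bsub>A Quot ?I\<^esub>" by (rule \<pi>.hom_zero)
      finally show ?thesis .
    qed
  qed
qed

end


theorem proposition4p2p4:
  fixes l r m :: nat
    and F :: "'a monoid" and T :: "'a topology" and x :: "nat \<Rightarrow> 'a"
    and P :: "nat \<Rightarrow> complex" and b :: complex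
    and \<iota> :: "'a \<Rightarrow> complex fls \<Rightarrow> complex fls"
    and Ih :: "(complex \<Rightarrow> complex) \<Rightarrow> 'a \<Rightarrow> 'a"
    and \<Theta> :: "'a cga \<Rightarrow> tensor"
    and g :: "complex \<Rightarrow> complex"
  assumes "Factorial_Ring.prime l" and "r \<ge> 2"
    and "free_pro_l_group l r F T x"
    and "branch_points r P" and "b \<notin> P ` {1..r}"
    and "pi1_identification l r P b F T x \<iota>"
    and "ihara_representation l r P b F T x \<iota> Ih"
    and "magnus_isomorphism l r F T x \<Theta>"
    and "m \<ge> 1" and "g \<in> Gal_filtration r P F T Ih m"
  shows "magnus_cocycle_mod l r F T x m (Ih g)
           \<in> Units (matrix_ring r (cga_mod l F T (m + 1))) \<and>
         magnus_cocycle_mod l r F T x m (Ih g) =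
           \<one>\<^bsub>matrix_ring r (cga_mod l F T (m + 1))\<^esub> \<oplus>\<^bsub>matrix_ring r (cga_mod l F T (m + 1))\<^esub>
           bar_matrix r F T
             (fox_matrix l r F T x \<Theta> m (johnson_component l r F T x \<Theta> m (Ih g)))"
proof -
  interpret magnus l F T r x \<Theta>
    using assms(1,3,8) prime_gt_1_nat by unfold_locales (auto simp: free_pro_l_group_def)
  have "Ih g \<in> top_auto F T"
    using assms(7,10) by (auto simp: ihara_representation_def P_group_def Gal_filtration_def)
  moreover have "Ih g f \<otimes>\<^bsub>F\<^esub> inv\<^bsub>F\<^esub> f \<in> lcs F T (m + 1)" if "f \<in> carrier F" for f
    using assms(10) that by (auto simp: Gal_filtration_def)
  ultimately show ?thesis using magnus_cocycle_johnson[of "Ih g" m] assms(9) by blast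
qed

end
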